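(* Let $0<k<n$ be integers, let $\alpha\ge0$, let $\Omega\subset\mathbb R^n$ be a bounded domain, and let $f\in C^2(\overline\Omega\times\mathbb R\times\mathbb R^n)$ with $f>0$. Suppose that $u\in C^4(\Omega)\cap C^2(\overline\Omega)$ is a $(k-1)$-admissible solution of the Dirichlet problem $$\sigma_k(\eta)+\alpha\,\sigma_{k-1}(\eta)=f(x,u,Du)\ \text{ in }\Omega,\qquad u=0\ \text{ on }\partial\Omega,$$ where $\eta=\eta(x)$ is the vector of eigenvalues of $(\Delta u)I-D^2u$ at $x$. Then $$(-u)\,|D^2u|\le C\quad\text{in }\Omega,$$ where $C$ depends only on $n$, $k$, $|f|_{C^2}$ and $|u|_{C^1}$.
   Context: For $\lambda\in\mathbb R^n$, $\sigma_k(\lambda)=\sum_{1\le i_1<\cdots<i_k\le n}\lambda_{i_1}\cdots\lambda_{i_k}$ is the $k$-th elementary symmetric function, with $\sigma_0=1$. For a $C^2$ function $u$, let $\lambda(x)=(\lambda_1,\dots,\lambda_n)$ be the eigenvalues of $D^2u(x)$ and set $\eta_i=\sum_{j\ne i}\lambda_j$; then $\eta=(\eta_1,\dots,\eta_n)$ are the eigenvalues of the matrix $(\Delta u)I-D^2u$. A function $u\in C^2(\Omega)$ is called $l$-admissible if for every $x\in\Omega$ one has $\lambda(x)\in\Gamma_l'=\{\lambda\in\mathbb R^n:\sigma_j(\eta)>0,\ j=1,\dots,l\}$ (no condition when $l=0$). $|f|_{C^2}$ and $|u|_{C^1}$ denote the $C^2$ norm of $f$ and the $C^1$ norm of $u$.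 *)

theory Defs
  imports "HOL-Analysis.Analysis"
begin

section \<open>Classical differentiability classes and norms\<close>

text \<open>Partial derivatives are indexed by lists of basis vectors (the directions in which one
  differentiates, the head of the list being the last one) rather than by multi-indices.\<close>

primrec partial_deriv ::
  "'a::euclidean_space list \<Rightarrow> ('a \<Rightarrow> real) \<Rightarrow> 'a \<Rightarrow> real" where
  "partial_deriv [] u = u"
| "partial_deriv (b # bs) u = (\<lambda>x. frechet_derivative (partial_deriv bs u) (at x) b)"

definition directions :: "nat \<Rightarrow> 'a::euclidean_space list set" where
  "directions m = {bs. set bs \<subseteq> Basis \<and> length bs \<le> m}"

text \<open>The next two definitions are meant for open \<open>S\<close>. \<open>Ck_closure m S u\<close> says that
  \<open>u\<close> is of class \<open>C\<^sup>m\<close> on \<open>S\<close> and that all its derivatives of order at most \<open>m\<close> extend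
  continuously to the closure of \<open>S\<close>, with \<open>u\<close> itself being its own extension.\<close>

definition Ck_on :: "nat \<Rightarrow> 'a::euclidean_space set \<Rightarrow> ('a \<Rightarrow> real) \<Rightarrow> bool" where
  "Ck_on m S u \<longleftrightarrow>
     (\<forall>bs \<in> directions m. continuous_on S (partial_deriv bs u) \<and>
        (length bs < m \<longrightarrow> partial_deriv bs u differentiable_on S))"

definition Ck_closure :: "nat \<Rightarrow> 'a::euclidean_space set \<Rightarrow> ('a \<Rightarrow> real) \<Rightarrow> bool" where
  "Ck_closure m S u \<longleftrightarrow>
     Ck_on m S u \<and> continuous_on (closure S) u \<and>
     (\<forall>bs \<in> directions m.
        \<exists>g. continuous_on (closure S) g \<and> (\<forall>x\<in>S. g x = partial_deriv bs u x))"

text \<open>The sum of the suprema of all derivatives of order at most \<open>m\<close>; a mixed derivative is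
  counted once for each order of differentiation. Meaningful only if these derivatives are
  bounded on \<open>S\<close>.\<close>

definition Ck_norm :: "nat \<Rightarrow> 'a::euclidean_space set \<Rightarrow> ('a \<Rightarrow> real) \<Rightarrow> real" where
  "Ck_norm m S u = (\<Sum>bs \<in> directions m. SUP x\<in>S. \<bar>partial_deriv bs u x\<bar>)"

definition gradient :: "(real^'n \<Rightarrow> real) \<Rightarrow> real^'n \<Rightarrow> real^'n" where
  "gradient u x = (\<chi> i. partial_deriv [axis i 1] u x)"

definition hessian :: "(real^'n \<Rightarrow> real) \<Rightarrow> real^'n \<Rightarrow> real^'n^'n" where
  "hessian u x = (\<chi> i j. partial_deriv [axis i 1, axis j 1] u x)"

definition laplacian :: "(real^'n \<Rightarrow> real) \<Rightarrow> real^'n \<Rightarrow> real" where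
  "laplacian u x = trace (hessian u x)"

section \<open>Eigenvalues and elementary symmetric functions\<close>

text \<open>The eigenvalues with algebraic multiplicity, in an unspecified order. Such a vector
  exists when \<open>A\<close> is symmetric, the only case of interest here; only symmetric functions
  of it are ever used.\<close>

definition eigenvalues :: "real^'n^'n \<Rightarrow> real^'n" where
  "eigenvalues A = (SOME lam. \<forall>t. det (mat t - A) = (\<Prod>i\<in>UNIV. t - lam $ i))"

definition sigma :: "nat \<Rightarrow> real^'n \<Rightarrow> real" where
  "sigma k lam = (\<Sum>I | card I = k. \<Prod>i\<in>I. lam $ i)"

definition eta :: "real^'n \<Rightarrow> real^'n" where
  "eta lam = (\<chi> i. \<Sum>j \<in> UNIV - {i}. lam $ j)"

definition Gamma' :: "nat \<Rightarrow> (real^'n) set" where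
  "Gamma' l = {lam. \<forall>j\<in>{1..l}. sigma j (eta lam) > 0}"

definition admissible :: "nat \<Rightarrow> (real^'n) set \<Rightarrow> (real^'n \<Rightarrow> real) \<Rightarrow> bool" where
  "admissible l \<Omega> u \<longleftrightarrow>
     Ck_on 2 \<Omega> u \<and> (\<forall>x\<in>\<Omega>. eigenvalues (hessian u x) \<in> Gamma' l)"

definition eta_at :: "(real^'n \<Rightarrow> real) \<Rightarrow> real^'n \<Rightarrow> real^'n" where
  "eta_at u x = eigenvalues (mat (laplacian u x) - hessian u x)"

section \<open>The data of the Dirichlet problem\<close>

definition bounded_domain :: "(real^'n) set \<Rightarrow> bool" where
  "bounded_domain \<Omega> \<longleftrightarrow> open \<Omega> \<and> connected \<Omega> \<and> \<Omega> \<noteq> {} \<and> bounded \<Omega>"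

definition dirichlet_solution ::
  "nat \<Rightarrow> real \<Rightarrow> (real^'n) set \<Rightarrow> ((real^'n) \<times> real \<times> (real^'n) \<Rightarrow> real) \<Rightarrow>
   (real^'n \<Rightarrow> real) \<Rightarrow> bool" where
  "dirichlet_solution k \<alpha> \<Omega> f u \<longleftrightarrow>
     (\<forall>x\<in>\<Omega>. sigma k (eta_at u x) + \<alpha> * sigma (k - 1) (eta_at u x)
               = f (x, u x, gradient u x)) \<and>
     (\<forall>x\<in>frontier \<Omega>. u x = 0)"

text \<open>A function in \<open>C\<^sup>2\<close> of \<open>closure \<Omega> \<times> \<real> \<times> \<real>\<^sup>n\<close> need not have bounded derivatives, so its
  norm is taken over a bounded set of \<open>(x, z, p)\<close>. With \<open>R\<close> larger than the \<open>C\<^sup>1\<close> norm of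
  \<open>u\<close>, all the points \<open>(x, u x, gradient u x)\<close> lie in this set. Taking \<open>\<Omega>\<close> instead of its
  closure does not change the suprema.\<close>

definition C2_norm_data ::
  "(real^'n) set \<Rightarrow> real \<Rightarrow> ((real^'n) \<times> real \<times> (real^'n) \<Rightarrow> real) \<Rightarrow> real" where
  "C2_norm_data \<Omega> R f = Ck_norm 2 (\<Omega> \<times> {-R..R} \<times> cball 0 R) f"

end

(* The entries eta_1, ..., eta_n, alpha form a vector of the Garding cone Gamma_k of R^(n+1), and the
   left-hand side of the equation is its k-th elementary symmetric function. Superlevel sets in that
   cone are convex, and since k < n their normals, expressed through the eigenvalues of D^2 u, are
   uniformly elliptic; moreover moving by t in the direction (1, ..., 1, 0) raises the function by at
   least t^k. Freezing the normal at x therefore gives an elliptic operator with constant coefficients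
   whose value on D^2 u(y) - D^2 u(x) is at least -C |f(y) - f(x)|^(1/k), with no dependence on inf f
   or on alpha.

   Hence second differences of u are almost subsolutions. At a maximum of the second difference of
   step h, Savin's measure estimate for nonnegative supersolutions forces it to be almost maximal at
   three equidistant points, so the maximum for step h is at most the one for step 2h plus an error
   that is summable over dyadic scales. This bounds the eigenvalues of D^2 u from above by |Du|, and as
   the trace is positive when k > 1 (for k = 1 the equation is linear and the argument applies to -u as
   well) it bounds |D^2 u|. The dependence of f on Du costs a factor |D^2 u|^(1/k), which is absorbed
   by maximizing the Hessian times the distance to the boundary of a small ball. Finally such a ball
   around x may have radius comparable to -u(x), because u vanishes on the boundary and |Du| is bounded. *)

theory Submission
  imports Defs
begin

section \<open>Elementary symmetric functions\<close>

text \<open>The obstacle is degeneracy. A constant blind to inf f can treat f^(1/k) only as a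
  Hoelder function of exponent 1/k, so the equation is compared at two points and never
  differentiated; a step h then costs h^(1/k), which sums geometrically. Keeping \<alpha> as an
  entry frees the constants from it, because it cancels when two Hessians are compared. The
  ellipticity constant 1/(n+1) comes from testing the normal with the vector whose entries are 1
  except for one entry -1/n and for 0 in place of \<alpha>; it lies in the cone since k < n. Two
  Hessians have no common eigenframe, but the diagonal of one in the frame of the other is a doubly
  stochastic average of its eigenvalues, and a rearrangement argument compares these. Three points
  appear because the second difference of step 2h is the average of three of step h with weights 1,
  2, 1, and a bad set of small measure cannot meet every such triple. A penalty of size m / r^2,
  with m a bound for |D^2 u|, keeps the maximum interior. Its cost m h^2 / r^2 involves the unknown
  m, but with a small factor once the first step is a small fixed fraction of r.\<close>

definition esf :: "nat \<Rightarrow> 'a set \<Rightarrow> ('a \<Rightarrow> real) \<Rightarrow> real" where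
  "esf k S x = (\<Sum>T | T \<subseteq> S \<and> card T = k. \<Prod>i\<in>T. x i)"

lemma esf_0 [simp]: "finite S \<Longrightarrow> esf 0 S x = 1"
proof -
  assume "finite S"
  then have "{T. T \<subseteq> S \<and> card T = 0} = {{}}"
    using finite_subset by fastforce
  then show ?thesis by (simp add: esf_def)
qed

lemma esf_empty_Suc [simp]: "esf (Suc k) {} x = 0"
  by (simp add: esf_def sum.neutral)

lemma esf_insert:
  assumes "finite S" "a \<notin> S"
  shows "esf (Suc k) (insert a S) x = esf (Suc k) S x + x a * esf k S x"
proof -
  let ?A = "{T. T \<subseteq> S \<and> card T = Suc k}"
  let ?B = "{T. T \<subseteq> S \<and> card T = k}"
  have eq: "{T. T \<subseteq> insert a S \<and> card T = Suc k} = ?A \<union> insert a ` ?B"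
  proof (intro equalityI subsetI)
    fix T assume T: "T \<in> {T. T \<subseteq> insert a S \<and> card T = Suc k}"
    show "T \<in> ?A \<union> insert a ` ?B"
    proof (cases "a \<in> T")
      case True
      then have "T = insert a (T - {a})" "T - {a} \<subseteq> S" "card (T - {a}) = k"
        using T by (auto simp: card_Diff_singleton)
      then show ?thesis by blast
    qed (use T in auto)
  next
    fix T assume "T \<in> ?A \<union> insert a ` ?B"
    then show "T \<in> {T. T \<subseteq> insert a S \<and> card T = Suc k}"
      using assms finite_subset[of _ S] by (fastforce simp: card_insert_if)
  qed
  have inj: "inj_on (insert a) ?B"
    using assms(2) by (intro inj_onI) (metis (mono_tags, lifting) Diff_insert_absorb mem_Collect_eq subsetD)
  have fin: "finite ?A" "finite ?B" using assms(1) by auto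
  have disj: "?A \<inter> insert a ` ?B = {}" using assms(2) by auto
  have "(\<Sum>T\<in>insert a ` ?B. \<Prod>i\<in>T. x i) = (\<Sum>T\<in>?B. x a * (\<Prod>i\<in>T. x i))"
    unfolding sum.reindex[OF inj] comp_def
  proof (rule sum.cong[OF refl])
    fix T assume "T \<in> ?B"
    then show "(\<Prod>i\<in>insert a T. x i) = x a * (\<Prod>i\<in>T. x i)"
      using assms finite_subset[of T S] by (subst prod.insert) auto
  qed
  then show ?thesis
    unfolding esf_def eq using fin disj
    by (subst sum.union_disjoint) (auto simp: sum_distrib_left)
qed

lemma esf_remove:
  assumes "finite S" "i \<in> S"
  shows "esf (Suc k) S x = esf (Suc k) (S - {i}) x + x i * esf k (S - {i}) x"
  using esf_insert[of "S - {i}" i k x] assms by (simp add: insert_absorb)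

text \<open>Euler's relation for a homogeneous polynomial: \<open>esf k (S - {i})\<close> is the
  partial derivative of \<open>esf (Suc k) S\<close> in the i-th entry.\<close>

lemma esf_sum_remove:
  assumes "finite S"
  shows "(\<Sum>i\<in>S. x i * esf k (S - {i}) x) = real (Suc k) * esf (Suc k) S x"
  using assms
proof (induction S arbitrary: k rule: finite_induct)
  case (insert a S)
  have r: "insert a S - {i} = insert a (S - {i})" if "i \<in> S" for i
    using insert.hyps that by auto
  have "(\<Sum>i\<in>insert a S. x i * esf k (insert a S - {i}) x)
        = x a * esf k S x + (\<Sum>i\<in>S. x i * esf k (insert a (S - {i})) x)"
    using insert.hyps by (simp add: r)
  also have "\<dots> = real (Suc k) * esf (Suc k) (insert a S) x"
  proof (cases k)
    case 0
    then show ?thesis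
      using insert.hyps insert.IH[of 0] by (simp add: esf_insert algebra_simps)
  next
    case (Suc j)
    have "(\<Sum>i\<in>S. x i * esf k (insert a (S - {i})) x)
          = (\<Sum>i\<in>S. x i * esf k (S - {i}) x) + x a * (\<Sum>i\<in>S. x i * esf j (S - {i}) x)"
      using insert.hyps by (simp add: Suc esf_insert algebra_simps sum.distrib sum_distrib_left)
    also have "\<dots> = real (Suc k) * esf (Suc k) S x + x a * (real (Suc j) * esf (Suc j) S x)"
      using insert.IH by simp
    finally show ?thesis using insert.hyps by (simp add: Suc esf_insert algebra_simps)
  qed
  finally show ?case .
qed simp

lemma esf_scale: "esf k S (\<lambda>i. c * x i) = c ^ k * esf k S x"
proof -
  have "(\<Prod>i\<in>T. c * x i) = c ^ k * (\<Prod>i\<in>T. x i)" if "card T = k" for T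
    using that by (simp add: prod.distrib)
  then show ?thesis by (simp add: esf_def sum_distrib_left)
qed

lemma esf_cong: "(\<And>i. i \<in> S \<Longrightarrow> x i = y i) \<Longrightarrow> esf k S x = esf k S y"
  unfolding esf_def by (intro sum.cong refl prod.cong) auto

text \<open>The weighted sum on the left runs over the Newton defects of the vectors with one entry
  removed; it makes the defect of order \<open>k + 1\<close> a sum of squares by induction.\<close>

lemma esf_newton_step:
  assumes "finite S"
  shows "(\<Sum>i\<in>S. (x i)\<^sup>2 * ((esf (Suc k) (S - {i}) x)\<^sup>2
            - esf k (S - {i}) x * esf (Suc (Suc k)) (S - {i}) x))
         = real (k + 2) * (esf (Suc (Suc k)) S x)\<^sup>2
            - real (k + 3) * esf (Suc k) S x * esf (Suc (Suc (Suc k))) S x"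
proof -
  have "(x i)\<^sup>2 * ((esf (Suc k) (S - {i}) x)\<^sup>2 - esf k (S - {i}) x * esf (Suc (Suc k)) (S - {i}) x)
        = esf (Suc (Suc k)) S x * (x i * esf (Suc k) (S - {i}) x)
          - esf (Suc k) S x * (x i * esf (Suc (Suc k)) (S - {i}) x)" if "i \<in> S" for i
    using that assms by (simp add: esf_remove[of S i] power2_eq_square algebra_simps)
  then have "(\<Sum>i\<in>S. (x i)\<^sup>2 * ((esf (Suc k) (S - {i}) x)\<^sup>2
            - esf k (S - {i}) x * esf (Suc (Suc k)) (S - {i}) x))
      = esf (Suc (Suc k)) S x * (\<Sum>i\<in>S. x i * esf (Suc k) (S - {i}) x)
          - esf (Suc k) S x * (\<Sum>i\<in>S. x i * esf (Suc (Suc k)) (S - {i}) x)"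
    by (simp add: sum_subtractf sum_distrib_left)
  then show ?thesis
    using assms by (simp add: esf_sum_remove power2_eq_square algebra_simps)
qed

text \<open>The start of the induction for Newton's inequality: the same elimination of the i-th
  entry, one order lower, leaves the plain sum of squares.\<close>

lemma esf_newton_0:
  assumes "finite S"
  shows "(\<Sum>i\<in>S. (x i)\<^sup>2) = (esf 1 S x)\<^sup>2 - 2 * esf 2 S x"
proof -
  have "(x i)\<^sup>2 = esf 1 S x * x i - x i * esf 1 (S - {i}) x" if "i \<in> S" for i
    using that assms by (simp add: esf_remove[of S i] power2_eq_square algebra_simps)
  then have "(\<Sum>i\<in>S. (x i)\<^sup>2)
      = esf 1 S x * (\<Sum>i\<in>S. x i * esf 0 (S - {i}) x) - (\<Sum>i\<in>S. x i * esf 1 (S - {i}) x)"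
    using assms by (simp add: sum_subtractf sum_distrib_left)
  then show ?thesis
    using assms by (simp only: esf_sum_remove) (simp add: power2_eq_square numeral_2_eq_2)
qed

text \<open>Newton's inequality with its binomial factors dropped. The induction runs over all
  finite index sets at once because \<open>esf_newton_step\<close> expresses a defect on S through
  the defects on S with one entry removed.\<close>

lemma esf_newton:
  assumes "finite S"
  shows "esf k S x * esf (Suc (Suc k)) S x \<le> (esf (Suc k) S x)\<^sup>2"
  using assms
proof (induction k arbitrary: S)
  case 0
  have "0 \<le> (\<Sum>i\<in>S. (x i)\<^sup>2)" by (simp add: sum_nonneg)
  also have "\<dots> = (esf 1 S x)\<^sup>2 - 2 * esf 2 S x" by (rule esf_newton_0[OF 0])
  finally have "2 * esf 2 S x \<le> (esf 1 S x)\<^sup>2" by simp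
  then have "esf 2 S x \<le> (esf 1 S x)\<^sup>2" using zero_le_power2[of "esf 1 S x"] by linarith
  then show ?case using 0 by (simp add: numeral_2_eq_2)
next
  case (Suc k)
  have "0 \<le> (\<Sum>i\<in>S. (x i)\<^sup>2 * ((esf (Suc k) (S - {i}) x)\<^sup>2
            - esf k (S - {i}) x * esf (Suc (Suc k)) (S - {i}) x))"
    using Suc by (intro sum_nonneg mult_nonneg_nonneg) auto
  also have "\<dots> = real (k + 2) * (esf (Suc (Suc k)) S x)\<^sup>2
            - real (k + 3) * esf (Suc k) S x * esf (Suc (Suc (Suc k))) S x"
    by (rule esf_newton_step[OF Suc.prems])
  \<comment> \<open>Replacing the weight k + 2 by k + 3 adds a square, after which the common factor
    cancels.\<close>
  also have "\<dots> \<le> real (k + 3) * ((esf (Suc (Suc k)) S x)\<^sup>2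
            - esf (Suc k) S x * esf (Suc (Suc (Suc k))) S x)"
    by (simp add: algebra_simps)
  finally have "0 \<le> (esf (Suc (Suc k)) S x)\<^sup>2 - esf (Suc k) S x * esf (Suc (Suc (Suc k))) S x"
    by (simp add: zero_le_mult_iff)
  then show ?case by simp
qed

section \<open>Garding cones\<close>

definition esf_cone :: "nat \<Rightarrow> 'a set \<Rightarrow> ('a \<Rightarrow> real) set" where
  "esf_cone k S = {x. \<forall>j\<le>k. esf j S x > 0}"

lemma esf_coneD: "x \<in> esf_cone k S \<Longrightarrow> j \<le> k \<Longrightarrow> esf j S x > 0"
  by (simp add: esf_cone_def)

lemma esf_cone_Suc: "x \<in> esf_cone (Suc k) S \<longleftrightarrow> x \<in> esf_cone k S \<and> esf (Suc k) S x > 0"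
  by (auto simp: esf_cone_def le_Suc_eq)

lemma esf_cone_mono: "x \<in> esf_cone k S \<Longrightarrow> j \<le> k \<Longrightarrow> x \<in> esf_cone j S"
  by (auto simp: esf_cone_def)

text \<open>In other words, the partial derivatives are positive on the cone. If the next function
  of the remaining entries were nonpositive, positivity of \<open>esf (Suc k) S\<close> would bound
  x_i from below, and Newton's inequality on \<open>S - {i}\<close> would make
  \<open>esf (Suc (Suc k)) S\<close> nonpositive.\<close>

lemma esf_cone_remove:
  assumes "finite S" "i \<in> S" "x \<in> esf_cone (Suc k) S"
  shows "x \<in> esf_cone k (S - {i})"
  using assms(3)
proof (induction k)
  case 0
  then show ?case using assms by (simp add: esf_cone_def)
next
  case (Suc k)
  let ?e = "\<lambda>j. esf j (S - {i}) x"
  have IH: "x \<in> esf_cone k (S - {i})"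
    using Suc by (simp add: esf_cone_Suc[of x "Suc k"])
  have p0: "?e k > 0" using IH by (simp add: esf_coneD)
  have p1: "?e (Suc k) + x i * ?e k > 0" "?e (Suc (Suc k)) + x i * ?e (Suc k) > 0"
    using Suc.prems assms by (simp_all add: esf_coneD flip: esf_remove)
  have "?e (Suc k) > 0"
  proof (rule ccontr)
    assume n: "\<not> ?e (Suc k) > 0"
    have "?e k * (?e (Suc (Suc k)) + x i * ?e (Suc k)) > 0" using p0 p1(2) by simp
    moreover have "?e k * ?e (Suc (Suc k)) \<le> (?e (Suc k))\<^sup>2"
      using esf_newton[of "S - {i}"] assms(1) by simp
    moreover have "?e k * (?e (Suc (Suc k)) + x i * ?e (Suc k))
        = ?e k * ?e (Suc (Suc k)) + (x i * ?e k) * ?e (Suc k)" by (simp add: algebra_simps)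
    moreover have "(x i * ?e k) * ?e (Suc k) \<le> - ?e (Suc k) * ?e (Suc k)"
      using n p1(1) by (intro mult_right_mono_neg) auto
    ultimately show False by (simp add: power2_eq_square)
  qed
  then show ?case using IH by (simp add: esf_cone_Suc)
qed

section \<open>Concavity of the quotients of consecutive symmetric functions\<close>

lemma square_div_add_le:
  fixes a b c d :: real
  assumes "c > 0" "d > 0"
  shows "(a + b)\<^sup>2 / (c + d) \<le> a\<^sup>2 / c + b\<^sup>2 / d"
proof -
  have "0 \<le> (a * d - b * c)\<^sup>2" by simp
  then have "(a + b)\<^sup>2 * (c * d) \<le> (a\<^sup>2 * d + b\<^sup>2 * c) * (c + d)"
    by (simp add: power2_eq_square algebra_simps)
  then have "(a + b)\<^sup>2 / (c + d) \<le> (a\<^sup>2 * d + b\<^sup>2 * c) / (c * d)"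
    using assms by (simp add: field_simps)
  also have "\<dots> = a\<^sup>2 / c + b\<^sup>2 / d" using assms by (simp add: field_simps)
  finally show ?thesis .
qed

text \<open>Euler's relation writes the left-hand side as the sum of x_i e_{k+1}(S - i) /
  e_{k+1}(S). Eliminating e_{k+1}(S - i) from the numerator leaves x_i - x_i^2 / (x_i + r_i), where
  r_i is the quotient one order lower for the remaining entries; an induction on the order can thus
  act inside each summand.\<close>

lemma esf_quotient_eq:
  assumes "finite S" "x \<in> esf_cone (Suc (Suc k)) S"
  shows "real (k + 2) * (esf (Suc (Suc k)) S x / esf (Suc k) S x)
         = (\<Sum>i\<in>S. x i - (x i)\<^sup>2 / (x i + esf (Suc k) (S - {i}) x / esf k (S - {i}) x))"
proof -
  have p: "esf (Suc k) S x > 0" using assms(2) by (simp add: esf_coneD)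
  have "x i - (x i)\<^sup>2 / (x i + esf (Suc k) (S - {i}) x / esf k (S - {i}) x)
        = x i * esf (Suc k) (S - {i}) x / esf (Suc k) S x" if "i \<in> S" for i
  proof -
    have q: "esf k (S - {i}) x > 0"
      using esf_cone_remove[OF assms(1) that assms(2)] by (simp add: esf_coneD)
    have r: "esf (Suc k) S x = esf (Suc k) (S - {i}) x + x i * esf k (S - {i}) x"
      by (rule esf_remove[OF assms(1) that])
    have "x i + esf (Suc k) (S - {i}) x / esf k (S - {i}) x = esf (Suc k) S x / esf k (S - {i}) x"
      using q by (simp add: r field_simps)
    then have "x i - (x i)\<^sup>2 / (x i + esf (Suc k) (S - {i}) x / esf k (S - {i}) x)
       = x i * (esf (Suc k) S x - x i * esf k (S - {i}) x) / esf (Suc k) S x"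
      using p q by (simp add: field_simps power2_eq_square)
    then show ?thesis by (simp add: r)
  qed
  then have "(\<Sum>i\<in>S. x i - (x i)\<^sup>2 / (x i + esf (Suc k) (S - {i}) x / esf k (S - {i}) x))
      = (\<Sum>i\<in>S. x i * esf (Suc k) (S - {i}) x) / esf (Suc k) S x"
    by (simp add: sum_divide_distrib)
  then show ?thesis using assms(1) by (simp add: esf_sum_remove)
qed

text \<open>The Marcus--Lopes inequality. By \<open>esf_quotient_eq\<close> the quotient of order \<open>k + 1\<close> is a sum of
  values of \<open>a - a\<^sup>2 / (a + r)\<close>, which is superadditive in \<open>(a, r)\<close> and increasing in \<open>r\<close>.\<close>

lemma esf_quotient_superadd:
  assumes "finite S" "x \<in> esf_cone (Suc k) S" "y \<in> esf_cone (Suc k) S"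
  shows "(\<lambda>i. x i + y i) \<in> esf_cone (Suc k) S
       \<and> esf (Suc k) S x / esf k S x + esf (Suc k) S y / esf k S y
         \<le> esf (Suc k) S (\<lambda>i. x i + y i) / esf k S (\<lambda>i. x i + y i)"
  using assms
proof (induction k arbitrary: S)
  case 0
  have lin: "esf (Suc 0) S z = (\<Sum>i\<in>S. z i)" for z
    using esf_sum_remove[OF 0(1), of z 0] 0(1) by simp
  then show ?case using 0
    by (simp add: esf_cone_Suc sum.distrib) (simp add: esf_cone_def)
next
  case (Suc k)
  let ?z = "\<lambda>i. x i + y i"
  let ?r = "\<lambda>i w. w i + esf (Suc k) (S - {i}) w / esf k (S - {i}) w"
  have rpos: "?r i w = esf (Suc k) S w / esf k (S - {i}) w \<and> ?r i w > 0"
    if "i \<in> S" "w \<in> esf_cone k (S - {i})" "w \<in> esf_cone (Suc k) S" for i w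
  proof -
    have q: "esf k (S - {i}) w > 0" using that by (simp add: esf_coneD)
    have "?r i w = esf (Suc k) S w / esf k (S - {i}) w"
      using q by (simp add: esf_remove[OF Suc.prems(1) that(1)] field_simps)
    then show ?thesis using q that(3) esf_coneD[of w "Suc k" S "Suc k"] by simp
  qed
  have xy: "x \<in> esf_cone (Suc k) S" "y \<in> esf_cone (Suc k) S"
    using Suc.prems by (auto simp: esf_cone_Suc)
  have z1: "?z \<in> esf_cone (Suc k) S" using Suc.IH[OF Suc.prems(1) xy] by blast
  have tm: "(x i - (x i)\<^sup>2 / ?r i x) + (y i - (y i)\<^sup>2 / ?r i y) \<le> ?z i - (?z i)\<^sup>2 / ?r i ?z"
    if i: "i \<in> S" for i
  proof -
    have xi: "x \<in> esf_cone (Suc k) (S - {i})" "y \<in> esf_cone (Suc k) (S - {i})"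
      using esf_cone_remove[OF Suc.prems(1) i] Suc.prems by auto
    have IH: "?z \<in> esf_cone (Suc k) (S - {i})" "?r i x + ?r i y \<le> ?r i ?z"
      using Suc.IH[OF _ xi] Suc.prems(1) by auto
    have px: "?r i x > 0" "?r i y > 0"
      using rpos[OF i esf_cone_mono[OF xi(1)] xy(1)] rpos[OF i esf_cone_mono[OF xi(2)] xy(2)] by simp_all
    have "(?z i)\<^sup>2 / ?r i ?z \<le> (?z i)\<^sup>2 / (?r i x + ?r i y)"
      using IH(2) px by (intro divide_left_mono) (auto intro!: mult_pos_pos)
    also have "\<dots> \<le> (x i)\<^sup>2 / ?r i x + (y i)\<^sup>2 / ?r i y"
      by (rule square_div_add_le[OF px])
    finally show ?thesis by simp
  qed
  have zrem: "?z \<in> esf_cone k (S - {i})" "esf (Suc k) (S - {i}) ?z > 0" if "i \<in> S" for i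
  proof -
    have "?z \<in> esf_cone (Suc k) (S - {i})"
      using Suc.IH[of "S - {i}"] esf_cone_remove[OF Suc.prems(1) that Suc.prems(2)]
        esf_cone_remove[OF Suc.prems(1) that Suc.prems(3)] Suc.prems(1) by blast
    then show "?z \<in> esf_cone k (S - {i})" "esf (Suc k) (S - {i}) ?z > 0"
      by (simp_all add: esf_cone_Suc)
  qed
  \<comment> \<open>Membership of \<open>?z\<close> in the larger cone is still to be shown, so
    \<open>esf_quotient_eq\<close> does not apply; the identity is derived again from the weaker
    facts \<open>z1\<close> and \<open>zrem\<close>.\<close>
  have zeq: "real (k + 2) * (esf (Suc (Suc k)) S ?z / esf (Suc k) S ?z) = (\<Sum>i\<in>S. ?z i - (?z i)\<^sup>2 / ?r i ?z)"
  proof -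
    have p: "esf (Suc k) S ?z > 0" using z1 by (simp add: esf_coneD)
    have "?z i - (?z i)\<^sup>2 / ?r i ?z = ?z i * esf (Suc k) (S - {i}) ?z / esf (Suc k) S ?z" if "i \<in> S" for i
    proof -
      have q: "esf k (S - {i}) ?z > 0" using zrem[OF that] by (simp add: esf_coneD)
      have "?z i - (?z i)\<^sup>2 / ?r i ?z = ?z i * (esf (Suc k) S ?z - ?z i * esf k (S - {i}) ?z) / esf (Suc k) S ?z"
        using p q rpos[OF that zrem(1)[OF that] z1] by (simp add: field_simps power2_eq_square)
      then show ?thesis by (simp add: esf_remove[OF Suc.prems(1) that])
    qed
    then have "(\<Sum>i\<in>S. ?z i - (?z i)\<^sup>2 / ?r i ?z) = (\<Sum>i\<in>S. ?z i * esf (Suc k) (S - {i}) ?z) / esf (Suc k) S ?z"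
      by (simp add: sum_divide_distrib)
    then show ?thesis using esf_sum_remove[OF Suc.prems(1), of ?z "Suc k"] by simp
  qed
  have "real (k + 2) * (esf (Suc (Suc k)) S x / esf (Suc k) S x + esf (Suc (Suc k)) S y / esf (Suc k) S y)
        \<le> real (k + 2) * (esf (Suc (Suc k)) S ?z / esf (Suc k) S ?z)"
    unfolding zeq distrib_left esf_quotient_eq[OF Suc.prems(1,2)] esf_quotient_eq[OF Suc.prems(1,3)]
      sum.distrib[symmetric] by (intro sum_mono tm)
  then have main: "esf (Suc (Suc k)) S x / esf (Suc k) S x + esf (Suc (Suc k)) S y / esf (Suc k) S y
        \<le> esf (Suc (Suc k)) S ?z / esf (Suc k) S ?z"
    by (simp only: mult_le_cancel_left_pos)
  have "0 < esf (Suc (Suc k)) S x / esf (Suc k) S x + esf (Suc (Suc k)) S y / esf (Suc k) S y"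
    using Suc.prems by (intro add_pos_pos divide_pos_pos) (auto simp: esf_coneD)
  then have "0 < esf (Suc (Suc k)) S ?z / esf (Suc k) S ?z" using main by (rule order_less_le_trans)
  \<comment> \<open>The larger cone is reached only now, from a positive quotient with positive
    denominator.\<close>
  then have "esf (Suc (Suc k)) S ?z > 0"
    using esf_coneD[OF z1, of "Suc k"] by (simp add: zero_less_divide_iff)
  then show ?case using main z1 by (simp add: esf_cone_Suc)
qed

lemma esf_cone_scale: "c > 0 \<Longrightarrow> x \<in> esf_cone k S \<Longrightarrow> (\<lambda>i. c * x i) \<in> esf_cone k S"
  by (simp add: esf_cone_def esf_scale)

lemma esf_cone_add:
  assumes "finite S" "x \<in> esf_cone k S" "y \<in> esf_cone k S"
  shows "(\<lambda>i. x i + y i) \<in> esf_cone k S"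
  using assms esf_quotient_superadd[of S x "k - 1" y]
  by (cases k) (auto simp: esf_cone_def)

text \<open>Each function is the previous one times a quotient. Both factors are positive and
  superadditive, and multiplying out produces only nonnegative cross terms in addition.\<close>

lemma esf_superadd:
  assumes "finite S" "x \<in> esf_cone (Suc k) S" "y \<in> esf_cone (Suc k) S"
  shows "esf (Suc k) S x + esf (Suc k) S y \<le> esf (Suc k) S (\<lambda>i. x i + y i)"
  using assms
proof (induction k)
  case 0
  then show ?case using esf_quotient_superadd[OF assms(1), of x 0 y] by simp
next
  case (Suc k)
  let ?z = "\<lambda>i. x i + y i"
  let ?p = "esf (Suc k) S" and ?q = "esf (Suc (Suc k)) S"
  have pos: "?p x > 0" "?p y > 0" "?q x > 0" "?q y > 0"
    using Suc.prems by (auto simp: esf_coneD)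
  have IH: "?p x + ?p y \<le> ?p ?z" using Suc by (simp add: esf_cone_Suc)
  have q: "?q x / ?p x + ?q y / ?p y \<le> ?q ?z / ?p ?z"
    using esf_quotient_superadd[OF Suc.prems] by blast
  have "?q x + ?q y \<le> (?q x / ?p x + ?q y / ?p y) * (?p x + ?p y)"
    using pos by (simp add: field_simps)
  also have "\<dots> \<le> (?q ?z / ?p ?z) * ?p ?z"
    using IH q pos order_trans[OF _ q, of 0] by (intro mult_mono) auto
  also have "\<dots> = ?q ?z" using IH pos by (auto split: if_splits)
  finally show ?case .
qed

text \<open>The quotients are homogeneous of degree one and superadditive, hence concave, hence
  log-concave by the weighted inequality of arithmetic and geometric means. Log-concavity passes to
  products, and the product of the quotients telescopes.\<close>

lemma esf_log_concave:
  assumes "finite S" "x \<in> esf_cone k S" "y \<in> esf_cone k S" "0 < t" "t < 1"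
  shows "(esf k S x) powr (1 - t) * (esf k S y) powr t \<le> esf k S (\<lambda>i. (1 - t) * x i + t * y i)"
  using assms(2,3)
proof (induction k)
  case 0
  then show ?case using assms(1) by simp
next
  case (Suc k)
  let ?z = "\<lambda>i. (1 - t) * x i + t * y i"
  have pos: "esf k S x > 0" "esf k S y > 0" "esf (Suc k) S x > 0" "esf (Suc k) S y > 0"
    using Suc.prems by (auto simp: esf_coneD)
  have c: "(\<lambda>i. (1 - t) * x i) \<in> esf_cone (Suc k) S" "(\<lambda>i. t * y i) \<in> esf_cone (Suc k) S"
    using assms Suc.prems by (auto intro!: esf_cone_scale)
  have IH: "(esf k S x) powr (1 - t) * (esf k S y) powr t \<le> esf k S ?z"
    using Suc by (simp add: esf_cone_Suc)
  have z: "esf k S ?z > 0" using esf_cone_add[OF assms(1) c] by (simp add: esf_coneD)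
  let ?q = "\<lambda>w. esf (Suc k) S w / esf k S w"
  have "?q x powr (1 - t) * ?q y powr t \<le> (1 - t) * ?q x + t * ?q y"
    using assms pos by (intro Youngs_inequality_0) auto
  also have "\<dots> = ?q (\<lambda>i. (1 - t) * x i) + ?q (\<lambda>i. t * y i)"
    using assms by (simp add: esf_scale)
  also have "\<dots> \<le> ?q ?z" using esf_quotient_superadd[OF assms(1) c] by blast
  finally have q: "?q x powr (1 - t) * ?q y powr t \<le> ?q ?z" .
  have "(esf (Suc k) S x) powr (1 - t) * (esf (Suc k) S y) powr t
      = (?q x * esf k S x) powr (1 - t) * (?q y * esf k S y) powr t" using pos by simp
  also have "\<dots> = (?q x powr (1 - t) * ?q y powr t) * ((esf k S x) powr (1 - t) * (esf k S y) powr t)"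
    using pos by (subst (1 2) powr_mult) (auto simp: algebra_simps)
  also have "\<dots> \<le> ?q ?z * esf k S ?z"
    using q IH z pos order_trans[OF _ q, of 0] by (intro mult_mono) auto
  finally show ?case using z by simp
qed

section \<open>First-order inequalities on the cone\<close>

lemma esf_has_derivative_line:
  assumes "finite S"
  shows "((\<lambda>t. esf (Suc k) S (\<lambda>i. x i + t * d i))
           has_field_derivative (\<Sum>i\<in>S. d i * esf k (S - {i}) x)) (at 0)"
  using assms
proof (induction S arbitrary: k rule: finite_induct)
  case (insert a S)
  have r: "insert a S - {i} = insert a (S - {i})" if "i \<in> S" for i
    using insert.hyps that by auto
  have s: "(\<Sum>i\<in>insert a S. d i * esf k (insert a S - {i}) x)
      = d a * esf k S x + (\<Sum>i\<in>S. d i * esf k (insert a (S - {i})) x)"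
    using insert.hyps by (simp add: r)
  show ?case
  proof (cases k)
    case 0
    have "((\<lambda>t. esf (Suc 0) S (\<lambda>i. x i + t * d i) + (x a + t * d a)) has_field_derivative
        (\<Sum>i\<in>S. d i * esf 0 (S - {i}) x) + d a) (at 0)"
      by (rule derivative_eq_intros insert.IH refl | simp)+
    then show ?thesis using insert.hyps s by (simp add: 0 esf_insert add.commute)
  next
    case (Suc j)
    have "((\<lambda>t. esf (Suc k) S (\<lambda>i. x i + t * d i) + (x a + t * d a) * esf k S (\<lambda>i. x i + t * d i))
      has_field_derivative ((\<Sum>i\<in>S. d i * esf k (S - {i}) x)
         + (d a * esf k S x + x a * (\<Sum>i\<in>S. d i * esf j (S - {i}) x)))) (at 0)"
      unfolding Suc by (rule derivative_eq_intros insert.IH refl | simp)+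
    then show ?thesis using insert.hyps s
      by (simp add: Suc esf_insert algebra_simps sum.distrib sum_distrib_left)
  qed
qed simp

text \<open>Log-concavity keeps the function at or above its value at x along the whole segment
  towards y, whereas a negative directional derivative would make it drop at once.\<close>

lemma esf_supporting:
  assumes "finite S" "x \<in> esf_cone (Suc k) S" "y \<in> esf_cone (Suc k) S"
    and le: "esf (Suc k) S x \<le> esf (Suc k) S y"
  shows "0 \<le> (\<Sum>i\<in>S. (y i - x i) * esf k (S - {i}) x)"
proof (rule ccontr)
  assume "\<not> ?thesis"
  then have neg: "(\<Sum>i\<in>S. (y i - x i) * esf k (S - {i}) x) < 0" by simp
  obtain \<delta> where \<delta>: "\<delta> > 0"
    and dec: "\<And>h. 0 < h \<Longrightarrow> h < \<delta> \<Longrightarrow> esf (Suc k) S (\<lambda>i. x i + (0 + h) * (y i - x i)) < esf (Suc k) S (\<lambda>i. x i + 0 * (y i - x i))"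
    using has_real_derivative_neg_dec_right[OF DERIV_subset[OF esf_has_derivative_line[OF assms(1), of k x "\<lambda>i. y i - x i"], of UNIV]] neg
    by auto
  define t where "t = min (\<delta> / 2) (1 / 2)"
  have t: "0 < t" "t < \<delta>" "t < 1" using \<delta> by (auto simp: t_def)
  have px: "esf (Suc k) S x > 0" using assms(2) by (simp add: esf_coneD)
  have "esf (Suc k) S x = (esf (Suc k) S x) powr (1 - t) * (esf (Suc k) S x) powr t"
    using px by (simp flip: powr_add)
  also have "\<dots> \<le> (esf (Suc k) S x) powr (1 - t) * (esf (Suc k) S y) powr t"
    using t px le by (intro mult_left_mono powr_mono2) auto
  also have "\<dots> \<le> esf (Suc k) S (\<lambda>i. (1 - t) * x i + t * y i)"
    using esf_log_concave assms t by blast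
  also have "\<dots> = esf (Suc k) S (\<lambda>i. x i + (0 + t) * (y i - x i))"
    by (intro esf_cong) (simp add: algebra_simps)
  also have "\<dots> < esf (Suc k) S x" using dec[of t] t by simp
  finally show False by simp
qed

text \<open>By superadditivity, passing from x to x + d raises the function, so d points into the
  superlevel set of x.\<close>

lemma esf_derivative_cone_nonneg:
  assumes "finite S" "x \<in> esf_cone (Suc k) S" "d \<in> esf_cone (Suc k) S"
  shows "0 \<le> (\<Sum>i\<in>S. d i * esf k (S - {i}) x)"
  using esf_supporting[OF assms(1,2) esf_cone_add[OF assms]] esf_superadd[OF assms]
    esf_coneD[OF assms(3), of "Suc k"] by simp

section \<open>Invariance under reindexing\<close>

lemma esf_reindex:
  assumes "inj_on h S"
  shows "esf k (h ` S) x = esf k S (\<lambda>i. x (h i))"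
proof -
  have inj: "inj_on h T" if "T \<subseteq> S" for T using assms that by (rule inj_on_subset)
  have eq: "{T. T \<subseteq> h ` S \<and> card T = k} = image h ` {T. T \<subseteq> S \<and> card T = k}"
  proof (intro equalityI subsetI)
    fix T assume T: "T \<in> {T. T \<subseteq> h ` S \<and> card T = k}"
    then obtain U where U: "U \<subseteq> S" "T = h ` U" by (auto simp: subset_image_iff)
    then have "card U = k" using T card_image[OF inj[OF U(1)]] by simp
    then show "T \<in> image h ` {T. T \<subseteq> S \<and> card T = k}" using U by blast
  next
    fix T assume "T \<in> image h ` {T. T \<subseteq> S \<and> card T = k}"
    then obtain U where "U \<subseteq> S" "T = h ` U" "card U = k" by blast
    then show "T \<in> {T. T \<subseteq> h ` S \<and> card T = k}"
      using card_image[OF inj[of U]] by auto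
  qed
  have inj2: "inj_on (image h) {T. T \<subseteq> S \<and> card T = k}"
    by (rule inj_onI) (use inj_on_image_eq_iff[OF assms] in blast)
  show ?thesis
    unfolding esf_def eq sum.reindex[OF inj2] comp_def
  proof (rule sum.cong[OF refl])
    fix T assume "T \<in> {T. T \<subseteq> S \<and> card T = k}"
    then show "prod x (h ` T) = (\<Prod>i\<in>T. x (h i))"
      using prod.reindex[OF inj[of T]] by (simp add: comp_def)
  qed
qed

lemma esf_permutes:
  assumes "\<pi> permutes S"
  shows "esf k S (\<lambda>i. x (\<pi> i)) = esf k S x"
  using esf_reindex[of \<pi> S k x] permutes_inj_on[OF assms] permutes_image[OF assms] by simp

lemma esf_ones: "finite S \<Longrightarrow> esf k S (\<lambda>_. 1) = real (card S choose k)"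
  by (simp add: esf_def n_subsets)

section \<open>Symmetric matrices\<close>

definition orthonormal_frame :: "('n \<Rightarrow> real^'n) \<Rightarrow> bool" where
  "orthonormal_frame e \<longleftrightarrow> (\<forall>i j. e i \<bullet> e j = (if i = j then 1 else 0))"

definition eigenframe :: "real^'n^'n \<Rightarrow> ('n \<Rightarrow> real^'n) \<Rightarrow> ('n \<Rightarrow> real) \<Rightarrow> bool" where
  "eigenframe A e d \<longleftrightarrow> orthonormal_frame e \<and> (\<forall>i. A *v e i = d i *\<^sub>R e i)"

lemma orthonormal_frame_norm: "orthonormal_frame e \<Longrightarrow> norm (e i) = 1"
  by (simp add: orthonormal_frame_def norm_eq_1)

text \<open>A one-sided inverse of a square matrix is two-sided, so orthonormal rows have
  orthonormal columns.\<close>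

lemma orthonormal_frame_columns:
  fixes e :: "'n::finite \<Rightarrow> real^'n"
  assumes "orthonormal_frame e"
  shows "(\<Sum>i\<in>UNIV. e i $ a * e i $ b) = (if a = b then 1 else 0)"
proof -
  define Q :: "real^'n^'n" where "Q = (\<chi> i. e i)"
  have "Q ** transpose Q = mat 1"
    using assms
    by (simp add: Q_def matrix_matrix_mult_def transpose_def mat_def vec_eq_iff orthonormal_frame_def
        inner_vec_def)
  then have "transpose Q ** Q = mat 1" by (simp add: matrix_left_right_inverse)
  then have "(transpose Q ** Q) $ a $ b = (mat 1 :: real^'n^'n) $ a $ b" by simp
  then show ?thesis
    by (simp add: Q_def matrix_matrix_mult_def transpose_def mat_def)
qed

lemma sum_rotate3:
  "(\<Sum>i\<in>I. \<Sum>a\<in>A. \<Sum>b\<in>B. f i a b) = (\<Sum>a\<in>A. \<Sum>b\<in>B. \<Sum>i\<in>I. f i a b)"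
proof -
  have "(\<Sum>i\<in>I. \<Sum>a\<in>A. \<Sum>b\<in>B. f i a b) = (\<Sum>a\<in>A. \<Sum>i\<in>I. \<Sum>b\<in>B. f i a b)"
    by (rule sum.swap)
  also have "\<dots> = (\<Sum>a\<in>A. \<Sum>b\<in>B. \<Sum>i\<in>I. f i a b)"
    by (rule sum.cong[OF refl], rule sum.swap)
  finally show ?thesis .
qed

lemma orthonormal_frame_inner:
  fixes e :: "'n::finite \<Rightarrow> real^'n"
  assumes "orthonormal_frame e"
  shows "(\<Sum>i\<in>UNIV. (v \<bullet> e i) * (w \<bullet> e i)) = v \<bullet> w"
proof -
  have "(\<Sum>i\<in>UNIV. (v \<bullet> e i) * (w \<bullet> e i))
      = (\<Sum>i\<in>UNIV. \<Sum>a\<in>UNIV. \<Sum>b\<in>UNIV. v $ a * w $ b * (e i $ a * e i $ b))"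
    by (simp add: inner_vec_def sum_product algebra_simps)
  also have "\<dots> = (\<Sum>a\<in>UNIV. \<Sum>b\<in>UNIV. v $ a * w $ b * (\<Sum>i\<in>UNIV. e i $ a * e i $ b))"
    by (subst sum_rotate3) (simp add: sum_distrib_left)
  also have "\<dots> = v \<bullet> w"
    by (simp add: orthonormal_frame_columns[OF assms] inner_vec_def if_distrib[of "\<lambda>x. _ * x"] cong: if_cong)
  finally show ?thesis .
qed

lemma orthonormal_frame_expand:
  fixes e :: "'n::finite \<Rightarrow> real^'n"
  assumes "orthonormal_frame e"
  shows "(\<Sum>i\<in>UNIV. (v \<bullet> e i) *\<^sub>R e i) = v"
proof (rule vector_eq_rdot[THEN iffD1], rule allI)
  fix w
  show "(\<Sum>i\<in>UNIV. (v \<bullet> e i) *\<^sub>R e i) \<bullet> w = v \<bullet> w"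
    using orthonormal_frame_inner[OF assms, of v w] by (simp add: inner_sum_left inner_commute[of "e _" w])
qed

lemma trace_orthonormal_frame:
  fixes e :: "'n::finite \<Rightarrow> real^'n"
  assumes "orthonormal_frame e"
  shows "(\<Sum>i\<in>UNIV. (A *v e i) \<bullet> e i) = trace A"
proof -
  have "(\<Sum>i\<in>UNIV. (A *v e i) \<bullet> e i)
      = (\<Sum>i\<in>UNIV. \<Sum>a\<in>UNIV. \<Sum>b\<in>UNIV. A $ a $ b * (e i $ a * e i $ b))"
    by (simp add: inner_vec_def matrix_vector_mult_def sum_distrib_left sum_distrib_right algebra_simps)
  also have "\<dots> = (\<Sum>a\<in>UNIV. \<Sum>b\<in>UNIV. A $ a $ b * (\<Sum>i\<in>UNIV. e i $ a * e i $ b))"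
    by (subst sum_rotate3) (simp add: sum_distrib_left)
  also have "\<dots> = trace A"
    by (simp add: orthonormal_frame_columns[OF assms] trace_def if_distrib cong: if_cong)
  finally show ?thesis .
qed

section \<open>The spectral theorem\<close>

lemma symmetric_matrix_inner:
  fixes A :: "real^'n^'n"
  assumes "transpose A = A"
  shows "(A *v v) \<bullet> w = (A *v w) \<bullet> v"
proof -
  have "(A *v v) \<bullet> w = (w v* A) \<bullet> v"
    by (simp only: dot_lmul_matrix inner_commute[of w])
  also have "w v* A = A *v w" using transpose_matrix_vector[of A w] assms by simp
  finally show ?thesis .
qed

text \<open>A maximum point v of the quadratic form on the unit sphere of the invariant subspace is
  an eigenvector: the residual w = A v - \<mu> v is orthogonal to v, and moving v towards a nonzero
  w would increase the Rayleigh quotient.\<close>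

lemma symmetric_matrix_eigenvector:
  fixes A :: "real^'n^'n"
  assumes A: "transpose A = A" and S: "subspace S" and inv: "\<And>x. x \<in> S \<Longrightarrow> A *v x \<in> S"
    and ne: "x0 \<in> S" "x0 \<noteq> 0"
  obtains v \<mu> where "v \<in> S" "norm v = 1" "A *v v = \<mu> *\<^sub>R v"
proof -
  let ?K = "S \<inter> sphere 0 1"
  have K: "compact ?K" using closed_subspace[OF S] by (simp add: closed_Int_compact)
  have "x0 /\<^sub>R norm x0 \<in> ?K" using ne S by (simp add: subspace_scale)
  then have K0: "?K \<noteq> {}" by blast
  have "continuous_on ?K (\<lambda>x. (A *v x) \<bullet> x)"
    by (rule continuous_on_inner[OF matrix_vector_mult_linear_continuous_on continuous_on_id])
  from continuous_attains_sup[OF K K0 this]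
  obtain v where v: "v \<in> ?K" and max: "\<And>x. x \<in> ?K \<Longrightarrow> (A *v x) \<bullet> x \<le> (A *v v) \<bullet> v"
    by (elim bexE) (rule that, auto)
  define \<mu> where "\<mu> = (A *v v) \<bullet> v"
  have vS: "v \<in> S" and nv: "v \<bullet> v = 1" "norm v = 1" using v by (auto simp: dot_square_norm)
  have le: "(A *v x) \<bullet> x \<le> \<mu> * (x \<bullet> x)" if "x \<in> S" for x
  proof (cases "x = 0")
    case False
    have "x /\<^sub>R norm x \<in> ?K" using that S False by (simp add: subspace_scale)
    from max[OF this] have "inverse (norm x) * (inverse (norm x) * ((A *v x) \<bullet> x)) \<le> \<mu>"
      by (simp add: \<mu>_def matrix_vector_mult_scaleR)
    then have "(norm x * norm x) * (inverse (norm x) * (inverse (norm x) * ((A *v x) \<bullet> x))) \<le> (norm x * norm x) * \<mu>"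
      by (rule mult_left_mono) simp
    moreover have "(norm x * norm x) * (inverse (norm x) * (inverse (norm x) * ((A *v x) \<bullet> x))) = (A *v x) \<bullet> x"
      using False by (simp add: field_simps)
    ultimately show ?thesis by (simp add: dot_square_norm power2_eq_square mult.commute)
  qed simp
  define w where "w = A *v v - \<mu> *\<^sub>R v"
  have wS: "w \<in> S" unfolding w_def using vS S inv by (simp add: subspace_diff subspace_scale)
  have wv: "w \<bullet> v = 0" by (simp add: w_def \<mu>_def inner_diff_left nv)
  have Avw: "(A *v v) \<bullet> w = w \<bullet> w"
    using wv by (simp add: w_def inner_diff_left inner_diff_right inner_commute)
  have "w = 0"
  proof (rule ccontr)
    assume "w \<noteq> 0"
    then have ww: "w \<bullet> w > 0" by simp
    \<comment> \<open>The gain along w is 2 t |w|^2, of first order in t, while the loss is at most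
      t^2 K; the value of t below makes the loss t |w|^2.\<close>
    define K where "K = \<bar>\<mu> * (w \<bullet> w) - (A *v w) \<bullet> w\<bar> + 1"
    define t where "t = (w \<bullet> w) / K"
    have t: "t > 0" "t * K = w \<bullet> w" using ww by (auto simp: t_def K_def add_nonneg_pos)
    have Awv: "(A *v w) \<bullet> v = w \<bullet> w" using Avw symmetric_matrix_inner[OF A, of w v] by simp
    have "(A *v (v + t *\<^sub>R w)) \<bullet> (v + t *\<^sub>R w)
        = (A *v v) \<bullet> v + t * ((A *v v) \<bullet> w) + t * ((A *v w) \<bullet> v) + t * t * ((A *v w) \<bullet> w)"
      by (simp add: matrix_vector_right_distrib matrix_vector_mult_scaleR inner_add_left inner_add_right distrib_left mult.assoc)
    then have "(A *v (v + t *\<^sub>R w)) \<bullet> (v + t *\<^sub>R w)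
        = \<mu> + 2 * t * (w \<bullet> w) + t * t * ((A *v w) \<bullet> w)"
      unfolding Avw Awv \<mu>_def by simp
    moreover have "(v + t *\<^sub>R w) \<bullet> (v + t *\<^sub>R w) = 1 + t * t * (w \<bullet> w)"
      using wv nv by (simp add: inner_add_left inner_add_right inner_commute[of v w])
    moreover have "(A *v (v + t *\<^sub>R w)) \<bullet> (v + t *\<^sub>R w) \<le> \<mu> * ((v + t *\<^sub>R w) \<bullet> (v + t *\<^sub>R w))"
      using le vS wS S by (simp add: subspace_add subspace_scale)
    ultimately have "2 * t * (w \<bullet> w) \<le> t * t * (\<mu> * (w \<bullet> w) - (A *v w) \<bullet> w)"
      by (simp add: right_diff_distrib distrib_left mult.left_commute)
    also have "\<dots> \<le> t * t * K" using t(1) by (intro mult_left_mono) (auto simp: K_def)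
    also have "\<dots> = t * (w \<bullet> w)" using t(2) by simp
    finally show False using t(1) ww by simp
  qed
  then show ?thesis using that[of v \<mu>] vS nv by (simp add: w_def)
qed

text \<open>A largest orthonormal set of eigenvectors is a basis: otherwise its orthogonal
  complement is nonzero, invariant by symmetry, and contains one more eigenvector.\<close>

theorem symmetric_matrix_eigenframe:
  fixes A :: "real^'n^'n"
  assumes A: "transpose A = A"
  obtains e d where "eigenframe A e d"
proof -
  define E where "E = {B :: (real^'n) set. pairwise orthogonal B \<and> (\<forall>b\<in>B. norm b = 1 \<and> (\<exists>\<mu>. A *v b = \<mu> *\<^sub>R b))}"
  have ind: "independent B" if "B \<in> E" for B
    using that by (intro pairwise_orthogonal_independent) (auto simp: E_def)
  have bound: "finite B \<and> card B \<le> CARD('n)" if "B \<in> E" for B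
    using independent_bound[OF ind[OF that]] by simp
  have "{} \<in> E" by (simp add: E_def)
  then obtain B where B: "B \<in> E" and max: "\<And>C. C \<in> E \<Longrightarrow> card C \<le> card B"
    using ex_has_greatest_nat[of "\<lambda>B. B \<in> E" "{}" card "CARD('n) + 1"] bound
    by (auto simp: less_Suc_eq_le)
  have "card B = CARD('n)"
  proof (rule ccontr)
    assume "card B \<noteq> CARD('n)"
    then have "dim B < DIM(real^'n)"
      using bound[OF B] dim_eq_card_independent[OF ind[OF B]] by simp
    then obtain x0 where x0: "x0 \<noteq> 0" "\<And>y. y \<in> span B \<Longrightarrow> orthogonal x0 y"
      using orthogonal_to_subspace_exists by blast
    define S where "S = {x. \<forall>b\<in>B. b \<bullet> x = 0}"
    have "subspace S" by (auto simp: S_def subspace_def inner_add_right)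
    moreover have "A *v x \<in> S" if "x \<in> S" for x
    proof -
      have "b \<bullet> (A *v x) = 0" if b: "b \<in> B" for b
      proof -
        obtain \<mu> where "A *v b = \<mu> *\<^sub>R b" using B b by (auto simp: E_def)
        then have "(A *v x) \<bullet> b = 0"
          using symmetric_matrix_inner[OF A, of x b] \<open>x \<in> S\<close> b by (simp add: S_def)
        then show ?thesis by (simp add: inner_commute)
      qed
      then show ?thesis by (simp add: S_def)
    qed
    moreover have "x0 \<in> S"
      using x0(2) by (auto simp: S_def orthogonal_def inner_commute span_base)
    ultimately obtain v \<mu> where v: "v \<in> S" "norm v = 1" "A *v v = \<mu> *\<^sub>R v"
      using symmetric_matrix_eigenvector[OF A] x0(1) by metis
    have "v \<notin> B" using v by (auto simp: S_def norm_eq_1)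
    moreover have "insert v B \<in> E"
      using B v by (auto simp: E_def pairwise_insert S_def orthogonal_def inner_commute)
    ultimately show False using max[of "insert v B"] bound[OF B] by simp
  qed
  then obtain e where e: "bij_betw e (UNIV :: 'n set) B"
    using bound[OF B] finite_same_card_bij[of "UNIV :: 'n set" B] by auto
  have eB: "e i \<in> B" for i using e by (auto simp: bij_betw_def)
  have "orthonormal_frame e"
    unfolding orthonormal_frame_def
  proof (intro allI)
    fix i j
    show "e i \<bullet> e j = (if i = j then 1 else 0)"
    proof (cases "i = j")
      case False
      then have "e i \<noteq> e j" using e by (auto simp: bij_betw_def inj_on_def)
      then show ?thesis using B eB[of i] eB[of j] False by (auto simp: E_def pairwise_def orthogonal_def)
    qed (use B eB in \<open>auto simp: E_def norm_eq_1\<close>)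
  qed
  moreover have "\<forall>i. \<exists>\<mu>. A *v e i = \<mu> *\<^sub>R e i" using B eB by (auto simp: E_def)
  then obtain d where "\<forall>i. A *v e i = d i *\<^sub>R e i" by metis
  ultimately show ?thesis using that by (auto simp: eigenframe_def)
qed

section \<open>Eigenvalues as roots of the characteristic polynomial\<close>

lemma mat_mult_vec: "mat s *v x = s *\<^sub>R (x :: real^'n)"
  by (simp add: vec_eq_iff matrix_vector_mult_def mat_def if_distrib[of "\<lambda>x. x * _"] cong: if_cong)

lemma eigenframe_charpoly:
  fixes A :: "real^'n^'n"
  assumes "eigenframe A e d"
  shows "det (mat t - A) = (\<Prod>i\<in>UNIV. t - d i)"
proof -
  define Q :: "real^'n^'n" where "Q = (\<chi> a i. e i $ a)"
  define D :: "real^'n^'n" where "D = (\<chi> i j. if i = j then t - d i else 0)"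
  have A: "A *v e i = d i *\<^sub>R e i" for i using assms by (simp add: eigenframe_def)
  have "transpose Q ** Q = mat 1"
    using assms
    by (simp add: Q_def matrix_matrix_mult_def transpose_def mat_def vec_eq_iff orthonormal_frame_def
        inner_vec_def eigenframe_def)
  then have "det (transpose Q) * det Q = 1" by (metis det_I det_mul)
  then have Q0: "det Q \<noteq> 0" by auto
  have "((mat t - A) ** Q) $ a $ i = (Q ** D) $ a $ i" for a i
  proof -
    have "((mat t - A) ** Q) $ a $ i = ((mat t - A) *v e i) $ a"
      by (simp add: matrix_matrix_mult_def matrix_vector_mult_def Q_def)
    also have "\<dots> = (t - d i) * e i $ a"
      by (simp add: matrix_vector_mult_diff_rdistrib mat_mult_vec A algebra_simps)
    also have "\<dots> = (Q ** D) $ a $ i"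
      by (simp add: matrix_matrix_mult_def Q_def D_def if_distrib[of "\<lambda>x. _ * x"] mult.commute cong: if_cong)
    finally show ?thesis .
  qed
  then have "(mat t - A) ** Q = Q ** D" by (simp add: vec_eq_iff)
  then have "det (mat t - A) * det Q = det Q * det D" by (metis det_mul)
  moreover have "det D = (\<Prod>i\<in>UNIV. t - d i)"
    by (subst det_diagonal) (auto simp: D_def)
  ultimately show ?thesis using Q0 by simp
qed

lemma sum_singletons: "finite A \<Longrightarrow> (\<Sum>i\<in>A. {#x i#}) = image_mset x (mset_set A)"
  by (induction A rule: finite_induct) simp_all

text \<open>Both products are polynomials in t, whose multisets of roots are the images of l and of
  d; equal images with multiplicity differ by a permutation.\<close>

lemma prod_linear_eq_imp_permutes:
  fixes l d :: "'n::finite \<Rightarrow> real"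
  assumes "\<And>t. (\<Prod>i\<in>UNIV. t - l i) = (\<Prod>i\<in>UNIV. t - d i)"
  obtains \<pi> where "\<pi> permutes UNIV" "\<And>i. l i = d (\<pi> i)"
proof -
  have roots: "proots (\<Prod>i\<in>UNIV. [:- x i, 1:]) = image_mset x (mset_set UNIV)" for x :: "'n \<Rightarrow> real"
  proof -
    have "proots (\<Prod>i\<in>UNIV. [:- x i, 1:]) = (\<Sum>i\<in>UNIV. {#x i#})"
      by (subst proots_prod) auto
    also have "\<dots> = image_mset x (mset_set UNIV)"
      by (simp add: sum_singletons)
    finally show ?thesis .
  qed
  have "poly (\<Prod>i\<in>UNIV. [:- l i, 1:]) t = poly (\<Prod>i\<in>UNIV. [:- d i, 1:]) t" for t
    using assms[of t] by (simp add: poly_prod)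
  then have "(\<Prod>i\<in>UNIV. [:- l i, 1:]) = (\<Prod>i\<in>UNIV. [:- d i, 1:])" by (intro poly_ext)
  then have "image_mset l (mset_set UNIV) = image_mset d (mset_set UNIV)" by (metis roots)
  then obtain \<pi> where "\<pi> permutes UNIV" "\<forall>x\<in>UNIV. d x = l (\<pi> x)"
    using image_mset_eq_implies_permutes[of "UNIV :: 'n set" d l] by auto
  then show ?thesis
    using that[of "inv \<pi>"] by (simp add: permutes_inv permutes_inverses)
qed

text \<open>This gives access to the unspecified choice in \<open>eigenvalues\<close>: up to order,
  the chosen vector consists of the eigenvalues of any eigenframe.\<close>

lemma eigenvalues_eigenframe:
  fixes A :: "real^'n^'n"
  assumes "eigenframe A e d"
  obtains \<pi> where "\<pi> permutes UNIV" "\<And>i. eigenvalues A $ i = d (\<pi> i)"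
proof -
  have "\<forall>t. det (mat t - A) = (\<Prod>i\<in>UNIV. t - (\<chi> i. d i) $ i)"
    using eigenframe_charpoly[OF assms] by simp
  then have "\<forall>t. det (mat t - A) = (\<Prod>i\<in>UNIV. t - eigenvalues A $ i)"
    unfolding eigenvalues_def by (rule someI)
  then show ?thesis
    using prod_linear_eq_imp_permutes[of "\<lambda>i. eigenvalues A $ i" d] eigenframe_charpoly[OF assms] that
    by metis
qed

text \<open>Think of b as a concave function sampled at the points m i, with g i as a supergradient
  there. It exists because g decreases as m grows, and it is built one point at a time from the
  left.\<close>

lemma antitone_potential:
  fixes g m :: "'a \<Rightarrow> real"
  assumes "finite S" "\<And>i j. i \<in> S \<Longrightarrow> j \<in> S \<Longrightarrow> (g i - g j) * (m i - m j) \<le> 0"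
  shows "\<exists>b. \<forall>i\<in>S. \<forall>j\<in>S. b j - b i \<le> g i * (m j - m i)"
  using assms
proof (induction "card S" arbitrary: S)
  case (Suc n)
  \<comment> \<open>Maximizing m - g yields an element with both the largest m and the smallest g:
    by hypothesis m and g never increase strictly together.\<close>
  have top: "\<exists>q\<in>T. \<forall>i\<in>T. m i \<le> m q \<and> g q \<le> g i" if T: "T \<subseteq> S" "T \<noteq> {}" for T
  proof -
    have "finite T" using T Suc.prems finite_subset by blast
    then have "Max ((\<lambda>i. m i - g i) ` T) \<in> (\<lambda>i. m i - g i) ` T"
      "\<And>i. i \<in> T \<Longrightarrow> m i - g i \<le> Max ((\<lambda>i. m i - g i) ` T)"
      using T(2) by (auto intro: Max_in)
    then obtain q where q: "q \<in> T" "\<And>i. i \<in> T \<Longrightarrow> m i - g i \<le> m q - g q"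
      by (metis (no_types, lifting) imageE)
    have "m i \<le> m q \<and> g q \<le> g i" if "i \<in> T" for i
    proof -
      have "(g i - g q) * (m i - m q) \<le> 0" using Suc.prems(2) T q(1) that by blast
      then show ?thesis using q(2)[OF that] by (auto simp: mult_le_0_iff)
    qed
    then show ?thesis using q(1) by blast
  qed
  have "S \<noteq> {}" using Suc.hyps by auto
  then obtain q where q: "q \<in> S" "\<And>i. i \<in> S \<Longrightarrow> m i \<le> m q" "\<And>i. i \<in> S \<Longrightarrow> g q \<le> g i"
    using top[of S] by blast
  define T where "T = S - {q}"
  have S: "S = insert q T" and qT: "q \<notin> T" using q by (auto simp: T_def)
  have "card T = n" using q(1) Suc by (simp add: T_def)
  moreover have "finite T" "\<And>i j. i \<in> T \<Longrightarrow> j \<in> T \<Longrightarrow> (g i - g j) * (m i - m j) \<le> 0"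
    using Suc.prems by (auto simp: T_def)
  ultimately obtain b where b: "\<And>i j. i \<in> T \<Longrightarrow> j \<in> T \<Longrightarrow> b j - b i \<le> g i * (m j - m i)"
    using Suc.hyps(1)[of T] by blast
  show ?case
  proof (cases "T = {}")
    case True
    then show ?thesis by (auto simp: S)
  next
    case False
    then obtain p where p: "p \<in> T" "\<And>i. i \<in> T \<Longrightarrow> m i \<le> m p" using top[of T] S by blast
    \<comment> \<open>To the right of the last remaining point p the concave function continues with
      slope g q.\<close>
    define b' where "b' = b(q := b p + g q * (m q - m p))"
    have "b' j - b' i \<le> g i * (m j - m i)" if ij: "i \<in> S" "j \<in> S" for i j
    proof -
      consider "i \<in> T" "j \<in> T" | "i = q" "j = q" | "i \<in> T" "j = q" | "i = q" "j \<in> T"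
        using ij S by blast
      then show ?thesis
      proof cases
        case 3
        have "g q * (m q - m p) \<le> g i * (m q - m p)"
          using q p(1) S ij by (intro mult_right_mono) auto
        then show ?thesis using b[OF 3(1) p(1)] 3 qT by (auto simp: b'_def algebra_simps)
      next
        case 4
        have "g p * (m j - m p) \<le> g q * (m j - m p)"
          using q p 4 S by (intro mult_right_mono_neg) auto
        then show ?thesis using b[OF p(1) 4(2)] 4 qT by (auto simp: b'_def algebra_simps)
      qed (use b qT in \<open>auto simp: b'_def\<close>)
    qed
    then show ?thesis by blast
  qed
qed simp

text \<open>Replaces the Birkhoff--von Neumann theorem: a dual certificate for the assignment problem is
  available because an optimal assignment orders \<open>g\<close> and \<open>m\<close> oppositely.\<close>

lemma doubly_stochastic_ge_permutation:
  fixes g m :: "'n::finite \<Rightarrow> real"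
  assumes P: "\<And>i j. P i j \<ge> 0" "\<And>i. (\<Sum>j\<in>UNIV. P i j) = 1" "\<And>j. (\<Sum>i\<in>UNIV. P i j) = 1"
  shows "\<exists>\<pi>. \<pi> permutes UNIV \<and> (\<Sum>i\<in>UNIV. g i * m (\<pi> i)) \<le> (\<Sum>i\<in>UNIV. g i * (\<Sum>j\<in>UNIV. P i j * m j))"
proof -
  let ?f = "\<lambda>\<pi>. \<Sum>i\<in>UNIV. g i * m (\<pi> i)"
  have "finite {\<pi>. \<pi> permutes (UNIV :: 'n set)}" by (simp add: finite_permutations)
  moreover have "{\<pi>. \<pi> permutes (UNIV :: 'n set)} \<noteq> {}" using permutes_id by blast
  ultimately obtain \<pi> where \<pi>: "\<pi> permutes UNIV" and min: "\<And>\<rho>. \<rho> permutes UNIV \<Longrightarrow> ?f \<pi> \<le> ?f \<rho>"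
    using ex_min_if_finite[of "?f ` {\<pi>. \<pi> permutes (UNIV :: 'n set)}"]
    by (auto simp: not_less)
  define \<mu> where "\<mu> = (\<lambda>i. m (\<pi> i))"
  \<comment> \<open>Exchanging two values of an optimal assignment cannot lower its cost, which says
    that g and the assigned values are oppositely ordered.\<close>
  have anti: "(g i - g j) * (\<mu> i - \<mu> j) \<le> 0" for i j
  proof (cases "i = j")
    case False
    let ?\<rho> = "\<pi> \<circ> Transposition.transpose i j"
    have "?\<rho> permutes UNIV" using \<pi> by (intro permutes_compose permutes_swap_id) auto
    from min[OF this] have le: "?f \<pi> \<le> ?f ?\<rho>" .
    have split: "(\<Sum>l\<in>UNIV. h l) = h i + h j + (\<Sum>l\<in>UNIV - {i, j}. h l)" for h :: "'n \<Rightarrow> real"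
    proof -
      have "(\<Sum>l\<in>UNIV. h l) = (\<Sum>l\<in>{i, j}. h l) + (\<Sum>l\<in>UNIV - {i, j}. h l)"
        by (subst add.commute, rule sum.subset_diff) auto
      then show ?thesis using False by simp
    qed
    have rest: "(\<Sum>l\<in>UNIV - {i, j}. g l * m (?\<rho> l)) = (\<Sum>l\<in>UNIV - {i, j}. g l * m (\<pi> l))"
      by (intro sum.cong refl) (auto simp: Transposition.transpose_def)
    have "g i * \<mu> i + g j * \<mu> j \<le> g i * \<mu> j + g j * \<mu> i"
      using le unfolding split rest by (simp add: \<mu>_def)
    then show ?thesis by (simp add: algebra_simps)
  qed simp
  obtain b where b: "\<And>i j. b j - b i \<le> g i * (\<mu> j - \<mu> i)"
    using antitone_potential[of UNIV g \<mu>] anti by auto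
  define R where "R = (\<lambda>i j. P i (\<pi> j))"
  have bij: "bij \<pi>" using \<pi> by (rule permutes_bij)
  have R: "R i j \<ge> 0" "(\<Sum>j\<in>UNIV. R i j) = 1" "(\<Sum>i\<in>UNIV. R i j) = 1" for i j
    using P sum.reindex_bij_betw[OF bij, of "P i"] by (auto simp: R_def)
  have "?f \<pi> = (\<Sum>i\<in>UNIV. g i * \<mu> i)" by (simp add: \<mu>_def)
  \<comment> \<open>Both marginals of R are one, so b can be subtracted along the rows and added
    along the columns; under the double sum its inequality then applies entry by entry.\<close>
  also have "\<dots> = (\<Sum>i\<in>UNIV. (g i * \<mu> i - b i) * (\<Sum>j\<in>UNIV. R i j)) + (\<Sum>j\<in>UNIV. b j * (\<Sum>i\<in>UNIV. R i j))"
    by (simp add: R sum_subtractf)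
  also have "(\<Sum>j\<in>UNIV. b j * (\<Sum>i\<in>UNIV. R i j)) = (\<Sum>i\<in>UNIV. \<Sum>j\<in>UNIV. b j * R i j)"
    by (subst sum.swap) (simp add: sum_distrib_left)
  also have "(\<Sum>i\<in>UNIV. (g i * \<mu> i - b i) * (\<Sum>j\<in>UNIV. R i j)) + (\<Sum>i\<in>UNIV. \<Sum>j\<in>UNIV. b j * R i j)
      = (\<Sum>i\<in>UNIV. \<Sum>j\<in>UNIV. R i j * (g i * \<mu> i - b i + b j))"
    by (simp add: sum_distrib_left sum.distrib[symmetric] sum_subtractf[symmetric] algebra_simps)
  also have "\<dots> \<le> (\<Sum>i\<in>UNIV. \<Sum>j\<in>UNIV. R i j * (g i * \<mu> j))"
  proof (intro sum_mono mult_left_mono R)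
    fix i j show "g i * \<mu> i - b i + b j \<le> g i * \<mu> j" using b[of j i] by (simp add: algebra_simps)
  qed
  also have "\<dots> = (\<Sum>i\<in>UNIV. g i * (\<Sum>j\<in>UNIV. P i (\<pi> j) * m (\<pi> j)))"
    by (simp add: R_def \<mu>_def sum_distrib_left algebra_simps)
  also have "\<dots> = (\<Sum>i\<in>UNIV. g i * (\<Sum>j\<in>UNIV. P i j * m j))"
    by (intro sum.cong refl arg_cong2[where f = "(*)"] sum.reindex_bij_betw[OF bij])
  finally show ?thesis using \<pi> by blast
qed

text \<open>In the frame e the diagonal entries of B are averages of its eigenvalues with weights
  (e_i . v_j)^2, a doubly stochastic matrix. This makes up for the lack of a common eigenframe of
  two Hessians.\<close>

lemma eigenframe_diagonal_ge_permutation: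
  fixes B :: "real^'n^'n"
  assumes e: "orthonormal_frame e" and B: "eigenframe B v d"
  shows "\<exists>\<pi>. \<pi> permutes UNIV \<and> (\<Sum>i\<in>UNIV. g i * d (\<pi> i)) \<le> (\<Sum>i\<in>UNIV. g i * ((B *v e i) \<bullet> e i))"
proof -
  have v: "orthonormal_frame v" and Bv: "\<And>i. B *v v i = d i *\<^sub>R v i"
    using B by (auto simp: eigenframe_def)
  have "(B *v x) \<bullet> x = (\<Sum>j\<in>UNIV. (x \<bullet> v j)\<^sup>2 * d j)" for x
  proof -
    have "B *v x = B *v (\<Sum>j\<in>UNIV. (x \<bullet> v j) *\<^sub>R v j)"
      by (simp add: orthonormal_frame_expand[OF v])
    also have "\<dots> = (\<Sum>j\<in>UNIV. (x \<bullet> v j) *\<^sub>R d j *\<^sub>R v j)"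
      by (simp add: linear_sum[OF matrix_vector_mul_linear] matrix_vector_mult_scaleR Bv)
    finally show ?thesis
      by (simp add: inner_sum_left inner_commute[of "v _" x] power2_eq_square algebra_simps)
  qed
  moreover have "(\<Sum>j\<in>UNIV. (e i \<bullet> v j)\<^sup>2) = 1" for i
    using orthonormal_frame_inner[OF v, of "e i" "e i"] e
    by (simp add: power2_eq_square orthonormal_frame_def)
  moreover have "(\<Sum>i\<in>UNIV. (e i \<bullet> v j)\<^sup>2) = 1" for j
    using orthonormal_frame_inner[OF e, of "v j" "v j"] v
    by (simp add: power2_eq_square orthonormal_frame_def inner_commute)
  ultimately show ?thesis
    using doubly_stochastic_ge_permutation[of "\<lambda>i j. (e i \<bullet> v j)\<^sup>2" g d] by simp
qed

section \<open>Supporting hyperplanes of superlevel sets\<close>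

text \<open>Appending \<open>\<alpha>\<close> to \<open>\<eta>\<close> turns \<open>\<sigma>\<^sub>k(\<eta>) + \<alpha> \<sigma>\<^sub>k\<^sub>-\<^sub>1(\<eta>)\<close> into an elementary symmetric function.\<close>

definition hat :: "real \<Rightarrow> ('n::finite \<Rightarrow> real) \<Rightarrow> 'n option \<Rightarrow> real" where
  "hat \<alpha> d j = (case j of None \<Rightarrow> \<alpha> | Some i \<Rightarrow> sum d UNIV - d i)"

lemma hat_simps [simp]: "hat \<alpha> d None = \<alpha>" "hat \<alpha> d (Some i) = sum d UNIV - d i"
  by (simp_all add: hat_def)

lemma UNIV_option_minus_None: "UNIV - {None} = range Some"
  by (auto simp: UNIV_option_conv)

lemma sum_UNIV_option:
  fixes f :: "'n::finite option \<Rightarrow> real"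
  shows "(\<Sum>j\<in>UNIV. f j) = f None + (\<Sum>i\<in>UNIV. f (Some i))"
  by (simp add: UNIV_option_conv sum.reindex)

lemma esf_option:
  fixes x :: "'n::finite option \<Rightarrow> real"
  shows "esf (Suc k) UNIV x = esf (Suc k) UNIV (\<lambda>i. x (Some i)) + x None * esf k UNIV (\<lambda>i. x (Some i))"
  using esf_remove[of UNIV None k x] by (simp add: UNIV_option_minus_None esf_reindex)

lemma esf_hat_permutes:
  assumes "\<pi> permutes (UNIV :: 'n::finite set)"
  shows "esf k UNIV (hat \<alpha> (\<lambda>i. d (\<pi> i))) = esf k UNIV (hat \<alpha> d)"
proof (cases k)
  case (Suc j)
  have s: "(\<Sum>i\<in>UNIV. d (\<pi> i)) = sum d UNIV"
    using sum.permute[OF assms, of d] by (simp add: comp_def)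
  show ?thesis
    unfolding Suc esf_option hat_simps s
    using esf_permutes[OF assms, of _ "\<lambda>i. sum d UNIV - d i"] by simp
qed simp

text \<open>An explicit vector of the cone with a negative entry. With n the number of indices, its
  symmetric function of order m + 1 is C(n-1, m+1) - C(n-1, m) / n, which is positive because C(n-1,
  m) <= (m+1) C(n-1, m+1) < n C(n-1, m+1) for m + 1 < n.\<close>

lemma esf_cone_indicator_perturbed:
  fixes i :: "'n::finite"
  assumes "k < CARD('n)"
  shows "(\<lambda>j. case j of None \<Rightarrow> 0 | Some l \<Rightarrow> if l = i then - 1 / real CARD('n) else 1) \<in> esf_cone k UNIV"
    (is "?D \<in> _")
  unfolding esf_cone_def
proof (intro CollectI allI impI)
  fix j assume j: "j \<le> k"
  let ?n = "CARD('n)"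
  show "esf j UNIV ?D > 0"
  proof (cases j)
    case (Suc m)
    let ?R = "UNIV - {i}"
    have R: "card ?R = ?n - 1" by (simp add: card_Diff_singleton)
    have ones: "esf l ?R (\<lambda>l. ?D (Some l)) = real ((?n - 1) choose l)" for l
    proof -
      have "esf l ?R (\<lambda>l. ?D (Some l)) = esf l ?R (\<lambda>_. 1)" by (rule esf_cong) auto
      then show ?thesis by (simp add: esf_ones R)
    qed
    have le: "Suc m \<le> ?n - 1" using j Suc assms by simp
    have "esf (Suc m) UNIV ?D = real ((?n - 1) choose Suc m) - 1 / real ?n * real ((?n - 1) choose m)"
      using esf_option[of m ?D] esf_remove[of UNIV i m "\<lambda>l. ?D (Some l)"] ones[of "Suc m"] ones[of m] by simp
    moreover have "real ((?n - 1) choose m) / real ?n < real ((?n - 1) choose Suc m)"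
    proof -
      have "Suc m * ((?n - 1) choose Suc m) = (?n - 1 - m) * ((?n - 1) choose m)"
        by (simp only: binomial_absorption binomial_absorb_comp)
      then have "(?n - 1) choose m \<le> Suc m * ((?n - 1) choose Suc m)"
        using le by (cases "?n - 1 - m") auto
      also have "\<dots> < ?n * ((?n - 1) choose Suc m)"
        using le by (intro mult_strict_right_mono) auto
      finally have "real ((?n - 1) choose m) < real ?n * real ((?n - 1) choose Suc m)"
        by (simp flip: of_nat_mult)
      then show ?thesis by (simp add: divide_less_eq mult.commute)
    qed
    ultimately show ?thesis by (simp add: Suc)
  qed simp
qed

text \<open>The weights a are the normalized derivatives of the equation with respect to the
  eigenvalues of A. The entry \<alpha> is the same for both matrices and drops out of the supporting
  inequality.\<close>

lemma supporting_frame: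
  fixes A :: "real^'n^'n"
  assumes A: "eigenframe A e d" and cone: "hat \<alpha> d \<in> esf_cone (Suc k) UNIV" and k: "Suc k < CARD('n)"
  obtains a where "\<And>i. 1 / (real CARD('n) + 1) \<le> a i" "\<And>i. a i \<le> 1"
    "\<And>B v \<mu>. eigenframe B v \<mu> \<Longrightarrow> hat \<alpha> \<mu> \<in> esf_cone (Suc k) UNIV
      \<Longrightarrow> esf (Suc k) UNIV (hat \<alpha> d) \<le> esf (Suc k) UNIV (hat \<alpha> \<mu>)
      \<Longrightarrow> 0 \<le> (\<Sum>i\<in>UNIV. a i * (((B - A) *v e i) \<bullet> e i))"
proof -
  let ?n = "real CARD('n)"
  define g where "g = (\<lambda>j. esf k (UNIV - {j}) (hat \<alpha> d))"
  have gpos: "g j > 0" for j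
    using esf_cone_remove[OF _ _ cone, of j] by (simp add: g_def esf_coneD)
  define G where "G = (\<Sum>i\<in>UNIV. g (Some i))"
  have Gpos: "G > 0" unfolding G_def by (intro sum_pos gpos) auto
  \<comment> \<open>An eigenvalue enters every entry of \<eta> except its own, so its derivative is
    the sum of all g except one. Division by G makes the upper bound 1.\<close>
  define a where "a = (\<lambda>i. (G - g (Some i)) / G)"
  have a1: "a i \<le> 1" for i using gpos[of "Some i"] Gpos by (simp add: a_def divide_le_eq)
  have a2: "1 / (?n + 1) \<le> a i" for i
  proof -
    \<comment> \<open>Testing the gradient against this cone vector shows that no single g exceeds
      the fraction n / (n + 1) of their sum.\<close>
    let ?D = "\<lambda>j. case j of None \<Rightarrow> 0 | Some l \<Rightarrow> if l = i then - 1 / ?n else 1"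
    have "0 \<le> (\<Sum>j\<in>UNIV. ?D j * g j)"
      unfolding g_def by (rule esf_derivative_cone_nonneg[OF _ cone esf_cone_indicator_perturbed[OF k]]) simp
    also have "\<dots> = (\<Sum>l\<in>UNIV. g (Some l) - (if l = i then (1 + 1 / ?n) * g (Some l) else 0))"
      unfolding sum_UNIV_option by (auto intro!: sum.cong simp: algebra_simps)
    also have "\<dots> = G - (1 + 1 / ?n) * g (Some i)"
      by (simp add: sum_subtractf G_def)
    finally have le: "(1 + 1 / ?n) * g (Some i) \<le> G" by simp
    have "(1 + 1 / ?n) * g (Some i) * ?n \<le> G * ?n" by (rule mult_right_mono[OF le]) simp
    then have "(?n + 1) * g (Some i) \<le> ?n * G" by (simp add: algebra_simps)
    then have "1 * G \<le> (G - g (Some i)) * (?n + 1)" by (simp add: algebra_simps)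
    then show ?thesis
      unfolding a_def using Gpos by (subst frac_le_eq) (auto simp: divide_le_0_iff mult.commute)
  qed
  have a3: "0 \<le> (\<Sum>i\<in>UNIV. a i * (((B - A) *v e i) \<bullet> e i))"
    if B: "eigenframe B v \<mu>" and c: "hat \<alpha> \<mu> \<in> esf_cone (Suc k) UNIV"
      and le: "esf (Suc k) UNIV (hat \<alpha> d) \<le> esf (Suc k) UNIV (hat \<alpha> \<mu>)" for B v \<mu>
  proof -
    have e: "orthonormal_frame e" using A by (simp add: eigenframe_def)
    \<comment> \<open>A reordering of the eigenvalues of B stays on the same level of the symmetric
      function, so the supporting inequality may be used for the ordering that bounds the diagonal
      of B from below.\<close>
    obtain \<pi> where \<pi>: "\<pi> permutes UNIV"
      and ge: "(\<Sum>i\<in>UNIV. a i * \<mu> (\<pi> i)) \<le> (\<Sum>i\<in>UNIV. a i * ((B *v e i) \<bullet> e i))"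
      using eigenframe_diagonal_ge_permutation[OF e B, of a] by blast
    define m where "m = (\<lambda>i. \<mu> (\<pi> i))"
    have esf: "esf j UNIV (hat \<alpha> m) = esf j UNIV (hat \<alpha> \<mu>)" for j
      unfolding m_def by (rule esf_hat_permutes[OF \<pi>])
    have "0 \<le> (\<Sum>j\<in>UNIV. (hat \<alpha> m j - hat \<alpha> d j) * g j)"
      unfolding g_def by (rule esf_supporting[OF _ cone]) (use c le in \<open>simp_all add: esf_cone_def esf\<close>)
    also have "\<dots> = (\<Sum>i\<in>UNIV. (sum m UNIV - sum d UNIV) * g (Some i) - (m i - d i) * g (Some i))"
      unfolding sum_UNIV_option by (simp add: algebra_simps)
    also have "\<dots> = (sum m UNIV - sum d UNIV) * G - (\<Sum>i\<in>UNIV. (m i - d i) * g (Some i))"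
      by (simp add: sum_subtractf G_def sum_distrib_left)
    also have "\<dots> = (\<Sum>i\<in>UNIV. (m i - d i) * (G - g (Some i)))"
      by (simp add: algebra_simps sum_subtractf sum.distrib sum_distrib_left)
    also have "\<dots> = G * (\<Sum>i\<in>UNIV. a i * (m i - d i))"
      using Gpos by (simp add: a_def sum_distrib_left mult.commute)
    finally have "0 \<le> (\<Sum>i\<in>UNIV. a i * (m i - d i))" using Gpos by (simp add: zero_le_mult_iff)
    also have "\<dots> \<le> (\<Sum>i\<in>UNIV. a i * ((B *v e i) \<bullet> e i)) - (\<Sum>i\<in>UNIV. a i * d i)"
      using ge by (simp add: right_diff_distrib sum_subtractf m_def)
    also have "\<dots> = (\<Sum>i\<in>UNIV. a i * (((B - A) *v e i) \<bullet> e i))"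
      using A e
      by (simp add: eigenframe_def matrix_vector_mult_diff_rdistrib inner_diff_left right_diff_distrib
          sum_subtractf orthonormal_frame_def)
    finally show ?thesis .
  qed
  show ?thesis by (rule that[OF a2 a1 a3])
qed

text \<open>Adding t / (n - 1) to every eigenvalue adds t to every entry of \<eta> and leaves
  \<alpha> unchanged. By superadditivity the function then gains at least its value at the shift, a
  binomial coefficient times t^(k+1).\<close>

lemma hat_shift:
  fixes d :: "'n::finite \<Rightarrow> real"
  assumes cone: "hat \<alpha> d \<in> esf_cone (Suc k) UNIV" and k: "Suc k < CARD('n)" and t: "t > 0"
  defines "d' \<equiv> (\<lambda>i. d i + t / (real CARD('n) - 1))"
  shows "hat \<alpha> d' \<in> esf_cone (Suc k) UNIV"
    "esf (Suc k) UNIV (hat \<alpha> d) + t ^ Suc k \<le> esf (Suc k) UNIV (hat \<alpha> d')"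
proof -
  let ?E = "\<lambda>j. t * (case j of None \<Rightarrow> 0 | Some (l :: 'n) \<Rightarrow> 1)"
  have n: "real CARD('n) - 1 > 0" using k by simp
  define s where "s = t / (real CARD('n) - 1)"
  have "(real CARD('n) - 1) * s = t" using n by (simp add: s_def)
  then have s: "real CARD('n) * s - s = t" by (simp add: left_diff_distrib)
  have eq: "hat \<alpha> d' = (\<lambda>j. hat \<alpha> d j + ?E j)"
  proof
    fix j show "hat \<alpha> d' j = hat \<alpha> d j + ?E j"
      using s by (cases j) (auto simp: d'_def sum.distrib simp flip: s_def)
  qed
  have E: "esf j UNIV ?E = t ^ j * real (CARD('n) choose j)" for j
  proof (cases j)
    case (Suc m)
    have "esf (Suc m) UNIV (\<lambda>j. case j of None \<Rightarrow> 0 | Some (l :: 'n) \<Rightarrow> 1) = real (CARD('n) choose Suc m)"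
      by (simp add: esf_option esf_ones)
    then show ?thesis by (simp add: Suc esf_scale)
  qed simp
  have c: "?E \<in> esf_cone (Suc k) UNIV"
  proof -
    have "0 < esf j UNIV ?E" if "j \<le> Suc k" for j
      unfolding E using t k that by (intro mult_pos_pos) auto
    then show ?thesis by (simp add: esf_cone_def)
  qed
  show "hat \<alpha> d' \<in> esf_cone (Suc k) UNIV" unfolding eq by (rule esf_cone_add[OF _ cone c]) simp
  have "0 < CARD('n) choose Suc k" using k by (intro zero_less_binomial) simp
  then have "1 \<le> real (CARD('n) choose Suc k)" by linarith
  then have "t ^ Suc k * 1 \<le> esf (Suc k) UNIV ?E" unfolding E using t by (intro mult_left_mono) auto
  then show "esf (Suc k) UNIV (hat \<alpha> d) + t ^ Suc k \<le> esf (Suc k) UNIV (hat \<alpha> d')"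
    unfolding eq using esf_superadd[OF _ cone c] by simp
qed

text \<open>If the value at B falls short of the value at A, then B is shifted by a multiple of the
  identity until it reaches that level. The required t is the root of the deficit of order
  \<open>Suc k\<close>, and the shift costs at most n t since all weights are at most 1.\<close>

lemma supporting_frame_Hoelder:
  fixes A :: "real^'n^'n"
  assumes A: "eigenframe A e d" and cone: "hat \<alpha> d \<in> esf_cone (Suc k) UNIV" and k: "Suc k < CARD('n)"
  obtains a where "\<And>i. 1 / (real CARD('n) + 1) \<le> a i" "\<And>i. a i \<le> 1"
    "\<And>B v \<mu>. eigenframe B v \<mu> \<Longrightarrow> hat \<alpha> \<mu> \<in> esf_cone (Suc k) UNIV
      \<Longrightarrow> - (real CARD('n) * \<bar>esf (Suc k) UNIV (hat \<alpha> \<mu>) - esf (Suc k) UNIV (hat \<alpha> d)\<bar> powr (1 / real (Suc k)))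
         \<le> (\<Sum>i\<in>UNIV. a i * (((B - A) *v e i) \<bullet> e i))"
proof -
  let ?n = "real CARD('n)" and ?f = "\<lambda>d. esf (Suc k) UNIV (hat \<alpha> d)"
  obtain a where a: "\<And>i. 1 / (?n + 1) \<le> a i" "\<And>i. a i \<le> 1"
    and sup: "\<And>B v \<mu>. eigenframe B v \<mu> \<Longrightarrow> hat \<alpha> \<mu> \<in> esf_cone (Suc k) UNIV \<Longrightarrow> ?f d \<le> ?f \<mu>
      \<Longrightarrow> 0 \<le> (\<Sum>i\<in>UNIV. a i * (((B - A) *v e i) \<bullet> e i))"
    by (rule supporting_frame[OF A cone k]) (rule that, assumption+)
  have e: "orthonormal_frame e" using A by (simp add: eigenframe_def)
  have n: "?n - 1 \<ge> 1" using k by simp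
  have main: "- (?n * \<bar>?f \<mu> - ?f d\<bar> powr (1 / real (Suc k))) \<le> (\<Sum>i\<in>UNIV. a i * (((B - A) *v e i) \<bullet> e i))"
    if B: "eigenframe B v \<mu>" and c: "hat \<alpha> \<mu> \<in> esf_cone (Suc k) UNIV" for B v \<mu>
  proof (cases "?f d \<le> ?f \<mu>")
    case True
    have "- (?n * \<bar>?f \<mu> - ?f d\<bar> powr (1 / real (Suc k))) \<le> 0" by simp
    also have "0 \<le> (\<Sum>i\<in>UNIV. a i * (((B - A) *v e i) \<bullet> e i))" by (rule sup[OF B c True])
    finally show ?thesis .
  next
    case False
    define t where "t = \<bar>?f \<mu> - ?f d\<bar> powr (1 / real (Suc k))"
    have t: "t > 0" "t ^ Suc k = ?f d - ?f \<mu>"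
      using False by (auto simp: t_def powr_powr simp flip: powr_realpow simp del: power_Suc)
    define s where "s = t / (?n - 1)"
    have s: "0 \<le> s" "s \<le> t"
      using t n by (auto simp: s_def divide_le_eq mult_le_cancel_left1)
    have B': "eigenframe (B + mat s) v (\<lambda>i. \<mu> i + s)"
      using B by (simp add: eigenframe_def matrix_vector_mult_add_rdistrib mat_mult_vec scaleR_left_distrib)
    have "0 \<le> (\<Sum>i\<in>UNIV. a i * (((B + mat s - A) *v e i) \<bullet> e i))"
      using hat_shift[OF c k t(1)] t(2) by (intro sup[OF B']) (auto simp: s_def)
    also have "\<dots> = (\<Sum>i\<in>UNIV. a i * (((B - A) *v e i) \<bullet> e i)) + (\<Sum>i\<in>UNIV. a i * s)"
    proof -
      have "((B + mat s - A) *v e i) \<bullet> e i = ((B - A) *v e i) \<bullet> e i + s" for i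
        using e by (simp add: matrix_vector_mult_diff_rdistrib matrix_vector_mult_add_rdistrib mat_mult_vec
            inner_diff_left inner_add_left orthonormal_frame_def)
      then show ?thesis by (simp add: distrib_left sum.distrib)
    qed
    also have "(\<Sum>i\<in>UNIV. a i * s) \<le> (\<Sum>i\<in>(UNIV :: 'n set). 1 * t)"
      using a s t order_trans[OF _ a(1), of 0] by (intro sum_mono mult_mono) auto
    finally show ?thesis by (simp add: t_def)
  qed
  show ?thesis by (rule that[OF a main])
qed

section \<open>A measure estimate for supersolutions\<close>

lemma second_derivative_test:
  fixes \<gamma> \<gamma>' :: "real \<Rightarrow> real"
  assumes "\<epsilon> > 0" and \<gamma>: "\<And>t. \<bar>t\<bar> < \<epsilon> \<Longrightarrow> (\<gamma> has_real_derivative \<gamma>' t) (at t)"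
    and D: "(\<gamma>' has_real_derivative D) (at 0)" and min: "\<And>t. \<bar>t\<bar> < \<epsilon> \<Longrightarrow> \<gamma> 0 \<le> \<gamma> t"
  shows "\<gamma>' 0 = 0" and "0 \<le> D"
proof -
  show z: "\<gamma>' 0 = 0"
    using DERIV_local_min[OF \<gamma>[of 0] \<open>\<epsilon> > 0\<close>] min \<open>\<epsilon> > 0\<close> by simp
  show "0 \<le> D"
  proof (rule ccontr)
    assume "\<not> 0 \<le> D"
    then obtain \<delta> where \<delta>: "\<delta> > 0" "\<And>h. 0 < h \<Longrightarrow> h < \<delta> \<Longrightarrow> \<gamma>' h < 0"
      using has_real_derivative_neg_dec_right[OF D] z by auto
    define h where "h = min \<delta> \<epsilon> / 2"
    have h: "0 < h" "h < \<delta>" "h < \<epsilon>" using \<delta>(1) \<open>\<epsilon> > 0\<close> by (auto simp: h_def)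
    obtain \<xi> where \<xi>: "0 < \<xi>" "\<xi> < h" "\<gamma> h - \<gamma> 0 = (h - 0) * \<gamma>' \<xi>"
      using MVT2[of 0 h \<gamma> \<gamma>'] h \<gamma> by auto
    have "(h - 0) * \<gamma>' \<xi> < 0" using \<xi> h \<delta>(2)[of \<xi>] by (simp add: mult_pos_neg)
    then show False using \<xi>(3) min[of h] h by simp
  qed
qed

text \<open>Gradient and Hessian are carried as explicit functions, with H the pointwise derivative
  of G, so that second differences and penalized functions remain in the class by plain
  algebra.\<close>

definition twice_diff_on :: "(real^'n) set \<Rightarrow> (real^'n \<Rightarrow> real) \<Rightarrow> (real^'n \<Rightarrow> real^'n) \<Rightarrow> (real^'n \<Rightarrow> real^'n^'n) \<Rightarrow> bool" where
  "twice_diff_on S v G H \<longleftrightarrow> (\<forall>x\<in>S. (v has_derivative (\<lambda>h. G x \<bullet> h)) (at x)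
     \<and> (G has_derivative (\<lambda>h. H x *v h)) (at x) \<and> transpose (H x) = H x)"

lemma twice_diff_on_subset: "twice_diff_on S v G H \<Longrightarrow> T \<subseteq> S \<Longrightarrow> twice_diff_on T v G H"
  unfolding twice_diff_on_def by blast

lemma transpose_add: "transpose (A + B) = transpose A + transpose (B :: 'a::semiring_1^'n^'m)"
  by (simp add: transpose_def vec_eq_iff)

lemma dist_square_inner: "(dist x y)\<^sup>2 = (x - y) \<bullet> (x - y)" for x :: "'a::real_inner"
  by (simp add: dist_norm power2_norm_eq_inner)

lemma twice_diff_on_add_paraboloid:
  assumes "twice_diff_on S v G H"
  shows "twice_diff_on S (\<lambda>z. v z + b / 2 * (dist z y)\<^sup>2 + q) (\<lambda>z. G z + b *\<^sub>R (z - y)) (\<lambda>z. H z + mat b)"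
  unfolding twice_diff_on_def
proof (intro ballI conjI)
  fix x assume x: "x \<in> S"
  have v: "(v has_derivative (\<lambda>h. G x \<bullet> h)) (at x)" and G: "(G has_derivative (\<lambda>h. H x *v h)) (at x)"
    and H: "transpose (H x) = H x" using assms x by (auto simp: twice_diff_on_def)
  have "((\<lambda>z. v z + b / 2 * ((z - y) \<bullet> (z - y)) + q) has_derivative (\<lambda>h. (G x + b *\<^sub>R (x - y)) \<bullet> h)) (at x)"
    by (rule derivative_eq_intros v refl | simp add: inner_add_left inner_commute algebra_simps)+
  then show "((\<lambda>z. v z + b / 2 * (dist z y)\<^sup>2 + q) has_derivative (\<lambda>h. (G x + b *\<^sub>R (x - y)) \<bullet> h)) (at x)"
    by (simp add: dist_square_inner)
  show "((\<lambda>z. G z + b *\<^sub>R (z - y)) has_derivative (\<lambda>h. (H x + mat b) *v h)) (at x)"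
    unfolding matrix_vector_mult_add_rdistrib mat_mult_vec
    by (rule derivative_eq_intros G refl | simp)+
  show "transpose (H x + mat b) = H x + mat b" using H by (simp add: transpose_add)
qed

lemma twice_diff_on_line:
  assumes "twice_diff_on S v G H" "x + t *\<^sub>R e \<in> S"
  shows "((\<lambda>t. v (x + t *\<^sub>R e)) has_real_derivative G (x + t *\<^sub>R e) \<bullet> e) (at t)"
    and "((\<lambda>t. G (x + t *\<^sub>R e) \<bullet> e) has_real_derivative (H (x + t *\<^sub>R e) *v e) \<bullet> e) (at t)"
proof -
  have l: "((\<lambda>t. x + t *\<^sub>R e) has_derivative (\<lambda>s. s *\<^sub>R e)) (at t)"
    by (rule derivative_eq_intros refl | simp)+
  have v: "(v has_derivative (\<lambda>h. G (x + t *\<^sub>R e) \<bullet> h)) (at (x + t *\<^sub>R e))"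
    and G: "(G has_derivative (\<lambda>h. H (x + t *\<^sub>R e) *v h)) (at (x + t *\<^sub>R e))"
    using assms by (auto simp: twice_diff_on_def)
  show "((\<lambda>t. v (x + t *\<^sub>R e)) has_real_derivative G (x + t *\<^sub>R e) \<bullet> e) (at t)"
    using has_derivative_compose[OF l v] by (simp add: has_field_derivative_def mult_commute_abs)
  have "((\<lambda>t. G (x + t *\<^sub>R e)) has_derivative (\<lambda>s. H (x + t *\<^sub>R e) *v (s *\<^sub>R e))) (at t)"
    using has_derivative_compose[OF l G] .
  from has_derivative_inner_left[OF this, of e]
  show "((\<lambda>t. G (x + t *\<^sub>R e) \<bullet> e) has_real_derivative (H (x + t *\<^sub>R e) *v e) \<bullet> e) (at t)"
    by (simp add: has_field_derivative_def matrix_vector_mult_scaleR mult_commute_abs)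
qed

lemma twice_diff_on_interior_min:
  assumes v: "twice_diff_on S v G H" and S: "open S" "x \<in> S" and min: "\<And>y. y \<in> S \<Longrightarrow> v x \<le> v y"
  shows "G x = 0" and "0 \<le> (H x *v e) \<bullet> e"
proof -
  have main: "G x \<bullet> e = 0 \<and> 0 \<le> (H x *v e) \<bullet> e" for e
  proof -
    obtain \<delta> where \<delta>: "\<delta> > 0" "ball x \<delta> \<subseteq> S" using S by (meson openE)
    define \<epsilon> where "\<epsilon> = \<delta> / (norm e + 1)"
    have \<epsilon>: "\<epsilon> > 0" using \<delta> by (auto simp: \<epsilon>_def intro!: divide_pos_pos add_nonneg_pos)
    have inS: "x + t *\<^sub>R e \<in> S" if "\<bar>t\<bar> < \<epsilon>" for t
    proof -
      have "norm (t *\<^sub>R e) \<le> \<bar>t\<bar> * (norm e + 1)" by (simp add: algebra_simps)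
      also have "\<dots> < \<delta>" using that by (simp add: \<epsilon>_def pos_less_divide_eq add_nonneg_pos)
      finally show ?thesis using \<delta> by (auto simp: subset_iff dist_norm)
    qed
    show ?thesis
      using second_derivative_test[OF \<epsilon> twice_diff_on_line(1)[OF v inS], of "(H x *v e) \<bullet> e"]
        twice_diff_on_line(2)[OF v, of x 0 e] min inS S by auto
  qed
  show "0 \<le> (H x *v e) \<bullet> e" using main by blast
  show "G x = 0" using main[of "G x"] by simp
qed

text \<open>The points where a concave paraboloid of opening b with vertex in Y touches w from below
  over K, expressed by minimality of w plus the opposite paraboloid.\<close>

definition paraboloid_contact :: "real \<Rightarrow> (real^'n) set \<Rightarrow> (real^'n) set \<Rightarrow> (real^'n \<Rightarrow> real) \<Rightarrow> (real^'n) set" where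
  "paraboloid_contact b K Y w =
     {x \<in> K. \<exists>y\<in>Y. \<forall>z\<in>K. w x + b / 2 * (dist x y)\<^sup>2 \<le> w z + b / 2 * (dist z y)\<^sup>2}"

text \<open>The set of pairs of a contact point and a vertex is closed in
  \<open>K \<times> Y\<close>, and the contact set is its projection. Compactness provides
  measurability later.\<close>

lemma compact_paraboloid_contact:
  assumes K: "compact K" and Y: "compact Y" and w: "continuous_on K w"
  shows "compact (paraboloid_contact b K Y w)"
proof -
  let ?F = "\<lambda>z p. w z + b / 2 * (dist z (snd p))\<^sup>2 - (w (fst p) + b / 2 * (dist (fst p) (snd p))\<^sup>2)"
  define P where "P = (\<Inter>z\<in>K. {p \<in> K \<times> Y. 0 \<le> ?F z p})"
  have cl: "closed (K \<times> Y)" using K Y by (intro compact_imp_closed compact_Times)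
  have "closed {p \<in> K \<times> Y. 0 \<le> ?F z p}" for z
  proof -
    have "continuous_on (K \<times> Y) (\<lambda>p. w (fst p))"
      by (rule continuous_on_compose2[OF w]) (auto intro: continuous_intros)
    then have "continuous_on (K \<times> Y) (?F z)" by (intro continuous_intros)
    then have "closed (K \<times> Y \<inter> ?F z -` {0..})"
      by (rule continuous_closed_preimage[OF _ cl]) simp
    also have "K \<times> Y \<inter> ?F z -` {0..} = {p \<in> K \<times> Y. 0 \<le> ?F z p}" by auto
    finally show ?thesis .
  qed
  then have "closed P" unfolding P_def by (intro closed_INT) blast
  then have "compact ((K \<times> Y) \<inter> P)" using K Y by (intro compact_Int_closed compact_Times)
  then have "compact (fst ` ((K \<times> Y) \<inter> P))" by (intro compact_continuous_image continuous_intros)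
  also have "fst ` ((K \<times> Y) \<inter> P) = paraboloid_contact b K Y w"
    by (force simp: P_def paraboloid_contact_def image_iff)
  finally show ?thesis .
qed

text \<open>The bookkeeping after Vitali's covering lemma: the \<open>N i\<close> are the enlarged
  covering sets, and each is paid for by a set \<open>P i\<close> from a disjoint family inside W.
  Finite subfamilies suffice by continuity of measure.\<close>

lemma measure_Union_disjoint_packing:
  fixes P N :: "'i \<Rightarrow> 'a::euclidean_space set"
  assumes C: "countable C" and disj: "pairwise (\<lambda>i j. disjnt (P i) (P j)) C"
    and P: "\<And>i. i \<in> C \<Longrightarrow> P i \<in> lmeasurable \<and> P i \<subseteq> W" and W: "W \<in> lmeasurable"
    and N: "\<And>i. i \<in> C \<Longrightarrow> N i \<in> lmeasurable" and k: "0 \<le> \<kappa>"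
    and le: "\<And>i. i \<in> C \<Longrightarrow> measure lebesgue (N i) \<le> \<kappa> * measure lebesgue (P i)"
  shows "(\<Union>i\<in>C. N i) \<in> lmeasurable" and "measure lebesgue (\<Union>i\<in>C. N i) \<le> \<kappa> * measure lebesgue W"
proof -
  have bound: "measure lebesgue (\<Union>i\<in>J. N i) \<le> \<kappa> * measure lebesgue W" if J: "J \<subseteq> C" "finite J" for J
  proof -
    have "measure lebesgue (\<Union>i\<in>J. N i) \<le> (\<Sum>i\<in>J. measure lebesgue (N i))"
      using J N by (intro measure_UNION_le) (auto dest: fmeasurableD)
    also have "\<dots> \<le> (\<Sum>i\<in>J. \<kappa> * measure lebesgue (P i))" using J by (intro sum_mono le) auto
    also have "\<dots> = \<kappa> * measure lebesgue (\<Union>i\<in>J. P i)"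
    proof -
      have "measure lebesgue (\<Union>i\<in>J. P i) = (\<Sum>i\<in>J. measure lebesgue (P i))"
        using J P disj
        by (intro measure_UNION') (auto intro: pairwise_subset simp: subset_iff)
      then show ?thesis by (simp add: sum_distrib_left)
    qed
    also have "\<dots> \<le> \<kappa> * measure lebesgue W"
      using J P W k by (intro mult_left_mono measure_mono_fmeasurable) (auto intro!: sets.finite_UN dest: fmeasurableD)
    finally show ?thesis .
  qed
  show "(\<Union>i\<in>C. N i) \<in> lmeasurable" by (rule fmeasurable_UN_bound[OF C N bound])
  show "measure lebesgue (\<Union>i\<in>C. N i) \<le> \<kappa> * measure lebesgue W" by (rule measure_UN_bound[OF C N bound])
qed

lemma measure_ball_scale:
  fixes x y :: "'a::euclidean_space"
  assumes "0 \<le> r" "0 \<le> k"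
  shows "measure lebesgue (ball x (k * r)) = k ^ DIM('a) * measure lebesgue (ball y r)"
    and "measure lebesgue (cball x (k * r)) = k ^ DIM('a) * measure lebesgue (ball y r)"
  using assms by (simp_all add: content_ball content_cball power_mult_distrib)

text \<open>The change of variables results of the library assume a well-ordered index type; this crude
  version suffices here.\<close>

lemma measure_pointwise_Lipschitz_image:
  fixes \<Phi> :: "'a::euclidean_space \<Rightarrow> 'a"
  assumes T: "T \<in> lmeasurable" and S: "S \<in> lmeasurable" "S \<subseteq> \<Phi> ` T" and L: "0 < L"
    and lip: "\<And>x. x \<in> T \<Longrightarrow> \<exists>\<delta>>0. \<forall>z. dist z x < \<delta> \<longrightarrow> dist (\<Phi> z) (\<Phi> x) \<le> L * dist z x"
  shows "measure lebesgue S \<le> (5 * L) ^ DIM('a) * measure lebesgue T"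
proof (rule field_le_epsilon)
  fix \<epsilon> :: real assume "0 < \<epsilon>"
  let ?k = "(5 * L) ^ DIM('a)"
  have k: "?k > 0" using L by simp
  obtain U where U: "open U" "T \<subseteq> U" "U - T \<in> lmeasurable" "emeasure lebesgue (U - T) < ennreal (\<epsilon> / ?k)"
    by (rule sets_lebesgue_outer_open[OF fmeasurableD[OF T] divide_pos_pos[OF \<open>0 < \<epsilon>\<close> k]]) (rule that, assumption+)
  have eq: "T \<union> (U - T) = U" using U by blast
  have Um: "U \<in> lmeasurable" using fmeasurable.Un[OF T U(3)] by (simp only: eq)
  have Ule: "measure lebesgue U \<le> measure lebesgue T + \<epsilon> / ?k"
  proof -
    have "measure lebesgue U \<le> measure lebesgue T + measure lebesgue (U - T)"
      using measure_Un_le[OF fmeasurableD[OF T] fmeasurableD[OF U(3)]] by (simp only: eq)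
    moreover have "measure lebesgue (U - T) \<le> \<epsilon> / ?k"
      using U(4) k \<open>0 < \<epsilon>\<close> by (simp add: emeasure_eq_measure2[OF U(3)] ennreal_less_iff)
    ultimately show ?thesis by simp
  qed
  \<comment> \<open>The radius keeps the ball inside the outer open set U, while the expansion bound
    holds on the ball five times as large. Only distances to the center are compared, so a bound at
    each point is enough.\<close>
  have "\<exists>\<rho>. 0 < \<rho> \<and> \<rho> \<le> 1 \<and> ball x \<rho> \<subseteq> U \<and> (\<forall>z. dist z x < 5 * \<rho> \<longrightarrow> dist (\<Phi> z) (\<Phi> x) \<le> L * dist z x)"
    if x: "x \<in> T" for x
  proof -
    obtain \<delta> where \<delta>: "\<delta> > 0" "\<forall>z. dist z x < \<delta> \<longrightarrow> dist (\<Phi> z) (\<Phi> x) \<le> L * dist z x" using lip[OF x] by blast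
    obtain \<epsilon>' where \<epsilon>': "\<epsilon>' > 0" "ball x \<epsilon>' \<subseteq> U" using U x by (meson openE subsetD)
    show ?thesis
      using \<delta> \<epsilon>' by (intro exI[of _ "min 1 (min (\<delta> / 5) \<epsilon>')"]) (auto simp: subset_iff)
  qed
  then have "\<forall>x\<in>T. \<exists>\<rho>. 0 < \<rho> \<and> \<rho> \<le> 1 \<and> ball x \<rho> \<subseteq> U \<and> (\<forall>z. dist z x < 5 * \<rho> \<longrightarrow> dist (\<Phi> z) (\<Phi> x) \<le> L * dist z x)"
    by blast
  from bchoice[OF this] obtain \<rho> where \<rho>: "\<And>x. x \<in> T \<Longrightarrow> 0 < \<rho> x \<and> \<rho> x \<le> 1" "\<And>x. x \<in> T \<Longrightarrow> ball x (\<rho> x) \<subseteq> U"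
    "\<And>x z. x \<in> T \<Longrightarrow> dist z x < 5 * \<rho> x \<Longrightarrow> dist (\<Phi> z) (\<Phi> x) \<le> L * dist z x"
    by blast
  have cov: "T \<subseteq> (\<Union>x\<in>T. ball x (\<rho> x))" using \<rho>(1) by force
  obtain C where C: "countable C" "C \<subseteq> T" "pairwise (\<lambda>i j. disjnt (ball i (\<rho> i)) (ball j (\<rho> j))) C"
    "T \<subseteq> (\<Union>i\<in>C. ball i (5 * \<rho> i))"
    by (rule Vitali_covering_lemma_balls[where S = T and K = T and a = "\<lambda>x. x" and r = \<rho> and B = 1, OF cov \<rho>(1)])
      (assumption, rule that, assumption+)
  have sub: "S \<subseteq> (\<Union>i\<in>C. cball (\<Phi> i) (5 * L * \<rho> i))"
  proof
    fix y assume "y \<in> S"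
    then obtain x where x: "x \<in> T" "y = \<Phi> x" using S(2) by blast
    then obtain i where i: "i \<in> C" "dist x i < 5 * \<rho> i" using C(4) by (auto simp: dist_commute)
    have "dist (\<Phi> x) (\<Phi> i) \<le> L * dist x i" using \<rho>(3)[of i x] i C(2) by blast
    also have "\<dots> \<le> 5 * L * \<rho> i" using i L by (simp add: mult.commute mult.left_commute)
    finally show "y \<in> (\<Union>i\<in>C. cball (\<Phi> i) (5 * L * \<rho> i))" using i x by (auto simp: dist_commute)
  qed
  have meas: "measure lebesgue (cball (\<Phi> i) (5 * L * \<rho> i)) \<le> ?k * measure lebesgue (ball i (\<rho> i))" if "i \<in> C" for i
    using measure_ball_scale(2)[of "\<rho> i" "5 * L" "\<Phi> i" i] \<rho>(1)[of i] that C(2) L by auto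
  note pack = measure_Union_disjoint_packing[of C "\<lambda>i. ball i (\<rho> i)" U "\<lambda>i. cball (\<Phi> i) (5 * L * \<rho> i)" ?k]
  have "measure lebesgue S \<le> measure lebesgue (\<Union>i\<in>C. cball (\<Phi> i) (5 * L * \<rho> i))"
    by (rule measure_mono_fmeasurable[OF sub fmeasurableD[OF S(1)] pack(1)]) (use C \<rho>(2) Um k meas in auto)
  also have "\<dots> \<le> ?k * measure lebesgue U"
    by (rule pack(2)) (use C \<rho>(2) Um k meas in auto)
  also have "\<dots> \<le> ?k * (measure lebesgue T + \<epsilon> / ?k)" using Ule k by (intro mult_left_mono) auto
  also have "\<dots> = ?k * measure lebesgue T + \<epsilon>" using k L by (simp add: distrib_left)
  finally show "measure lebesgue S \<le> ?k * measure lebesgue T + \<epsilon>" .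
qed

text \<open>Testing with e_i + e_j and with e_i - e_j bounds 2 |M_ij| by M_ii + M_jj, and no
  diagonal entry exceeds the trace.\<close>

lemma psd_entry_le_trace:
  fixes M :: "real^'n^'n"
  assumes sym: "transpose M = M" and psd: "\<And>e. 0 \<le> (M *v e) \<bullet> e"
  shows "\<bar>M $ i $ j\<bar> \<le> trace M"
proof -
  have ent: "(M *v axis b 1) \<bullet> axis a 1 = M $ a $ b" for a b
    by (simp add: inner_axis matrix_vector_mul_component inner_axis')
  have symc: "M $ a $ b = M $ b $ a" for a b
    using sym by (simp add: transpose_def vec_eq_iff)
  have diag: "0 \<le> M $ a $ a" for a using psd[of "axis a 1"] by (simp add: ent)
  have le: "M $ a $ a \<le> trace M" for a
    unfolding trace_def using diag by (intro member_le_sum) auto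
  have "0 \<le> M $ i $ i + s * (2 * M $ i $ j) + M $ j $ j" if "s\<^sup>2 = 1" for s
  proof -
    have "0 \<le> (M *v (axis i 1 + s *\<^sub>R axis j 1)) \<bullet> (axis i 1 + s *\<^sub>R axis j 1)" by (rule psd)
    also have "\<dots> = M $ i $ i + s * (2 * M $ i $ j) + s\<^sup>2 * M $ j $ j"
      by (simp add: matrix_vector_right_distrib matrix_vector_mult_scaleR inner_add_left inner_add_right
          ent symc[of j i] algebra_simps power2_eq_square)
    finally show ?thesis using that by simp
  qed
  from this[of 1] this[of "-1"] have "2 * \<bar>M $ i $ j\<bar> \<le> M $ i $ i + M $ j $ j" by (simp add: abs_if)
  then show ?thesis using le[of i] le[of j] by linarith
qed

text \<open>An inequality for a Pucci extremal operator: some linear operator with eigenvalues in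
  [c, 1] has value at most \<kappa> at A. The frame is chosen separately for each matrix, so along a
  function the coefficients may be arbitrarily rough.\<close>

definition elliptic_bound :: "real \<Rightarrow> real \<Rightarrow> real^'n^'n \<Rightarrow> bool" where
  "elliptic_bound c \<kappa> A \<longleftrightarrow> (\<exists>e a. orthonormal_frame e \<and> (\<forall>i. c \<le> a i \<and> a i \<le> 1)
     \<and> (\<Sum>i\<in>UNIV. a i * ((A *v e i) \<bullet> e i)) \<le> \<kappa>)"

lemma elliptic_bound_add_mat:
  fixes A :: "real^'n^'n"
  assumes "elliptic_bound c \<kappa> A" "b \<ge> 0" "\<kappa> \<le> b"
  shows "elliptic_bound c ((real CARD('n) + 1) * b) (A + mat b)"
proof -
  obtain e a where e: "orthonormal_frame e" and a: "\<forall>i. c \<le> a i \<and> a i \<le> 1"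
    and s: "(\<Sum>i\<in>UNIV. a i * ((A *v e i) \<bullet> e i)) \<le> \<kappa>"
    using assms by (auto simp: elliptic_bound_def)
  have "(\<Sum>i\<in>UNIV. a i * (((A + mat b) *v e i) \<bullet> e i)) = (\<Sum>i\<in>UNIV. a i * ((A *v e i) \<bullet> e i)) + (\<Sum>i\<in>UNIV. a i * b)"
    using e by (simp add: matrix_vector_mult_add_rdistrib mat_mult_vec inner_add_left orthonormal_frame_def
        distrib_left sum.distrib)
  also have "(\<Sum>i\<in>UNIV. a i * b) \<le> (\<Sum>i\<in>(UNIV :: 'n set). 1 * b)"
    using a assms by (intro sum_mono mult_right_mono) auto
  finally have "(\<Sum>i\<in>UNIV. a i * (((A + mat b) *v e i) \<bullet> e i)) \<le> (real CARD('n) + 1) * b"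
    using s assms by (simp add: algebra_simps)
  then show ?thesis using e a unfolding elliptic_bound_def by blast
qed

section \<open>A barrier on annuli\<close>

lemma barrier_derivatives:
  fixes s \<beta> :: real
  defines "q \<equiv> \<lambda>t. s + 2 * t * \<beta> + t\<^sup>2"
  shows "q t \<noteq> 0 \<Longrightarrow> ((\<lambda>t. inverse (q t) ^ p) has_real_derivative
           - (real p * (2 * \<beta> + 2 * t) * inverse (q t) ^ Suc p)) (at t)"
    and "s \<noteq> 0 \<Longrightarrow> ((\<lambda>t. - (real p * (2 * \<beta> + 2 * t) * inverse (q t) ^ Suc p)) has_real_derivative
           real p * inverse s ^ Suc p * (4 * real (Suc p) * \<beta>\<^sup>2 / s - 2)) (at 0)"
proof -
  \<comment> \<open>With s = |x|^2 and \<beta> = x . e for a unit vector e, q t is |x + t e|^2; the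
    lemma thus differentiates the barrier along a line.\<close>
  have q: "(q has_real_derivative 2 * \<beta> + 2 * t) (at t)" for t
    unfolding q_def by (rule derivative_eq_intros refl | simp)+
  have pow: "((\<lambda>t. inverse (q t) ^ m) has_real_derivative - (real m * (2 * \<beta> + 2 * t) * inverse (q t) ^ Suc m)) (at t)"
    if "q t \<noteq> 0" for t m
  proof (cases m)
    case (Suc l)
    have "((\<lambda>t. inverse (q t) ^ m) has_real_derivative
      real m * ( - (inverse (q t) * (2 * \<beta> + 2 * t) * inverse (q t)) * inverse (q t) ^ (m - Suc 0))) (at t)"
      by (rule derivative_eq_intros q that refl | simp)+
    then show ?thesis by (simp add: Suc algebra_simps)
  qed simp
  show "((\<lambda>t. inverse (q t) ^ p) has_real_derivative
           - (real p * (2 * \<beta> + 2 * t) * inverse (q t) ^ Suc p)) (at t)" if "q t \<noteq> 0"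
    using pow[OF that] .
  assume s: "s \<noteq> 0"
  have q0: "q 0 = s" by (simp add: q_def)
  have "((\<lambda>t. - (real p * (2 * \<beta> + 2 * t) * inverse (q t) ^ Suc p)) has_real_derivative
     - (real p * 2 * inverse (q 0) ^ Suc p + real p * (2 * \<beta> + 2 * 0) * - (real (Suc p) * (2 * \<beta> + 2 * 0) * inverse (q 0) ^ Suc (Suc p)))) (at 0)"
    by (rule derivative_eq_intros pow refl | simp add: q0 s)+
  then show "((\<lambda>t. - (real p * (2 * \<beta> + 2 * t) * inverse (q t) ^ Suc p)) has_real_derivative
           real p * inverse s ^ Suc p * (4 * real (Suc p) * \<beta>\<^sup>2 / s - 2)) (at 0)"
    by (simp add: q0 algebra_simps power2_eq_square divide_inverse)
qed

text \<open>The power of 4 compensates for |z - xb|^2 <= 4 r^2 on the annulus; the factor n + 1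
  matches the right-hand side of the supersolution inequality.\<close>

definition barrier_const :: "nat \<Rightarrow> nat \<Rightarrow> real" where
  "barrier_const n p = (real n + 1) * 4 ^ Suc p"

lemma elliptic_sum_square_ge:
  fixes e :: "'n::finite \<Rightarrow> real^'n"
  assumes "orthonormal_frame e" "\<And>i. c \<le> a i"
  shows "c * (x \<bullet> x) \<le> (\<Sum>i\<in>UNIV. a i * (x \<bullet> e i)\<^sup>2)"
proof -
  have "c * (x \<bullet> x) = (\<Sum>i\<in>UNIV. c * (x \<bullet> e i)\<^sup>2)"
    unfolding orthonormal_frame_inner[OF assms(1), of x x, symmetric]
    by (simp add: sum_distrib_left power2_eq_square)
  also have "\<dots> \<le> (\<Sum>i\<in>UNIV. a i * (x \<bullet> e i)\<^sup>2)"
    by (intro sum_mono mult_right_mono assms) auto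
  finally show ?thesis .
qed

text \<open>Comparison with a multiple of \<open>\<bar>z - x\<bar>\<^sup>-\<^sup>2\<^sup>p\<close>, a strict subsolution on the annulus once
  \<open>p c \<ge> n\<close>, moves smallness of \<open>w\<close> from the outer part of a ball to its core.\<close>

lemma barrier_comparison:
  fixes w :: "real^'n \<Rightarrow> real"
  assumes w: "twice_diff_on (ball xb (2 * r)) w G H" "continuous_on (cball xb (2 * r)) w"
    and nonneg: "\<And>z. z \<in> cball xb (2 * r) \<Longrightarrow> 0 \<le> w z"
    and ell: "\<And>z. z \<in> ball xb (2 * r) \<Longrightarrow> elliptic_bound c ((real CARD('n) + 1) * b) (H z)"
    and c: "0 < c" and p: "real CARD('n) \<le> real p * c" and b: "0 < b" and r: "0 < r"
    and x1: "x1 \<in> cball xb r" "w x1 = 0"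
  shows "\<exists>x2\<in>cball xb (r / 2). w x2 \<le> barrier_const CARD('n) p * 4 ^ p * b * r\<^sup>2"
proof (rule ccontr)
  assume no: "\<not> ?thesis"
  let ?n = "real CARD('n)"
  let ?A = "barrier_const CARD('n) p * b * r\<^sup>2"
  define s where "s = (\<lambda>z. (z - xb) \<bullet> (z - xb))"
  \<comment> \<open>Subtracting 4^(-p) makes the barrier vanish at distance 2 r. It is positive at
    x1, and at distance r / 2 it is at most A 4^p, hence below w under the contrary assumption; so w
    - \<phi> has a negative interior minimum.\<close>
  define \<phi> where "\<phi> = (\<lambda>z. ?A * ((r\<^sup>2) ^ p * inverse (s z) ^ p - 1 / 4 ^ p))"
  define K where "K = cball xb (2 * r) - ball xb (r / 2)"
  define U where "U = ball xb (2 * r) - cball xb (r / 2)"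
  have A: "?A > 0" using b r by (simp add: barrier_const_def add_nonneg_pos)
  have p1: "p \<ge> 1"
    using p c by (cases p) auto
  have sdist: "s z = (dist xb z)\<^sup>2" for z
    by (simp add: s_def dist_square_inner[symmetric] dist_commute)
  have snz: "s z \<noteq> 0" if "z \<in> K" for z
    using that r by (auto simp: K_def sdist)
  have K: "compact K" unfolding K_def by (intro compact_diff) auto
  have x1_far: "r / 2 \<le> dist xb x1"
  proof (rule ccontr)
    assume "\<not> ?thesis"
    then have "x1 \<in> cball xb (r / 2)" by simp
    moreover have "0 \<le> ?A * 4 ^ p" using A by simp
    then have "w x1 \<le> barrier_const CARD('n) p * 4 ^ p * b * r\<^sup>2" using x1(2) by (simp add: mult_ac)
    ultimately show False using no by blast
  qed
  then have x1K: "x1 \<in> K" using x1 r by (auto simp: K_def)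
  have "continuous_on K s" unfolding s_def by (intro continuous_intros)
  moreover have "continuous_on K w" by (rule continuous_on_subset[OF w(2)]) (auto simp: K_def)
  ultimately have cont: "continuous_on K (\<lambda>z. w z - \<phi> z)"
    unfolding \<phi>_def using snz by (intro continuous_intros) auto
  obtain z0 where z0: "z0 \<in> K" and zmin: "\<And>z. z \<in> K \<Longrightarrow> w z0 - \<phi> z0 \<le> w z - \<phi> z"
    using continuous_attains_inf[OF K _ cont] x1K by blast
  have ratio: "(r\<^sup>2) ^ p * inverse (s z) ^ p = (r\<^sup>2 / s z) ^ p" for z
    by (simp add: power_mult_distrib[symmetric] divide_inverse)
  have "\<phi> x1 > 0"
  proof -
    have "s x1 \<le> r\<^sup>2" using x1(1) by (simp add: sdist power_mono)
    moreover have "s x1 > 0" using snz[OF x1K] by (simp add: sdist)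
    ultimately have "1 ^ p \<le> (r\<^sup>2 / s x1) ^ p" by (intro power_mono) auto
    moreover have "(1 :: real) / 4 ^ p < 1" using p1 by (simp add: divide_less_eq)
    ultimately have "0 < (r\<^sup>2 / s x1) ^ p - 1 / 4 ^ p" unfolding power_one by linarith
    then show ?thesis unfolding \<phi>_def ratio by (rule mult_pos_pos[OF A])
  qed
  then have neg: "w z0 - \<phi> z0 < 0" using zmin[OF x1K] x1(2) by simp
  have "z0 \<in> U"
  proof (rule ccontr)
    assume "z0 \<notin> U"
    then consider "dist xb z0 = 2 * r" | "dist xb z0 = r / 2"
      using z0 by (auto simp: U_def K_def)
    then show False
    proof cases
      case 1
      have "r\<^sup>2 / s z0 = 1 / 4" using r by (simp add: sdist 1 power_mult_distrib)
      then have "\<phi> z0 = 0" unfolding \<phi>_def ratio by (simp add: power_divide)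
      then show False using neg nonneg[of z0] 1 by simp
    next
      case 2
      have "r\<^sup>2 / s z0 = 4" using r by (simp add: sdist 2 power_divide)
      then have "\<phi> z0 \<le> ?A * 4 ^ p" unfolding \<phi>_def ratio using A by (simp add: algebra_simps)
      moreover have "w z0 > ?A * 4 ^ p" using no 2 by (force simp: algebra_simps)
      ultimately show False using neg by simp
    qed
  qed
  have "open U" by (simp add: U_def open_Diff)
  then obtain \<epsilon> where \<epsilon>: "\<epsilon> > 0" "ball z0 \<epsilon> \<subseteq> U" using \<open>z0 \<in> U\<close> by (meson openE)
  have UK: "U \<subseteq> K" and UB: "U \<subseteq> ball xb (2 * r)" by (auto simp: U_def K_def)
  define S where "S = s z0"
  have S: "S > 0" "S \<le> 4 * r\<^sup>2"
  proof -
    show "S > 0" using snz[OF z0] by (simp add: S_def sdist)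
    have "(dist xb z0)\<^sup>2 \<le> (2 * r)\<^sup>2" using z0 by (intro power_mono) (auto simp: K_def)
    then show "S \<le> 4 * r\<^sup>2" by (simp add: S_def sdist power_mult_distrib)
  qed
  \<comment> \<open>The common factor of the second derivatives of the barrier; it is at least (n +
    1) b because |z0 - xb| is at most 2 r.\<close>
  define B where "B = ?A * (r\<^sup>2) ^ p * (real p * inverse S ^ Suc p)"
  have second: "B * (4 * real (Suc p) * ((z0 - xb) \<bullet> e)\<^sup>2 / S - 2) \<le> (H z0 *v e) \<bullet> e" if e: "norm e = 1" for e
  proof -
    let ?\<beta> = "(z0 - xb) \<bullet> e"
    have line: "s (z0 + t *\<^sub>R e) = S + 2 * t * ?\<beta> + t\<^sup>2" for t
    proof -
      have eq: "z0 + t *\<^sub>R e - xb = (z0 - xb) + t *\<^sub>R e" by simp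
      have ee: "e \<bullet> e = 1" using e by (simp add: norm_eq_1)
      show ?thesis
        unfolding S_def s_def eq inner_add_left inner_add_right inner_scaleR_left inner_scaleR_right ee inner_commute[of e "z0 - xb"]
        by (simp add: power2_eq_square algebra_simps)
    qed
    have inU: "z0 + t *\<^sub>R e \<in> U" if "\<bar>t\<bar> < \<epsilon>" for t
      using that e \<epsilon> by (auto simp: dist_norm)
    let ?d1 = "\<lambda>t. - (real p * (2 * ?\<beta> + 2 * t) * inverse (S + 2 * t * ?\<beta> + t\<^sup>2) ^ Suc p)"
    let ?d2 = "real p * inverse S ^ Suc p * (4 * real (Suc p) * ?\<beta>\<^sup>2 / S - 2)"
    have d1: "((\<lambda>t. w (z0 + t *\<^sub>R e) - \<phi> (z0 + t *\<^sub>R e)) has_real_derivative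
        (G (z0 + t *\<^sub>R e) \<bullet> e - ?A * ((r\<^sup>2) ^ p * ?d1 t))) (at t)" if t: "\<bar>t\<bar> < \<epsilon>" for t
    proof -
      have nz: "S + 2 * t * ?\<beta> + t\<^sup>2 \<noteq> 0"
        using snz[of "z0 + t *\<^sub>R e"] inU[OF t] UK by (auto simp: line)
      have "((\<lambda>t. \<phi> (z0 + t *\<^sub>R e)) has_real_derivative ?A * ((r\<^sup>2) ^ p * ?d1 t - 0)) (at t)"
        unfolding \<phi>_def line by (intro DERIV_cmult DERIV_diff DERIV_const barrier_derivatives(1)[OF nz])
      then have "((\<lambda>t. \<phi> (z0 + t *\<^sub>R e)) has_real_derivative ?A * ((r\<^sup>2) ^ p * ?d1 t)) (at t)"
        by (simp only: diff_0_right)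
      then show ?thesis
        by (intro DERIV_diff twice_diff_on_line(1)[OF w(1)]) (use inU[OF t] UB in auto)
    qed
    have "((\<lambda>t. G (z0 + t *\<^sub>R e) \<bullet> e - ?A * ((r\<^sup>2) ^ p * ?d1 t)) has_real_derivative
        ((H z0 *v e) \<bullet> e - ?A * ((r\<^sup>2) ^ p * ?d2))) (at 0)"
    proof (intro DERIV_diff DERIV_cmult)
      show "((\<lambda>t. G (z0 + t *\<^sub>R e) \<bullet> e) has_real_derivative (H z0 *v e) \<bullet> e) (at 0)"
        using twice_diff_on_line(2)[OF w(1), of z0 0 e] \<open>z0 \<in> U\<close> UB by auto
      show "(?d1 has_real_derivative ?d2) (at 0)"
        using barrier_derivatives(2)[of S p ?\<beta>] S by simp
    qed
    from second_derivative_test(2)[OF \<epsilon>(1) d1 this] zmin inU UK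
    have "0 \<le> (H z0 *v e) \<bullet> e - ?A * ((r\<^sup>2) ^ p * ?d2)" by force
    then show ?thesis by (simp add: B_def mult.assoc)
  qed
  obtain e a where e: "orthonormal_frame e" and a: "\<And>i. c \<le> a i" "\<And>i. a i \<le> 1"
    and ub: "(\<Sum>i\<in>UNIV. a i * ((H z0 *v e i) \<bullet> e i)) \<le> (?n + 1) * b"
    using ell[of z0] \<open>z0 \<in> U\<close> UB unfolding elliptic_bound_def by blast
  have a0: "0 \<le> a i" for i using a(1)[of i] c by simp
  have B0: "B \<ge> (?n + 1) * b"
  proof -
    have "1 \<le> 4 * r\<^sup>2 / S" using S by simp
    then have "1 ^ Suc p \<le> (4 * r\<^sup>2 / S) ^ Suc p" by (intro power_mono) auto
    then have "(?n + 1) * b * real p * 1 \<le> (?n + 1) * b * real p * (4 * r\<^sup>2 / S) ^ Suc p"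
      using b by (intro mult_left_mono) auto
    also have "\<dots> = B"
      by (simp add: B_def barrier_const_def divide_inverse power_mult_distrib algebra_simps)
    finally have le: "(?n + 1) * b * real p \<le> B" by simp
    have "(?n + 1) * b * 1 \<le> (?n + 1) * b * real p"
      using p1 b by (intro mult_left_mono) auto
    from order_trans[OF this le] show ?thesis by simp
  qed
  \<comment> \<open>The radial part of the barrier contributes at least 4 (p + 1) c and the other
    part costs at most 2 n; with p c >= n the balance is at least 2.\<close>
  have "B * 2 \<le> B * (4 * real (Suc p) * c - 2 * ?n)"
  proof (rule mult_left_mono)
    have "1 \<le> ?n" by (simp add: Suc_leI)
    moreover have "4 * real (Suc p) * c = 4 * (real p * c) + 4 * c" by (simp add: algebra_simps)
    ultimately show "2 \<le> 4 * real (Suc p) * c - 2 * ?n" using p c by linarith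
    show "0 \<le> B" using B0 b order_trans[OF _ B0, of 0] by simp
  qed
  also have "\<dots> \<le> B * (\<Sum>i\<in>UNIV. a i * (4 * real (Suc p) * ((z0 - xb) \<bullet> e i)\<^sup>2 / S - 2))"
  proof (rule mult_left_mono)
    have "c * S \<le> (\<Sum>i\<in>UNIV. a i * ((z0 - xb) \<bullet> e i)\<^sup>2)"
      unfolding S_def s_def by (rule elliptic_sum_square_ge[OF e a(1)])
    then have "4 * real (Suc p) / S * (c * S) \<le> 4 * real (Suc p) / S * (\<Sum>i\<in>UNIV. a i * ((z0 - xb) \<bullet> e i)\<^sup>2)"
      using S by (intro mult_left_mono) auto
    moreover have "(\<Sum>i\<in>UNIV. a i * 2) \<le> (\<Sum>i\<in>(UNIV :: 'n set). 2)" using a by (intro sum_mono) auto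
    moreover have "(\<Sum>i\<in>UNIV. a i * (4 * real (Suc p) * ((z0 - xb) \<bullet> e i)\<^sup>2 / S - 2))
      = 4 * real (Suc p) / S * (\<Sum>i\<in>UNIV. a i * ((z0 - xb) \<bullet> e i)\<^sup>2) - (\<Sum>i\<in>UNIV. a i * 2)"
      unfolding sum_distrib_left sum_subtractf[symmetric] by (intro sum.cong refl) (simp add: field_simps)
    ultimately show "4 * real (Suc p) * c - 2 * ?n \<le> (\<Sum>i\<in>UNIV. a i * (4 * real (Suc p) * ((z0 - xb) \<bullet> e i)\<^sup>2 / S - 2))"
      using S by simp
    show "0 \<le> B" using B0 b order_trans[OF _ B0, of 0] by simp
  qed
  also have "\<dots> = (\<Sum>i\<in>UNIV. a i * (B * (4 * real (Suc p) * ((z0 - xb) \<bullet> e i)\<^sup>2 / S - 2)))"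
    by (simp add: sum_distrib_left mult.left_commute)
  also have "\<dots> \<le> (\<Sum>i\<in>UNIV. a i * ((H z0 *v e i) \<bullet> e i))"
    by (intro sum_mono mult_left_mono second a0 orthonormal_frame_norm[OF e])
  also note ub
  finally have "B * 2 \<le> (?n + 1) * b" .
  moreover have "(?n + 1) * b > 0" using b by (simp add: add_nonneg_pos)
  ultimately show False using B0 by simp
qed

section \<open>Sliding paraboloids\<close>

definition jacobian_const :: "nat \<Rightarrow> real \<Rightarrow> real" where
  "jacobian_const n c = (5 * (real n * real n * ((2 * real n + 1) / c) + 1)) ^ n"

text \<open>A contact point x determines its vertex as \<Phi> x = x + G x / b, and every vertex of
  the small ball has a contact point, so \<Phi> maps the contact set onto at least that ball. There
  the derivative I + H / b of \<Phi> is positive semidefinite and the supersolution inequality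
  bounds its trace, so \<Phi> expands by a bounded factor.\<close>

lemma measure_sliding_paraboloids:
  fixes w :: "real^'n \<Rightarrow> real"
  assumes w: "twice_diff_on (ball x0 R) w G H" "continuous_on (cball x0 R) w"
    and nonneg: "\<And>z. z \<in> cball x0 R \<Longrightarrow> 0 \<le> w z"
    and ell: "\<And>z. z \<in> ball x0 R \<Longrightarrow> elliptic_bound c ((real CARD('n) + 1) * b) (H z)"
    and c: "0 < c" and b: "0 < b" and r: "0 < r" and sub: "ball x2 (r / 2) \<subseteq> ball x0 R"
    and x2: "w x2 < 3 / 128 * b * r\<^sup>2"
  defines "T \<equiv> paraboloid_contact b (cball x0 R) (cball x2 (r / 8)) w"
  shows "T \<subseteq> ball x2 (r / 2)"
    and "measure lebesgue (cball x2 (r / 8)) \<le> jacobian_const CARD('n) c * measure lebesgue T"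
proof -
  let ?n = "real CARD('n)"
  have "x2 \<in> ball x2 (r / 2)" using r by simp
  then have "x2 \<in> ball x0 R" using sub by blast
  then have x2R: "x2 \<in> cball x0 R" by simp
  show Tsub: "T \<subseteq> ball x2 (r / 2)"
  proof
    fix x assume "x \<in> T"
    then obtain y where y: "dist x2 y \<le> r / 8" "x \<in> cball x0 R"
      "w x + b / 2 * (dist x y)\<^sup>2 \<le> w x2 + b / 2 * (dist x2 y)\<^sup>2"
      using x2R by (auto simp: T_def paraboloid_contact_def)
    have "(dist x2 y)\<^sup>2 \<le> (r / 8)\<^sup>2" using y(1) by (intro power_mono) auto
    then have "b / 2 * (dist x2 y)\<^sup>2 \<le> b / 2 * (r / 8)\<^sup>2" using b by (intro mult_left_mono) auto
    \<comment> \<open>Here 3/128 + (1/2)(1/8)^2 = (1/2)(1/4)^2: a contact point is within r / 4 of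
      its vertex and hence within r / 2 of x2.\<close>
    then have "b / 2 * (dist x y)\<^sup>2 < 3 / 128 * b * r\<^sup>2 + b / 2 * (r / 8)\<^sup>2"
      using y(3) x2 nonneg[OF y(2)] by linarith
    also have "\<dots> = b / 2 * (r / 4)\<^sup>2" by (simp add: power2_eq_square)
    finally have lt: "(dist x y)\<^sup>2 < (r / 4)\<^sup>2" using b by (simp add: mult_less_cancel_left_pos)
    have "dist x y < r / 4" by (rule power_less_imp_less_base[OF lt]) (use r in simp)
    then have "dist x2 x < r / 2" using y(1) r dist_triangle[of x2 x y] by (simp add: dist_commute)
    then show "x \<in> ball x2 (r / 2)" by simp
  qed
  have compT: "compact T" unfolding T_def by (intro compact_paraboloid_contact w) auto
  define \<Phi> where "\<Phi> = (\<lambda>x. x + (1 / b) *\<^sub>R G x)"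
  define M where "M = (\<lambda>x. mat 1 + (1 / b) *\<^sub>R H x)"
  have Mv: "M x *v h = h + (1 / b) *\<^sub>R (H x *v h)" for x h
    by (simp add: M_def matrix_vector_mult_add_rdistrib mat_mult_vec scaleR_matrix_vector_assoc)
  have first_second: "y = \<Phi> x \<and> (\<forall>e. 0 \<le> (M x *v e) \<bullet> e)"
    if x: "x \<in> ball x0 R"
      and min: "\<And>z. z \<in> cball x0 R \<Longrightarrow> w x + b / 2 * (dist x y)\<^sup>2 \<le> w z + b / 2 * (dist z y)\<^sup>2" for x y
  proof -
    note d = twice_diff_on_add_paraboloid[OF w(1), of b y 0]
    have m: "w x + b / 2 * (dist x y)\<^sup>2 + 0 \<le> w z + b / 2 * (dist z y)\<^sup>2 + 0" if "z \<in> ball x0 R" for z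
      using min[of z] that by simp
    have "G x + b *\<^sub>R (x - y) = 0"
      using twice_diff_on_interior_min(1)[OF d open_ball x] m by blast
    then have "(1 / b) *\<^sub>R (G x + b *\<^sub>R (x - y)) = 0" by simp
    then have "y = \<Phi> x" using b by (simp add: \<Phi>_def algebra_simps)
    moreover have "0 \<le> (M x *v e) \<bullet> e" for e
    proof -
      have "0 \<le> ((H x + mat b) *v e) \<bullet> e"
        using twice_diff_on_interior_min(2)[OF d open_ball x] m by blast
      then have "0 \<le> (1 / b) * (((H x + mat b) *v e) \<bullet> e)" using b by simp
      then show ?thesis using b
        by (simp add: Mv matrix_vector_mult_add_rdistrib mat_mult_vec inner_add_left field_simps)
    qed
    ultimately show ?thesis by blast
  qed
  have TB: "x \<in> ball x0 R" if "x \<in> T" for x using Tsub sub that by blast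
  have image: "cball x2 (r / 8) \<subseteq> \<Phi> ` T"
  proof
    fix y assume y: "y \<in> cball x2 (r / 8)"
    have cont: "continuous_on (cball x0 R) (\<lambda>z. w z + b / 2 * (dist z y)\<^sup>2)"
      by (intro continuous_intros w)
    have ne: "cball x0 R \<noteq> {}" using x2R by blast
    from continuous_attains_inf[OF compact_cball ne cont] obtain x where x: "x \<in> cball x0 R"
      and min: "\<And>z. z \<in> cball x0 R \<Longrightarrow> w x + b / 2 * (dist x y)\<^sup>2 \<le> w z + b / 2 * (dist z y)\<^sup>2"
      by blast
    have "x \<in> T" unfolding T_def paraboloid_contact_def using x y min by blast
    moreover have "y = \<Phi> x" using first_second[OF TB[OF \<open>x \<in> T\<close>] min] by blast
    ultimately show "y \<in> \<Phi> ` T" by blast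
  qed
  have deriv: "(\<Phi> has_derivative (\<lambda>h. M x *v h)) (at x)" if "x \<in> T" for x
  proof -
    have "(G has_derivative (\<lambda>h. H x *v h)) (at x)"
      using w(1) TB[OF that] by (simp add: twice_diff_on_def)
    then show ?thesis
      unfolding \<Phi>_def Mv by (intro has_derivative_add has_derivative_ident has_derivative_scaleR_right)
  qed
  \<comment> \<open>The trace of the derivative is at most (2 n + 1) / c, the factor n^2 passes from
    entries to the operator norm, and the last 1 absorbs the remainder of the derivative.
    \<open>jacobian_const\<close> adds the factor 5 of the covering argument.\<close>
  define L where "L = ?n * ?n * ((2 * ?n + 1) / c) + 1"
  have L: "L > 0" using c by (simp add: L_def add_nonneg_pos)
  have lip: "\<exists>\<delta>>0. \<forall>z. dist z x < \<delta> \<longrightarrow> dist (\<Phi> z) (\<Phi> x) \<le> L * dist z x" if x: "x \<in> T" for x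
  proof -
    have psd: "0 \<le> (M x *v e) \<bullet> e" for e
    proof -
      obtain y where "\<forall>z\<in>cball x0 R. w x + b / 2 * (dist x y)\<^sup>2 \<le> w z + b / 2 * (dist z y)\<^sup>2"
        using x by (auto simp: T_def paraboloid_contact_def)
      then show ?thesis using first_second[OF TB[OF x], of y] by blast
    qed
    obtain e a where e: "orthonormal_frame e" and a: "\<And>i. c \<le> a i" "\<And>i. a i \<le> 1"
      and ub: "(\<Sum>i\<in>UNIV. a i * ((H x *v e i) \<bullet> e i)) \<le> (?n + 1) * b"
      using ell[OF TB[OF x]] unfolding elliptic_bound_def by blast
    \<comment> \<open>Semidefiniteness of M lets the lower bound c replace each weight. The identity
      part of M contributes at most n, and the part from H at most n + 1.\<close>
    have "c * trace (M x) = (\<Sum>i\<in>UNIV. c * ((M x *v e i) \<bullet> e i))"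
      by (simp add: trace_orthonormal_frame[OF e, symmetric] sum_distrib_left)
    also have "\<dots> \<le> (\<Sum>i\<in>UNIV. a i * ((M x *v e i) \<bullet> e i))"
      by (intro sum_mono mult_right_mono a psd)
    also have "\<dots> = (\<Sum>i\<in>UNIV. a i) + 1 / b * (\<Sum>i\<in>UNIV. a i * ((H x *v e i) \<bullet> e i))"
      using e by (simp add: Mv inner_add_left distrib_left sum.distrib sum_distrib_left orthonormal_frame_def
          mult.left_commute)
    also have "\<dots> \<le> (\<Sum>i\<in>(UNIV :: 'n set). 1) + 1 / b * ((?n + 1) * b)"
      using a ub b by (intro add_mono sum_mono mult_left_mono) auto
    also have "\<dots> = 2 * ?n + 1" using b by simp
    finally have tr: "trace (M x) \<le> (2 * ?n + 1) / c" using c by (simp add: pos_le_divide_eq mult.commute)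
    have sym: "transpose (M x) = M x"
      using w(1) TB[OF x]
      by (simp add: M_def twice_diff_on_def transpose_add) (simp add: transpose_def vec_eq_iff)
    have on: "onorm (\<lambda>h. M x *v h) \<le> ?n * ?n * ((2 * ?n + 1) / c)"
      using psd_entry_le_trace[OF sym psd] tr by (intro onorm_le_matrix_component) (rule order_trans)
    have bl: "norm (M x *v h) \<le> ?n * ?n * ((2 * ?n + 1) / c) * norm h" for h
      using onorm[OF matrix_vector_mul_bounded_linear, of "M x" h] mult_right_mono[OF on norm_ge_zero[of h]]
      by linarith
    have "(\<Phi> has_derivative (\<lambda>h. M x *v h)) (at x)" by (rule deriv[OF x])
    then obtain \<delta> where \<delta>: "\<delta> > 0"
      "\<And>z. norm (z - x) < \<delta> \<Longrightarrow> norm (\<Phi> z - \<Phi> x - M x *v (z - x)) \<le> 1 * norm (z - x)"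
      unfolding has_derivative_at_alt by (metis zero_less_one)
    have "dist (\<Phi> z) (\<Phi> x) \<le> L * dist z x" if "dist z x < \<delta>" for z
    proof -
      have "norm (\<Phi> z - \<Phi> x) \<le> norm (\<Phi> z - \<Phi> x - M x *v (z - x)) + norm (M x *v (z - x))"
        using norm_triangle_ineq[of "\<Phi> z - \<Phi> x - M x *v (z - x)" "M x *v (z - x)"] by simp
      also have "\<dots> \<le> 1 * norm (z - x) + ?n * ?n * ((2 * ?n + 1) / c) * norm (z - x)"
        using \<delta>(2)[of z] that bl by (intro add_mono) (auto simp: dist_norm)
      finally show ?thesis by (simp add: L_def dist_norm algebra_simps)
    qed
    then show ?thesis using \<delta>(1) by blast
  qed
  have Tm: "T \<in> lmeasurable" using compT by (rule lmeasurable_compact)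
  show "measure lebesgue (cball x2 (r / 8)) \<le> jacobian_const CARD('n) c * measure lebesgue T"
    using measure_pointwise_Lipschitz_image[OF Tm _ image L lip]
    by (simp add: jacobian_const_def L_def)
qed

text \<open>Completing the square: two paraboloids add up to one whose opening is the sum and whose
  vertex is the weighted mean, up to a constant independent of z.\<close>

lemma paraboloid_sum:
  fixes z y y' :: "'a::real_inner"
  assumes "0 < b" "0 < b'"
  defines "m \<equiv> (b / (b + b')) *\<^sub>R y + (b' / (b + b')) *\<^sub>R y'"
  shows "b / 2 * (dist z y)\<^sup>2 + b' / 2 * (dist z y')\<^sup>2
       = (b + b') / 2 * (dist z m)\<^sup>2 + b * b' / (2 * (b + b')) * (dist y y')\<^sup>2"
proof -
  define t s where "t = b + b'" and "s = b / t"
  have t: "t > 0" using assms by (simp add: t_def)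
  have b: "b = s * t" "b' = (1 - s) * t"
    using t by (simp_all add: s_def left_diff_distrib) (simp add: t_def)
  have w: "b / t = s" "b' / t = 1 - s" using t by (simp_all add: b)
  define A B where "A = z - y" and "B = z - y'"
  have m: "z - m = s *\<^sub>R A + (1 - s) *\<^sub>R B"
    unfolding m_def t_def[symmetric] w by (simp add: A_def B_def algebra_simps)
  have AB: "y - y' = B - A" by (simp add: A_def B_def)
  have key: "s * (A \<bullet> A) + (1 - s) * (B \<bullet> B)
      = (s *\<^sub>R A + (1 - s) *\<^sub>R B) \<bullet> (s *\<^sub>R A + (1 - s) *\<^sub>R B) + s * (1 - s) * ((B - A) \<bullet> (B - A))"
    by (simp add: inner_add_left inner_add_right inner_diff_left inner_diff_right inner_commute[of B A] algebra_simps)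
  have "(s * t) / 2 * (A \<bullet> A) + ((1 - s) * t) / 2 * (B \<bullet> B) = t / 2 * (s * (A \<bullet> A) + (1 - s) * (B \<bullet> B))"
    by (simp add: distrib_left mult_ac)
  also have "\<dots> = t / 2 * ((s *\<^sub>R A + (1 - s) *\<^sub>R B) \<bullet> (s *\<^sub>R A + (1 - s) *\<^sub>R B))
      + t / 2 * (s * (1 - s) * ((B - A) \<bullet> (B - A)))"
    unfolding key by (rule distrib_left)
  also have "t / 2 * (s * (1 - s) * ((B - A) \<bullet> (B - A))) = (s * t) * ((1 - s) * t) / (2 * t) * ((B - A) \<bullet> (B - A))"
    using t by simp
  finally show ?thesis
    unfolding dist_square_inner m AB b[symmetric] A_def[symmetric] B_def[symmetric] t_def[symmetric] .
qed

section \<open>Growth of the contact sets with the opening\<close>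

locale nonneg_supersolution =
  fixes v :: "real^'n \<Rightarrow> real" and G :: "real^'n \<Rightarrow> real^'n" and H :: "real^'n \<Rightarrow> real^'n^'n"
    and x0 :: "real^'n" and \<rho> c \<kappa> :: real and p :: nat
  assumes c: "0 < c" and kappa: "0 < \<kappa>" and rho: "0 < \<rho>" and p: "real CARD('n) \<le> real p * c"
    and diff: "twice_diff_on (ball x0 (4 * \<rho>)) v G H" and cont: "continuous_on (cball x0 (4 * \<rho>)) v"
    and nonneg: "\<And>z. z \<in> cball x0 (4 * \<rho>) \<Longrightarrow> 0 \<le> v z" and zero: "v x0 = 0"
    and ell: "\<And>z. z \<in> ball x0 (4 * \<rho>) \<Longrightarrow> elliptic_bound c \<kappa> (H z)"
begin

text \<open>Vertices range over the full ball, a convex set containing all contact points, so that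
  weighted means of vertices and contact points are again allowed as vertices.\<close>

definition E :: "real \<Rightarrow> (real^'n) set" where
  "E b = cball x0 (2 * \<rho>) \<inter> paraboloid_contact b (cball x0 (4 * \<rho>)) (cball x0 (4 * \<rho>)) v"

lemma center_in_E: "0 \<le> b \<Longrightarrow> x0 \<in> E b"
  using rho nonneg zero by (auto simp: E_def paraboloid_contact_def intro!: bexI[of _ x0] add_nonneg_nonneg)

lemma compact_E: "compact (E b)"
  unfolding E_def by (intro compact_Int compact_paraboloid_contact cont compact_cball)

text \<open>Adding a paraboloid of opening b' - b whose vertex is the contact point x itself
  preserves the contact at x; by \<open>paraboloid_sum\<close> the result has opening b'.\<close>

lemma E_mono:
  assumes "0 < b" "b \<le> b'"
  shows "E b \<subseteq> E b'"
proof (cases "b = b'")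
  case False
  then have b': "0 < b' - b" using assms by simp
  show ?thesis
  proof
    fix x assume "x \<in> E b"
    then obtain y where x: "x \<in> cball x0 (2 * \<rho>)" "x \<in> cball x0 (4 * \<rho>)" and y: "y \<in> cball x0 (4 * \<rho>)"
      and le: "\<And>z. z \<in> cball x0 (4 * \<rho>) \<Longrightarrow> v x + b / 2 * (dist x y)\<^sup>2 \<le> v z + b / 2 * (dist z y)\<^sup>2"
      by (auto simp: E_def paraboloid_contact_def)
    define m where "m = (b / b') *\<^sub>R y + ((b' - b) / b') *\<^sub>R x"
    have sum: "b / 2 * (dist z y)\<^sup>2 + (b' - b) / 2 * (dist z x)\<^sup>2
        = b' / 2 * (dist z m)\<^sup>2 + b * (b' - b) / (2 * b') * (dist y x)\<^sup>2" for z
      using paraboloid_sum[OF \<open>0 < b\<close> b', of z y x] by (simp add: m_def)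
    have "m \<in> cball x0 (4 * \<rho>)"
      unfolding m_def by (rule convexD[OF convex_cball y x(2)]) (use assms b' in \<open>auto simp: field_simps\<close>)
    moreover have "v x + b' / 2 * (dist x m)\<^sup>2 \<le> v z + b' / 2 * (dist z m)\<^sup>2" if "z \<in> cball x0 (4 * \<rho>)" for z
    proof -
      have "0 \<le> (b' - b) / 2 * (dist z x)\<^sup>2" using b' by simp
      moreover have "(b' - b) / 2 * (dist x x)\<^sup>2 = 0" by simp
      ultimately show ?thesis using le[OF that] sum[of z] sum[of x] by linarith
    qed
    ultimately show "x \<in> E b'" unfolding E_def paraboloid_contact_def using x by blast
  qed
qed simp

text \<open>Comparison with x0, where v vanishes; 8 is half the square of the radius factor
  4.\<close>

lemma E_bound:
  assumes "0 \<le> b" "x \<in> E b"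
  shows "v x \<le> 8 * b * \<rho>\<^sup>2"
proof -
  obtain y where y: "dist x0 y \<le> 4 * \<rho>"
    and le: "v x + b / 2 * (dist x y)\<^sup>2 \<le> v x0 + b / 2 * (dist x0 y)\<^sup>2"
    using assms rho by (auto simp: E_def paraboloid_contact_def)
  have "(dist x0 y)\<^sup>2 \<le> (4 * \<rho>)\<^sup>2" using y by (intro power_mono) auto
  then have "b / 2 * (dist x0 y)\<^sup>2 \<le> b / 2 * (4 * \<rho>)\<^sup>2" using assms by (intro mult_left_mono) auto
  moreover have "0 \<le> b / 2 * (dist x y)\<^sup>2" using assms by simp
  ultimately have "v x \<le> b / 2 * (4 * \<rho>)\<^sup>2" using le zero by simp
  also have "\<dots> = 8 * b * \<rho>\<^sup>2" by (simp add: power_mult_distrib)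
  finally show ?thesis .
qed

text \<open>The new opening is b + b2. At x2 the barrier leaves a value of at most B b r^2, with B
  the constant in parentheses; b2 = 64 B b raises the threshold 3/128 of the sliding argument to 3/2
  of that value.\<close>

definition open_factor :: real where
  "open_factor = 1 + 64 * (barrier_const CARD('n) p * 4 ^ p)"

text \<open>The power of 8 compares the ball of vertices, of radius r / 8, with the ball of radius
  r.\<close>

definition density_const :: real where
  "density_const = 8 ^ CARD('n) * jacobian_const CARD('n) c"

lemma barrier_const_pos: "barrier_const n p > 0"
  by (simp add: barrier_const_def add_nonneg_pos)

lemma open_factor_ge: "1 \<le> open_factor"
  using barrier_const_pos[of "CARD('n)"] by (simp add: open_factor_def)

lemma density_const_pos: "0 < density_const"
  using c unfolding density_const_def jacobian_const_def
  by (intro mult_pos_pos zero_less_power) (auto intro!: add_nonneg_pos)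

text \<open>Savin's propagation step. Subtracting the paraboloid that touches v at x1 gives a
  nonnegative supersolution w with zero x1; the barrier finds a point near the center where w is
  small, and paraboloids slid under w there touch on a set of substantial measure. Contact under w
  is contact under v with a larger opening.\<close>

lemma E_propagates:
  assumes b: "\<kappa> \<le> b" and xb: "xb \<in> ball x0 \<rho>" and r: "0 < r" "r \<le> \<rho>"
    and x1: "x1 \<in> E b" "x1 \<in> cball xb r"
  shows "measure lebesgue (ball xb r) \<le> density_const * measure lebesgue (E (open_factor * b) \<inter> ball xb r)"
proof -
  let ?K = "cball x0 (4 * \<rho>)" and ?n = "CARD('n)"
  let ?B = "barrier_const ?n p * 4 ^ p"
  have bpos: "0 < b" using b kappa by simp
  have B: "?B > 0" using barrier_const_pos by simp
  obtain y1 where y1: "y1 \<in> ?K"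
    and touch: "\<And>z. z \<in> ?K \<Longrightarrow> v x1 + b / 2 * (dist x1 y1)\<^sup>2 \<le> v z + b / 2 * (dist z y1)\<^sup>2"
    using x1 by (auto simp: E_def paraboloid_contact_def)
  define q where "q = - (v x1 + b / 2 * (dist x1 y1)\<^sup>2)"
  define w where "w = (\<lambda>z. v z + b / 2 * (dist z y1)\<^sup>2 + q)"
  have w: "twice_diff_on (ball x0 (4 * \<rho>)) w (\<lambda>z. G z + b *\<^sub>R (z - y1)) (\<lambda>z. H z + mat b)"
    unfolding w_def by (rule twice_diff_on_add_paraboloid[OF diff])
  have wc: "continuous_on ?K w" unfolding w_def by (intro continuous_intros cont)
  have w0: "0 \<le> w z" if "z \<in> ?K" for z using touch[OF that] by (simp add: w_def q_def)
  have we: "elliptic_bound c ((real ?n + 1) * b) (H z + mat b)" if "z \<in> ball x0 (4 * \<rho>)" for z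
    using elliptic_bound_add_mat[OF ell[OF that]] b bpos by simp
  have sub2: "cball xb (2 * r) \<subseteq> ball x0 (4 * \<rho>)"
  proof
    fix z assume "z \<in> cball xb (2 * r)"
    then show "z \<in> ball x0 (4 * \<rho>)"
      using xb r dist_triangle[of x0 z xb] by simp
  qed
  then have sub2': "ball xb (2 * r) \<subseteq> ball x0 (4 * \<rho>)" "cball xb (2 * r) \<subseteq> ?K" by auto
  have "\<exists>x2\<in>cball xb (r / 2). w x2 \<le> barrier_const ?n p * 4 ^ p * b * r\<^sup>2"
  proof (rule barrier_comparison[OF twice_diff_on_subset[OF w sub2'(1)] continuous_on_subset[OF wc sub2'(2)] _ _ c p bpos r(1) x1(2)])
    show "w x1 = 0" by (simp add: w_def q_def)
  qed (use w0 we sub2' in auto)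
  then obtain x2 where x2: "x2 \<in> cball xb (r / 2)" "w x2 \<le> ?B * b * r\<^sup>2" by blast
  define b2 where "b2 = 64 * ?B * b"
  have b2: "0 < b2" "b \<le> b2"
  proof -
    show "0 < b2" using B bpos by (simp add: b2_def)
    have "1 \<le> ?B"
    proof -
      have "(1 :: real) * 1 \<le> barrier_const ?n p"
        unfolding barrier_const_def by (intro mult_mono one_le_power) auto
      then show ?thesis using mult_mono[of 1 "barrier_const ?n p" 1 "4 ^ p"] by simp
    qed
    then have "1 * b \<le> 64 * ?B * b" using bpos by (intro mult_right_mono) auto
    then show "b \<le> b2" by (simp add: b2_def)
  qed
  have r2: "ball x2 (r / 2) \<subseteq> ball xb r"
  proof
    fix z assume "z \<in> ball x2 (r / 2)"
    then show "z \<in> ball xb r" using x2(1) dist_triangle[of xb z x2] by simp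
  qed
  have r3: "ball xb r \<subseteq> ball x0 (2 * \<rho>)"
  proof
    fix z assume "z \<in> ball xb r"
    then show "z \<in> ball x0 (2 * \<rho>)" using xb r dist_triangle[of x0 z xb] by simp
  qed
  have we2: "elliptic_bound c ((real ?n + 1) * b2) (H z + mat b)" if "z \<in> ball x0 (4 * \<rho>)" for z
  proof -
    have "(real ?n + 1) * b \<le> (real ?n + 1) * b2" using b2 by (intro mult_left_mono) auto
    then show ?thesis using we[OF that] unfolding elliptic_bound_def by (meson order_trans)
  qed
  have small: "w x2 < 3 / 128 * b2 * r\<^sup>2"
  proof -
    have "0 < ?B * b * r\<^sup>2" using r by (intro mult_pos_pos[OF mult_pos_pos[OF B bpos]]) simp
    moreover have "3 / 128 * b2 * r\<^sup>2 = 3 / 2 * (?B * b * r\<^sup>2)" by (simp add: b2_def)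
    ultimately show ?thesis using x2(2) by linarith
  qed
  have r4: "ball x2 (r / 2) \<subseteq> ball x0 (4 * \<rho>)"
    using r2 r3 rho by (auto simp: subset_iff)
  define T where "T = paraboloid_contact b2 ?K (cball x2 (r / 8)) w"
  note slide = measure_sliding_paraboloids[OF w wc w0 we2 c b2(1) r(1) r4 small, folded T_def]
  have "T \<subseteq> E (open_factor * b)"
  proof
    fix x assume x: "x \<in> T"
    then obtain y where xK: "x \<in> ?K" and y: "y \<in> cball x2 (r / 8)"
      and le: "\<And>z. z \<in> ?K \<Longrightarrow> w x + b2 / 2 * (dist x y)\<^sup>2 \<le> w z + b2 / 2 * (dist z y)\<^sup>2"
      by (auto simp: T_def paraboloid_contact_def)
    \<comment> \<open>The vertex of the sum of the paraboloid touching v and the one touching w; it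
      stays in the ball by convexity.\<close>
    define m where "m = (b / (b + b2)) *\<^sub>R y1 + (b2 / (b + b2)) *\<^sub>R y"
    have "y \<in> ?K"
    proof -
      have "y \<in> ball x2 (r / 2)" using y r by simp
      then have "y \<in> ball x0 (4 * \<rho>)" using r4 by blast
      then show ?thesis by simp
    qed
    then have "m \<in> ?K"
      unfolding m_def using y1 bpos b2
      by (intro convexD[OF convex_cball]) (auto simp flip: add_divide_distrib)
    moreover have eq: "open_factor * b = b + b2" by (simp add: open_factor_def b2_def algebra_simps)
    have "v x + open_factor * b / 2 * (dist x m)\<^sup>2 \<le> v z + open_factor * b / 2 * (dist z m)\<^sup>2" if "z \<in> ?K" for z
      unfolding eq using le[OF that] paraboloid_sum[OF bpos b2(1), of z y1 y] paraboloid_sum[OF bpos b2(1), of x y1 y]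
      by (simp add: w_def m_def)
    moreover have "x \<in> ball x0 (2 * \<rho>)" using x slide(1) r2 r3 by blast
    moreover have "x \<in> cball x0 (2 * \<rho>)" using \<open>x \<in> ball x0 (2 * \<rho>)\<close> by simp
    ultimately show "x \<in> E (open_factor * b)"
      unfolding E_def paraboloid_contact_def using xK by blast
  qed
  then have sub: "T \<subseteq> E (open_factor * b) \<inter> ball xb r" using slide(1) r2 by blast
  have Tm: "T \<in> lmeasurable"
    unfolding T_def by (intro lmeasurable_compact compact_paraboloid_contact wc compact_cball)
  have "(1 / 8) ^ ?n * measure lebesgue (ball xb r) = measure lebesgue (cball x2 (r / 8))"
    using measure_ball_scale(2)[of r "1 / 8" x2 xb] r by simp
  also have "\<dots> \<le> jacobian_const ?n c * measure lebesgue T" by (rule slide(2))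
  also have "\<dots> \<le> jacobian_const ?n c * measure lebesgue (E (open_factor * b) \<inter> ball xb r)"
  proof (rule mult_left_mono)
    show "measure lebesgue T \<le> measure lebesgue (E (open_factor * b) \<inter> ball xb r)"
      using sub Tm lmeasurable_compact[OF compact_E]
      by (intro measure_mono_fmeasurable fmeasurable_Int_fmeasurable) (auto dest: fmeasurableD)
    show "0 \<le> jacobian_const ?n c" using c by (simp add: jacobian_const_def)
  qed
  finally have "8 ^ ?n * ((1 / 8) ^ ?n * measure lebesgue (ball xb r))
      \<le> 8 ^ ?n * (jacobian_const ?n c * measure lebesgue (E (open_factor * b) \<inter> ball xb r))"
    by (rule mult_left_mono) simp
  then show ?thesis by (simp add: density_const_def power_divide)
qed

text \<open>The part not yet reached is covered by balls whose radius is the distance to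
  \<open>E b\<close>. Such an open ball misses \<open>E b\<close> while its closure meets it, so
  \<open>E_propagates\<close> makes a fixed fraction of it newly covered; Vitali's lemma selects a
  disjoint family.\<close>

lemma E_grows:
  assumes b: "\<kappa> \<le> b"
  shows "measure lebesgue (ball x0 \<rho> - E b)
    \<le> 5 ^ CARD('n) * density_const * (measure lebesgue (E (open_factor * b)) - measure lebesgue (E b))"
proof -
  let ?U = "ball x0 \<rho> - E b" and ?E' = "E (open_factor * b)"
  have bpos: "0 < b" using b kappa by simp
  have mono: "E b \<subseteq> ?E'"
    using mult_right_mono[OF open_factor_ge, of b] bpos by (intro E_mono) auto
  have ne: "E b \<noteq> {}" using center_in_E[of b] bpos by auto
  define r where "r = (\<lambda>x. infdist x (E b))"
  have r: "0 < r x \<and> r x \<le> \<rho>" if x: "x \<in> ?U" for x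
  proof -
    have "0 < r x"
      using in_closed_iff_infdist_zero[OF compact_imp_closed[OF compact_E] ne] x infdist_nonneg[of x "E b"]
      by (auto simp: r_def less_le)
    moreover have "r x \<le> dist x x0" unfolding r_def using center_in_E bpos by (intro infdist_le) auto
    ultimately show ?thesis using x by (simp add: dist_commute)
  qed
  have cov: "?U \<subseteq> (\<Union>x\<in>?U. ball x (r x))" using r by force
  obtain C where C: "countable C" "C \<subseteq> ?U" "pairwise (\<lambda>i j. disjnt (ball i (r i)) (ball j (r j))) C"
    "?U \<subseteq> (\<Union>i\<in>C. ball i (5 * r i))"
    by (rule Vitali_covering_lemma_balls[where S = ?U and K = ?U and a = "\<lambda>x. x" and r = r and B = \<rho>, OF cov r])
      (assumption, rule that, assumption+)
  have Em: "E b' \<in> lmeasurable" for b' by (rule lmeasurable_compact[OF compact_E])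
  have Wm: "?E' - E b \<in> lmeasurable" using Em by (intro fmeasurable.Diff)
  have disjE: "ball x (r x) \<inter> E b = {}" for x
  proof -
    have "r x \<le> dist x y" if "y \<in> E b" for y unfolding r_def using that by (rule infdist_le)
    then show ?thesis by (force simp: dist_commute)
  qed
  let ?P = "\<lambda>i. ?E' \<inter> ball i (r i)"
  have P: "?P i \<in> lmeasurable \<and> ?P i \<subseteq> ?E' - E b" for i
    using disjE[of i] Em by (auto intro!: fmeasurable_Int_fmeasurable)
  have dens: "measure lebesgue (ball i (5 * r i)) \<le> 5 ^ CARD('n) * density_const * measure lebesgue (?P i)"
    if i: "i \<in> C" for i
  proof -
    have iU: "i \<in> ?U" using i C by blast
    obtain x1 where x1: "x1 \<in> E b" "infdist i (E b) = dist i x1"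
      using infdist_attains_inf[OF compact_imp_closed[OF compact_E] ne] by blast
    have "measure lebesgue (ball i (r i)) \<le> density_const * measure lebesgue (?P i)"
      using iU r[OF iU] x1 by (intro E_propagates[OF b, of _ _ x1]) (auto simp: r_def)
    then have "5 ^ CARD('n) * measure lebesgue (ball i (r i)) \<le> 5 ^ CARD('n) * (density_const * measure lebesgue (?P i))"
      by (rule mult_left_mono) simp
    then show ?thesis
      using measure_ball_scale(1)[of "r i" 5 i i] r[OF iU] by (simp add: mult.assoc)
  qed
  have "pairwise (\<lambda>i j. disjnt (?P i) (?P j)) C"
    using C(3) by (auto simp: pairwise_def disjnt_def)
  note pack = measure_Union_disjoint_packing[OF C(1) this P Wm _ _ dens]
  have "measure lebesgue ?U \<le> measure lebesgue (\<Union>i\<in>C. ball i (5 * r i))"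
    using density_const_pos Em
    by (intro measure_mono_fmeasurable[OF C(4) _ pack(1)]) (auto dest: fmeasurableD)
  also have "\<dots> \<le> 5 ^ CARD('n) * density_const * measure lebesgue (?E' - E b)"
    using density_const_pos by (intro pack(2)) auto
  also have "measure lebesgue (?E' - E b) = measure lebesgue ?E' - measure lebesgue (E b)"
    using mono Em by (intro measurable_measure_Diff) (auto dest: fmeasurableD)
  finally show ?thesis .
qed

text \<open>The sets gained in J generations have total measure at most that of a ball of radius 2
  \<rho>, and each gain is at least a fixed multiple of what is left at the end. Decay like 1 / J is
  enough, and telescoping makes it irrelevant where in the larger ball the gains lie.\<close>

lemma measure_outside_E:
  "real J * measure lebesgue (ball x0 \<rho> - E (open_factor ^ J * \<kappa>))
    \<le> 5 ^ CARD('n) * density_const * (2 ^ CARD('n) * measure lebesgue (ball x0 \<rho>))"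
proof -
  let ?b = "\<lambda>j. open_factor ^ j * \<kappa>" and ?m = "measure lebesgue" and ?k = "5 ^ CARD('n) * density_const"
  have kap: "\<kappa> \<le> ?b j" for j
    using mult_right_mono[OF one_le_power[OF open_factor_ge, of j], of \<kappa>] kappa by simp
  have Em: "E b' \<in> lmeasurable" for b' by (rule lmeasurable_compact[OF compact_E])
  have k: "0 \<le> ?k" using density_const_pos by simp
  have "real J * ?m (ball x0 \<rho> - E (?b J)) = (\<Sum>j<J. ?m (ball x0 \<rho> - E (?b J)))" by simp
  also have "\<dots> \<le> (\<Sum>j<J. ?m (ball x0 \<rho> - E (?b j)))"
  proof (rule sum_mono)
    fix j assume "j \<in> {..<J}"
    then have "?b j \<le> ?b J"
      using open_factor_ge kappa by (intro mult_right_mono power_increasing) auto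
    then have "E (?b j) \<subseteq> E (?b J)" using kap[of j] kappa by (intro E_mono) auto
    then show "?m (ball x0 \<rho> - E (?b J)) \<le> ?m (ball x0 \<rho> - E (?b j))"
      using Em by (intro measure_mono_fmeasurable fmeasurable.Diff) (auto dest: fmeasurableD)
  qed
  also have "\<dots> \<le> (\<Sum>j<J. ?k * (?m (E (?b (Suc j))) - ?m (E (?b j))))"
    using E_grows[OF kap] by (intro sum_mono) (simp add: mult.assoc)
  also have "\<dots> = ?k * (?m (E (?b J)) - ?m (E (?b 0)))"
    using sum_lessThan_telescope[of "\<lambda>j. ?m (E (?b j))" J] by (simp only: sum_distrib_left[symmetric])
  also have "\<dots> \<le> ?k * (2 ^ CARD('n) * ?m (ball x0 \<rho>))"
  proof (rule mult_left_mono[OF _ k])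
    have "?m (E (?b J)) \<le> ?m (cball x0 (2 * \<rho>))"
      using Em by (intro measure_mono_fmeasurable) (auto simp: E_def dest: fmeasurableD)
    also have "\<dots> = 2 ^ CARD('n) * ?m (ball x0 \<rho>)"
      using measure_ball_scale(2)[of \<rho> 2 x0 x0] rho by simp
    finally show "?m (E (?b J)) - ?m (E (?b 0)) \<le> 2 ^ CARD('n) * ?m (ball x0 \<rho>)"
      using measure_nonneg[of lebesgue "E (?b 0)"] by linarith
  qed
  finally show ?thesis .
qed

end

text \<open>The measure estimate behind the weak Harnack inequality, after Savin: points at which \<open>v\<close> is
  touched from below by a paraboloid of opening \<open>b\<close> fill up the ball as \<open>b\<close> grows.\<close>

theorem nonneg_supersolution_measure:
  fixes c \<delta> :: real
  assumes "0 < c" "0 < \<delta>"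
  shows "\<exists>C>0. \<forall>(v :: real^'n \<Rightarrow> real) G H x0 \<rho> \<kappa>.
     0 < \<kappa> \<longrightarrow> 0 < \<rho> \<longrightarrow> twice_diff_on (ball x0 (4 * \<rho>)) v G H \<longrightarrow> continuous_on (cball x0 (4 * \<rho>)) v \<longrightarrow>
     (\<forall>z\<in>cball x0 (4 * \<rho>). 0 \<le> v z) \<longrightarrow> v x0 = 0 \<longrightarrow>
     (\<forall>z\<in>ball x0 (4 * \<rho>). elliptic_bound c \<kappa> (H z)) \<longrightarrow>
     (\<exists>B\<in>lmeasurable. {x \<in> ball x0 \<rho>. C * \<kappa> * \<rho>\<^sup>2 < v x} \<subseteq> B
        \<and> measure lebesgue B \<le> \<delta> * measure lebesgue (ball x0 \<rho>))"
proof -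
  let ?n = "CARD('n)"
  obtain p :: nat where p: "real ?n \<le> real p * c"
    using reals_Archimedean3[OF assms(1)] less_imp_le by blast
  define \<Lambda> :: real where "\<Lambda> = 1 + 64 * (barrier_const ?n p * 4 ^ p)"
  define M :: real where "M = 5 ^ ?n * (8 ^ ?n * jacobian_const ?n c) * 2 ^ ?n"
  obtain J :: nat where J: "M < real J * \<delta>" using reals_Archimedean3[OF assms(2)] by blast
  have \<Lambda>: "\<Lambda> > 0" by (simp add: \<Lambda>_def barrier_const_def add_pos_nonneg)
  show ?thesis
  proof (intro exI[of _ "8 * \<Lambda> ^ J"] conjI allI impI)
    show "0 < 8 * \<Lambda> ^ J" using \<Lambda> by simp
    fix v :: "real^'n \<Rightarrow> real" and G H x0 \<rho> \<kappa>
    assume h: "0 < \<kappa>" "0 < \<rho>" "twice_diff_on (ball x0 (4 * \<rho>)) v G H" "continuous_on (cball x0 (4 * \<rho>)) v"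
      "\<forall>z\<in>cball x0 (4 * \<rho>). 0 \<le> v z" "v x0 = 0" "\<forall>z\<in>ball x0 (4 * \<rho>). elliptic_bound c \<kappa> (H z)"
    interpret nonneg_supersolution v G H x0 \<rho> c \<kappa> p
      by unfold_locales (use assms p h in auto)
    have L: "open_factor = \<Lambda>" by (simp add: open_factor_def \<Lambda>_def)
    let ?B = "ball x0 \<rho> - E (\<Lambda> ^ J * \<kappa>)"
    have Bm: "?B \<in> lmeasurable" using lmeasurable_compact[OF compact_E] by (intro fmeasurable.Diff) auto
    have sub: "{x \<in> ball x0 \<rho>. 8 * \<Lambda> ^ J * \<kappa> * \<rho>\<^sup>2 < v x} \<subseteq> ?B"
      using E_bound[of "\<Lambda> ^ J * \<kappa>"] \<Lambda> h(1) by (fastforce simp: mult.assoc not_le[symmetric])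
    have "0 < 5 ^ ?n * density_const * (2 ^ ?n)" using density_const_pos by simp
    then have Mpos: "M > 0" by (simp add: M_def density_const_def)
    then have J0: "real J > 0" using J assms(2) by (cases J) auto
    have "real J * measure lebesgue ?B \<le> M * measure lebesgue (ball x0 \<rho>)"
      using measure_outside_E[of J] by (simp add: L M_def density_const_def mult.assoc)
    also have "\<dots> \<le> real J * \<delta> * measure lebesgue (ball x0 \<rho>)"
      using J by (intro mult_right_mono) auto
    finally have "measure lebesgue ?B \<le> \<delta> * measure lebesgue (ball x0 \<rho>)"
      using J0 by (simp add: mult.assoc)
    then show "\<exists>B\<in>lmeasurable. {x \<in> ball x0 \<rho>. 8 * \<Lambda> ^ J * \<kappa> * \<rho>\<^sup>2 < v x} \<subseteq> B
        \<and> measure lebesgue B \<le> \<delta> * measure lebesgue (ball x0 \<rho>)"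
      using Bm sub by blast
  qed
qed

section \<open>Second differences\<close>

definition second_diff :: "('a::real_normed_vector \<Rightarrow> real) \<Rightarrow> 'a \<Rightarrow> real \<Rightarrow> 'a \<Rightarrow> real" where
  "second_diff u e h x = (u (x + h *\<^sub>R e) + u (x - h *\<^sub>R e) - 2 * u x) / h\<^sup>2"

text \<open>The function u(x + t e) + u(x - t e) - K t^2 has nonpositive derivative for 0 < t <
  h.\<close>

lemma second_diff_le:
  fixes u :: "'a::real_normed_vector \<Rightarrow> real"
  assumes h: "0 < h" and g: "\<And>t. \<bar>t\<bar> \<le> h \<Longrightarrow> ((\<lambda>t. u (x + t *\<^sub>R e)) has_real_derivative g t) (at t)"
    and le: "\<And>t. 0 < t \<Longrightarrow> t < h \<Longrightarrow> g t - g (- t) \<le> 2 * K * t"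
  shows "second_diff u e h x \<le> K"
proof -
  define \<psi> where "\<psi> = (\<lambda>t. u (x + t *\<^sub>R e) + u (x + (- t) *\<^sub>R e) - K * t\<^sup>2)"
  have d: "(\<psi> has_real_derivative (g t - g (- t) - 2 * K * t)) (at t)" if t: "\<bar>t\<bar> \<le> h" for t
  proof -
    have "(uminus has_real_derivative - 1) (at t)" by (auto intro!: derivative_eq_intros)
    from DERIV_chain2[where f = "\<lambda>t. u (x + t *\<^sub>R e)" and x = t, OF g[of "- t"] this]
    have "((\<lambda>t. u (x + (- t) *\<^sub>R e)) has_real_derivative g (- t) * (- 1)) (at t)" using t by simp
    then show ?thesis unfolding \<psi>_def
      by (auto intro!: derivative_eq_intros g[OF t])
  qed
  obtain \<xi> where "0 < \<xi>" "\<xi> < h" "\<psi> h - \<psi> 0 = (h - 0) * (g \<xi> - g (- \<xi>) - 2 * K * \<xi>)"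
    using MVT2[of 0 h \<psi> "\<lambda>t. g t - g (- t) - 2 * K * t"] h d by auto
  moreover from this have "(h - 0) * (g \<xi> - g (- \<xi>) - 2 * K * \<xi>) \<le> 0"
    using le[of \<xi>] h by (intro mult_nonneg_nonpos) auto
  ultimately have "u (x + h *\<^sub>R e) + u (x - h *\<^sub>R e) - 2 * u x \<le> K * h\<^sup>2" by (simp add: \<psi>_def)
  then show ?thesis using h by (simp add: second_diff_def divide_le_eq)
qed

lemma second_diff_uminus: "second_diff (\<lambda>x. - u x) e h x = - second_diff u e h x"
  by (simp add: second_diff_def minus_divide_left)

lemma second_diff_ge:
  fixes u :: "'a::real_normed_vector \<Rightarrow> real"
  assumes h: "0 < h" and g: "\<And>t. \<bar>t\<bar> \<le> h \<Longrightarrow> ((\<lambda>t. u (x + t *\<^sub>R e)) has_real_derivative g t) (at t)"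
    and ge: "\<And>t. 0 < t \<Longrightarrow> t < h \<Longrightarrow> 2 * K * t \<le> g t - g (- t)"
  shows "K \<le> second_diff u e h x"
proof -
  have "second_diff (\<lambda>x. - u x) e h x \<le> - K"
  proof (rule second_diff_le[OF h, where g = "\<lambda>t. - g t"])
    show "- g t - - g (- t) \<le> 2 * - K * t" if "0 < t" "t < h" for t using ge[OF that] by simp
  qed (intro DERIV_minus g)
  then show ?thesis by (simp add: second_diff_uminus)
qed

lemma second_diff_double:
  "second_diff u e (2 * h) x
     = (second_diff u e h (x + h *\<^sub>R e) + 2 * second_diff u e h x + second_diff u e h (x - h *\<^sub>R e)) / 4"
proof -
  have eq: "x + h *\<^sub>R e + h *\<^sub>R e = x + (2 * h) *\<^sub>R e" "x - h *\<^sub>R e - h *\<^sub>R e = x - (2 * h) *\<^sub>R e"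
    by (simp_all add: algebra_simps scaleR_2 flip: scaleR_left_distrib)
  then show ?thesis
    by (simp add: second_diff_def eq power_mult_distrib add_divide_distrib diff_divide_distrib)
qed

lemma segment_in_cball:
  fixes x :: "'a::real_normed_vector"
  assumes "x \<in> cball z s" "\<bar>t\<bar> * norm e \<le> q" "s + q \<le> r"
  shows "x + t *\<^sub>R e \<in> cball z r" and "x - t *\<^sub>R e \<in> cball z r"
proof -
  have "norm (t *\<^sub>R e) \<le> q" using assms(2) by simp
  then show "x + t *\<^sub>R e \<in> cball z r" "x - t *\<^sub>R e \<in> cball z r"
    using assms dist_triangle[of z "x + t *\<^sub>R e" x] dist_triangle[of z "x - t *\<^sub>R e" x]
    by (auto simp: dist_norm)
qed

text \<open>The first bound controls the oscillation of second differences and thereby fixes the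
  size of the penalty; the second, of order 1 / h, starts the dyadic iteration at a fixed
  step.\<close>

lemma twice_diff_second_diff_bounds:
  fixes u :: "real^'n \<Rightarrow> real"
  assumes u: "twice_diff_on (cball z r) u G H" and e: "norm e = 1"
    and x: "x \<in> cball z s" and h: "0 < h" "s + h \<le> r"
  shows "(\<And>y. y \<in> cball z r \<Longrightarrow> \<bar>(H y *v e) \<bullet> e\<bar> \<le> m) \<Longrightarrow> \<bar>second_diff u e h x\<bar> \<le> m"
    and "(\<And>y. y \<in> cball z r \<Longrightarrow> norm (G y) \<le> g0) \<Longrightarrow> second_diff u e h x \<le> 2 * g0 / h"
proof -
  have seg: "x + t *\<^sub>R e \<in> cball z r" if "\<bar>t\<bar> \<le> h" for t
    using segment_in_cball(1)[OF x, of t e h r] that e h by simp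
  note d1 = twice_diff_on_line(1)[OF u seg] and d2 = twice_diff_on_line(2)[OF u seg]
  show "\<bar>second_diff u e h x\<bar> \<le> m" if m: "\<And>y. y \<in> cball z r \<Longrightarrow> \<bar>(H y *v e) \<bullet> e\<bar> \<le> m"
  proof -
    have mvt: "\<exists>\<xi>. \<bar>\<xi>\<bar> \<le> h \<and> G (x + t *\<^sub>R e) \<bullet> e - G (x + (- t) *\<^sub>R e) \<bullet> e = 2 * t * ((H (x + \<xi> *\<^sub>R e) *v e) \<bullet> e)"
      if t: "0 < t" "t < h" for t
    proof -
      obtain \<xi> where "- t < \<xi>" "\<xi> < t"
        "G (x + t *\<^sub>R e) \<bullet> e - G (x + (- t) *\<^sub>R e) \<bullet> e = (t - (- t)) * ((H (x + \<xi> *\<^sub>R e) *v e) \<bullet> e)"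
        using MVT2[of "- t" t "\<lambda>t. G (x + t *\<^sub>R e) \<bullet> e" "\<lambda>t. (H (x + t *\<^sub>R e) *v e) \<bullet> e"] t d2 by auto
      then show ?thesis using t by (intro exI[of _ \<xi>]) auto
    qed
    have bounds: "G (x + t *\<^sub>R e) \<bullet> e - G (x + (- t) *\<^sub>R e) \<bullet> e \<le> 2 * m * t
        \<and> 2 * (- m) * t \<le> G (x + t *\<^sub>R e) \<bullet> e - G (x + (- t) *\<^sub>R e) \<bullet> e" if t: "0 < t" "t < h" for t
    proof -
      obtain \<xi> where \<xi>: "\<bar>\<xi>\<bar> \<le> h" and eq: "G (x + t *\<^sub>R e) \<bullet> e - G (x + (- t) *\<^sub>R e) \<bullet> e = 2 * t * ((H (x + \<xi> *\<^sub>R e) *v e) \<bullet> e)"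
        using mvt[OF t] by blast
      have b: "- m \<le> (H (x + \<xi> *\<^sub>R e) *v e) \<bullet> e" "(H (x + \<xi> *\<^sub>R e) *v e) \<bullet> e \<le> m" using m[OF seg[OF \<xi>]] by (simp_all add: abs_le_iff)
      have "2 * t * ((H (x + \<xi> *\<^sub>R e) *v e) \<bullet> e) \<le> 2 * t * m" "2 * t * (- m) \<le> 2 * t * ((H (x + \<xi> *\<^sub>R e) *v e) \<bullet> e)"
        using mult_left_mono[OF b(2), of "2 * t"] mult_left_mono[OF b(1), of "2 * t"] t by simp_all
      moreover have "2 * m * t = 2 * t * m" "2 * (- m) * t = 2 * t * (- m)" by simp_all
      ultimately show ?thesis unfolding eq by argo
    qed
    have "second_diff u e h x \<le> m" by (rule second_diff_le[OF h(1) d1]) (use bounds in auto)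
    moreover have "- m \<le> second_diff u e h x" by (rule second_diff_ge[OF h(1) d1]) (use bounds in auto)
    ultimately show ?thesis by simp
  qed
  show "second_diff u e h x \<le> 2 * g0 / h" if g0: "\<And>y. y \<in> cball z r \<Longrightarrow> norm (G y) \<le> g0"
  proof -
    have b: "\<bar>G (x + t *\<^sub>R e) \<bullet> e\<bar> \<le> g0" if "\<bar>t\<bar> \<le> h" for t
      using Cauchy_Schwarz_ineq2[of "G (x + t *\<^sub>R e)" e] g0[OF seg[OF that]] e by simp
    obtain \<xi> where \<xi>: "0 < \<xi>" "\<xi> < h" "u (x + h *\<^sub>R e) - u (x + 0 *\<^sub>R e) = (h - 0) * (G (x + \<xi> *\<^sub>R e) \<bullet> e)"
      using MVT2[of 0 h "\<lambda>t. u (x + t *\<^sub>R e)" "\<lambda>t. G (x + t *\<^sub>R e) \<bullet> e"] h d1 by auto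
    obtain \<zeta> where \<zeta>: "- h < \<zeta>" "\<zeta> < 0" "u (x + 0 *\<^sub>R e) - u (x + (- h) *\<^sub>R e) = (0 - (- h)) * (G (x + \<zeta> *\<^sub>R e) \<bullet> e)"
      using MVT2[of "- h" 0 "\<lambda>t. u (x + t *\<^sub>R e)" "\<lambda>t. G (x + t *\<^sub>R e) \<bullet> e"] h d1 by auto
    have "u (x + h *\<^sub>R e) + u (x - h *\<^sub>R e) - 2 * u x = h * (G (x + \<xi> *\<^sub>R e) \<bullet> e - G (x + \<zeta> *\<^sub>R e) \<bullet> e)"
      using \<xi>(3) \<zeta>(3) by (simp add: right_diff_distrib)
    also have "\<dots> \<le> h * (2 * g0)"
    proof (rule mult_left_mono)
      show "G (x + \<xi> *\<^sub>R e) \<bullet> e - G (x + \<zeta> *\<^sub>R e) \<bullet> e \<le> 2 * g0"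
        using b[of \<xi>] b[of \<zeta>] \<xi> \<zeta> by (simp add: abs_le_iff)
    qed (use h in simp)
    finally have "second_diff u e h x \<le> h * (2 * g0) / h\<^sup>2"
      unfolding second_diff_def by (rule divide_right_mono) simp
    then show ?thesis using h by (simp add: power2_eq_square)
  qed
qed

text \<open>The last link of the dyadic chain. The threshold \<delta> depends on u and x, which does
  no harm because the steps can be halved indefinitely.\<close>

lemma second_diff_eventually_ge:
  fixes u :: "real^'n \<Rightarrow> real"
  assumes u: "twice_diff_on (cball x r) u G H" and r: "0 < r" and e: "norm e = 1" and \<epsilon>: "0 < \<epsilon>"
  shows "\<exists>\<delta>>0. \<forall>h. 0 < h \<longrightarrow> h < \<delta> \<longrightarrow> (H x *v e) \<bullet> e - \<epsilon> \<le> second_diff u e h x"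
proof -
  let ?g = "\<lambda>t. G (x + t *\<^sub>R e) \<bullet> e" and ?D = "(H x *v e) \<bullet> e"
  have seg: "x + t *\<^sub>R e \<in> cball x r" if "\<bar>t\<bar> \<le> r" for t using that e by (simp add: dist_norm)
  have "(?g has_real_derivative ?D) (at 0)"
    using twice_diff_on_line(2)[OF u seg[of 0]] r by simp
  then have "(?g has_derivative (\<lambda>t. ?D * t)) (at 0)" by (simp add: has_field_derivative_def)
  then obtain \<delta> where \<delta>: "\<delta> > 0" "\<And>t. \<bar>t\<bar> < \<delta> \<Longrightarrow> \<bar>?g t - ?g 0 - ?D * t\<bar> \<le> \<epsilon> * \<bar>t\<bar>"
    unfolding has_derivative_at_alt using \<epsilon> by (metis (no_types, lifting) diff_zero real_norm_def)
  have "?D - \<epsilon> \<le> second_diff u e h x" if h: "0 < h" "h < min \<delta> r" for h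
  proof (rule second_diff_ge[OF h(1), where g = ?g])
    show "((\<lambda>t. u (x + t *\<^sub>R e)) has_real_derivative ?g t) (at t)" if "\<bar>t\<bar> \<le> h" for t
      using twice_diff_on_line(1)[OF u seg] that h by simp
    show "2 * (?D - \<epsilon>) * t \<le> ?g t - ?g (- t)" if t: "0 < t" "t < h" for t
    proof -
      have "\<bar>?g t - ?g 0 - ?D * t\<bar> \<le> \<epsilon> * t" "\<bar>?g (- t) - ?g 0 + ?D * t\<bar> \<le> \<epsilon> * t"
        using \<delta>(2)[of t] \<delta>(2)[of "- t"] t h by auto
      moreover have "2 * (?D - \<epsilon>) * t = 2 * (?D * t) - 2 * (\<epsilon> * t)" by (simp add: algebra_simps)
      ultimately show ?thesis by (simp add: abs_le_iff)
    qed
  qed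
  then show ?thesis using \<delta>(1) r by (intro exI[of _ "min \<delta> r"]) auto
qed

lemma has_derivative_at_shift:
  assumes "(f has_derivative f') (at (x + a))"
  shows "((\<lambda>z. f (z + a)) has_derivative f') (at x)"
proof -
  have "((\<lambda>z. z + a) has_derivative (\<lambda>z. z)) (at x)" by (auto intro!: derivative_eq_intros)
  from has_derivative_compose[OF this assms] show ?thesis .
qed

lemma twice_diff_on_second_diff:
  fixes u :: "real^'n \<Rightarrow> real"
  assumes u: "twice_diff_on (cball z r) u G H" and e: "norm e = 1" and h: "0 < h" "s + h \<le> r"
  shows "twice_diff_on (cball z s) (second_diff u e h)
     (\<lambda>x. (1 / h\<^sup>2) *\<^sub>R (G (x + h *\<^sub>R e) + G (x - h *\<^sub>R e) - 2 *\<^sub>R G x))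
     (\<lambda>x. (1 / h\<^sup>2) *\<^sub>R (H (x + h *\<^sub>R e) + H (x - h *\<^sub>R e) - 2 *\<^sub>R H x))"
  unfolding twice_diff_on_def
proof (intro ballI conjI)
  fix x assume x: "x \<in> cball z s"
  have "0 \<le> h * norm e" using h by simp
  then have pts: "x + h *\<^sub>R e \<in> cball z r" "x + - (h *\<^sub>R e) \<in> cball z r" "x \<in> cball z r"
    using segment_in_cball[OF x, of h e h r] x h e by auto
  have du: "(u has_derivative (\<lambda>h. G y \<bullet> h)) (at y)" and dG: "(G has_derivative (\<lambda>h. H y *v h)) (at y)"
    and sym: "transpose (H y) = H y" if "y \<in> cball z r" for y
    using u that by (auto simp: twice_diff_on_def)
  have "((\<lambda>x. (1 / h\<^sup>2) *\<^sub>R (u (x + h *\<^sub>R e) + u (x + - (h *\<^sub>R e)) - 2 *\<^sub>R u x)) has_derivative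
     (\<lambda>k. (1 / h\<^sup>2) *\<^sub>R (G (x + h *\<^sub>R e) \<bullet> k + G (x + - (h *\<^sub>R e)) \<bullet> k - 2 *\<^sub>R (G x \<bullet> k)))) (at x)"
    by (intro has_derivative_scaleR_right has_derivative_diff has_derivative_add
        has_derivative_at_shift[OF du[OF pts(1)]] has_derivative_at_shift[OF du[OF pts(2)]] du pts)
  then show "(second_diff u e h has_derivative
      (\<lambda>k. ((1 / h\<^sup>2) *\<^sub>R (G (x + h *\<^sub>R e) + G (x - h *\<^sub>R e) - 2 *\<^sub>R G x)) \<bullet> k)) (at x)"
    by (simp add: second_diff_def[abs_def] inner_add_left inner_diff_left)
  have "((\<lambda>x. (1 / h\<^sup>2) *\<^sub>R (G (x + h *\<^sub>R e) + G (x + - (h *\<^sub>R e)) - 2 *\<^sub>R G x)) has_derivative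
     (\<lambda>k. (1 / h\<^sup>2) *\<^sub>R (H (x + h *\<^sub>R e) *v k + H (x + - (h *\<^sub>R e)) *v k - 2 *\<^sub>R (H x *v k)))) (at x)"
    by (intro has_derivative_scaleR_right has_derivative_diff has_derivative_add
        has_derivative_at_shift[OF dG[OF pts(1)]] has_derivative_at_shift[OF dG[OF pts(2)]] dG pts)
  then show "((\<lambda>x. (1 / h\<^sup>2) *\<^sub>R (G (x + h *\<^sub>R e) + G (x - h *\<^sub>R e) - 2 *\<^sub>R G x)) has_derivative
      (\<lambda>k. ((1 / h\<^sup>2) *\<^sub>R (H (x + h *\<^sub>R e) + H (x - h *\<^sub>R e) - 2 *\<^sub>R H x)) *v k)) (at x)"
    by (simp add: matrix_vector_mult_add_rdistrib matrix_vector_mult_diff_rdistrib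
        scaleR_matrix_vector_assoc[symmetric])
  show "transpose ((1 / h\<^sup>2) *\<^sub>R (H (x + h *\<^sub>R e) + H (x - h *\<^sub>R e) - 2 *\<^sub>R H x))
      = (1 / h\<^sup>2) *\<^sub>R (H (x + h *\<^sub>R e) + H (x - h *\<^sub>R e) - 2 *\<^sub>R H x)"
    using sym[OF pts(1)] sym[OF pts(2)] sym[OF pts(3)]
    by (simp add: transpose_def vec_eq_iff)
qed

text \<open>The set B and its two translates have total measure at most three quarters of that of
  the ball, so they cannot cover it.\<close>

lemma exists_symmetric_triple_outside:
  fixes x0 :: "'a::euclidean_space"
  assumes B: "B \<in> lmeasurable" and le: "4 * measure lebesgue B \<le> measure lebesgue (ball x0 h)" and h: "0 < h"
  shows "\<exists>x\<in>ball x0 h. x \<notin> B \<and> x + a \<notin> B \<and> x - a \<notin> B"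
proof (rule ccontr)
  assume no: "\<not> ?thesis"
  let ?U = "B \<union> ((+) (- a) ` B \<union> (+) a ` B)"
  have T: "(+) b ` B \<in> lmeasurable" for b using B by (rule measurable_translation)
  have Tm: "(\<lambda>x. x - a) ` B \<in> lmeasurable" "measure lebesgue ((\<lambda>x. x - a) ` B) = measure lebesgue B"
    using T[of "- a"] measure_translation[of "- a" B] by simp_all
  have "x \<in> (+) b ` B" if "x - b \<in> B" for x b using that by (intro image_eqI[of _ _ "x - b"]) auto
  then have "ball x0 h \<subseteq> ?U" using no by force
  then have "measure lebesgue (ball x0 h) \<le> measure lebesgue ?U"
    using B T Tm by (intro measure_mono_fmeasurable fmeasurable.Un) auto
  also have "\<dots> \<le> measure lebesgue B + (measure lebesgue ((+) (- a) ` B) + measure lebesgue ((+) a ` B))"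
    using B T Tm by (intro order_trans[OF measure_Un_le] add_left_mono measure_Un_le fmeasurableD fmeasurable.Un) auto
  also have "\<dots> = 3 * measure lebesgue B" using Tm by (simp add: measure_translation)
  finally have "measure lebesgue (ball x0 h) \<le> 3 * measure lebesgue B" .
  moreover have "measure lebesgue (ball x0 h) > 0" using h by simp
  ultimately show False using le by linarith
qed

section \<open>Comparison of consecutive scales\<close>

definition penalized :: "(real^'n \<Rightarrow> real) \<Rightarrow> real^'n \<Rightarrow> real^'n \<Rightarrow> real \<Rightarrow> real \<Rightarrow> real^'n \<Rightarrow> real" where
  "penalized u e z A h x = second_diff u e h x - A * (dist x z)\<^sup>2"

lemma parallelogram:
  fixes a b :: "'a::real_inner"
  shows "(a + b) \<bullet> (a + b) + (a - b) \<bullet> (a - b) = 2 * (a \<bullet> a) + 2 * (b \<bullet> b)"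
  by (simp add: inner_add_left inner_add_right inner_diff_left inner_diff_right)

lemma average_le:
  fixes a b c d :: real
  assumes "a + 2 * b + c \<le> 4 * d"
  shows "(a + 2 * b + c) / 4 \<le> d"
  using assms by simp

lemma twice_diff_on_uminus:
  assumes "twice_diff_on S u G H"
  shows "twice_diff_on S (\<lambda>x. - u x) (\<lambda>x. - G x) (\<lambda>x. - H x)"
  unfolding twice_diff_on_def
proof (intro ballI conjI)
  fix x assume "x \<in> S"
  then have u: "(u has_derivative (\<lambda>h. G x \<bullet> h)) (at x)" and G: "(G has_derivative (\<lambda>h. H x *v h)) (at x)"
    and H: "transpose (H x) = H x" using assms by (auto simp: twice_diff_on_def)
  show "((\<lambda>x. - u x) has_derivative (\<lambda>h. - G x \<bullet> h)) (at x)"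
    using has_derivative_minus[OF u] by simp
  have "- H x *v h = - (H x *v h)" for h
    by (simp add: matrix_vector_mult_def vec_eq_iff sum_negf)
  then show "((\<lambda>x. - G x) has_derivative (\<lambda>h. - H x *v h)) (at x)"
    using has_derivative_minus[OF G] by simp
  show "transpose (- H x) = - H x" using H by (simp add: transpose_def vec_eq_iff)
qed

text \<open>By the parallelogram identity the average of |. - z|^2 over the three points is at least
  its value at the center, so the penalty acts in the favorable direction.\<close>

lemma penalized_double:
  assumes "0 \<le> A" "norm e = 1"
  shows "(penalized u e z A h (x + h *\<^sub>R e) + 2 * penalized u e z A h x + penalized u e z A h (x - h *\<^sub>R e)) / 4
     \<le> penalized u e z A (2 * h) x"
proof -
  have p: "x + h *\<^sub>R e - z = (x - z) + h *\<^sub>R e" "x - h *\<^sub>R e - z = (x - z) - h *\<^sub>R e" by simp_all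
  have "(dist (x + h *\<^sub>R e) z)\<^sup>2 + (dist (x - h *\<^sub>R e) z)\<^sup>2 = 2 * (dist x z)\<^sup>2 + 2 * ((h *\<^sub>R e) \<bullet> (h *\<^sub>R e))"
    unfolding dist_square_inner p by (rule parallelogram)
  then have "2 * (dist x z)\<^sup>2 \<le> (dist (x + h *\<^sub>R e) z)\<^sup>2 + (dist (x - h *\<^sub>R e) z)\<^sup>2"
    using inner_ge_zero[of "h *\<^sub>R e"] by linarith
  then have "A * (2 * (dist x z)\<^sup>2) \<le> A * ((dist (x + h *\<^sub>R e) z)\<^sup>2 + (dist (x - h *\<^sub>R e) z)\<^sup>2)"
    using assms(1) by (rule mult_left_mono)
  then have "2 * (A * (dist x z)\<^sup>2) \<le> A * (dist (x + h *\<^sub>R e) z)\<^sup>2 + A * (dist (x - h *\<^sub>R e) z)\<^sup>2"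
    by (simp add: distrib_left)
  then show ?thesis
    unfolding penalized_def second_diff_double by (intro average_le) (simp add: right_diff_distrib)
qed

text \<open>\<open>concave\<close> is the inequality for the operator frozen at x, with its Hoelder
  error. The fraction in \<open>harnack\<close> is such that an exceptional set in a ball of radius
  2 h fills at most a quarter of the concentric ball of radius h.\<close>

locale concave_type =
  fixes u :: "real^'n \<Rightarrow> real" and G :: "real^'n \<Rightarrow> real^'n" and H :: "real^'n \<Rightarrow> real^'n^'n"
    and z e :: "real^'n" and r m q \<beta> c C :: real
  assumes r: "0 < r" and m: "0 < m" and q: "0 \<le> q" and \<beta>: "0 < \<beta>" and c: "0 < c" and e: "norm e = 1" and C: "0 < C"
    and diff: "twice_diff_on (cball z r) u G H"
    and bound: "\<And>y. y \<in> cball z r \<Longrightarrow> \<bar>(H y *v e) \<bullet> e\<bar> \<le> m"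
    and concave: "\<And>x. x \<in> cball z r \<Longrightarrow> \<exists>f a. orthonormal_frame f \<and> (\<forall>i. c \<le> a i \<and> a i \<le> 1) \<and>
        (\<forall>y\<in>cball z r. - (q * dist x y powr \<beta>) \<le> (\<Sum>i\<in>UNIV. a i * (((H y - H x) *v f i) \<bullet> f i)))"
    and harnack: "\<And>(v :: real^'n \<Rightarrow> real) G H x0 \<rho> \<kappa>. 0 < \<kappa> \<Longrightarrow> 0 < \<rho> \<Longrightarrow> twice_diff_on (ball x0 (4 * \<rho>)) v G H
      \<Longrightarrow> continuous_on (cball x0 (4 * \<rho>)) v \<Longrightarrow> \<forall>z\<in>cball x0 (4 * \<rho>). 0 \<le> v z \<Longrightarrow> v x0 = 0
      \<Longrightarrow> \<forall>z\<in>ball x0 (4 * \<rho>). elliptic_bound c \<kappa> (H z)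
      \<Longrightarrow> \<exists>B\<in>lmeasurable. {x \<in> ball x0 \<rho>. C * \<kappa> * \<rho>\<^sup>2 < v x} \<subseteq> B
        \<and> measure lebesgue B \<le> 1 / (4 * 2 ^ CARD('n)) * measure lebesgue (ball x0 \<rho>)"
begin

text \<open>A second difference varies by at most 2 m, so with this coefficient the penalty confines
  every maximum point to distance r / 4 from z.\<close>

definition A :: real where "A = 64 * m / r\<^sup>2"

abbreviation "\<phi> \<equiv> penalized u e z A"

lemma A_pos: "0 < A"
  using r m by (simp add: A_def)

text \<open>The Hessian of the second difference splits into two differences based at x, and the
  operator frozen at x bounds each from below by -q h^\<beta>. The penalty adds at most 2 A
  n.\<close>

lemma elliptic_defect:
  assumes x: "x \<in> cball z (r / 2)" and h: "0 < h" "h \<le> r / 2"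
  shows "elliptic_bound c (2 * q * h powr \<beta> / h\<^sup>2 + 2 * A * CARD('n))
    (- ((1 / h\<^sup>2) *\<^sub>R (H (x + h *\<^sub>R e) + H (x - h *\<^sub>R e) - 2 *\<^sub>R H x)) + mat (2 * A))"
proof -
  have xr: "x \<in> cball z r" using x r by simp
  have pts: "x + h *\<^sub>R e \<in> cball z r" "x - h *\<^sub>R e \<in> cball z r"
    using segment_in_cball[OF x, of h e h r] h e by auto
  obtain f a where f: "orthonormal_frame f" and a: "\<And>i. c \<le> a i" "\<And>i. a i \<le> 1"
    and ge: "\<And>y. y \<in> cball z r \<Longrightarrow> - (q * dist x y powr \<beta>) \<le> (\<Sum>i\<in>UNIV. a i * (((H y - H x) *v f i) \<bullet> f i))"
    using concave[OF xr] by blast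
  let ?S = "\<lambda>B. \<Sum>i\<in>UNIV. a i * ((B *v f i) \<bullet> f i)"
  have "dist x (x + h *\<^sub>R e) = h" "dist x (x - h *\<^sub>R e) = h" using e h by (simp_all add: dist_norm)
  then have "- (2 * q * h powr \<beta>) \<le> ?S (H (x + h *\<^sub>R e) - H x) + ?S (H (x - h *\<^sub>R e) - H x)"
    using ge[OF pts(1)] ge[OF pts(2)] by simp
  then have "?S (H (x + h *\<^sub>R e) - H x) + ?S (H (x - h *\<^sub>R e) - H x) + 2 * q * h powr \<beta> \<ge> 0" by simp
  then have le: "0 \<le> (1 / h\<^sup>2) * (?S (H (x + h *\<^sub>R e) - H x) + ?S (H (x - h *\<^sub>R e) - H x) + 2 * q * h powr \<beta>)"
    by simp
  have tm: "a i * (((- ((1 / h\<^sup>2) *\<^sub>R (H (x + h *\<^sub>R e) + H (x - h *\<^sub>R e) - 2 *\<^sub>R H x)) + mat (2 * A)) *v f i) \<bullet> f i)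
     = - (1 / h\<^sup>2) * (a i * (((H (x + h *\<^sub>R e) - H x) *v f i) \<bullet> f i) + a i * (((H (x - h *\<^sub>R e) - H x) *v f i) \<bullet> f i)) + a i * (2 * A)" for i
  proof -
    have ff: "f i \<bullet> f i = 1" using f by (simp add: orthonormal_frame_def)
    have "(- ((1 / h\<^sup>2) *\<^sub>R (H (x + h *\<^sub>R e) + H (x - h *\<^sub>R e) - 2 *\<^sub>R H x)) + mat (2 * A)) *v f i
      = - (1 / h\<^sup>2) *\<^sub>R ((H (x + h *\<^sub>R e) - H x) *v f i + (H (x - h *\<^sub>R e) - H x) *v f i) + (2 * A) *\<^sub>R f i"
    proof -
      have "H (x + h *\<^sub>R e) + H (x - h *\<^sub>R e) - 2 *\<^sub>R H x = (H (x + h *\<^sub>R e) - H x) + (H (x - h *\<^sub>R e) - H x)"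
        by (simp add: scaleR_2)
      then have "- ((1 / h\<^sup>2) *\<^sub>R (H (x + h *\<^sub>R e) + H (x - h *\<^sub>R e) - 2 *\<^sub>R H x))
        = (- (1 / h\<^sup>2)) *\<^sub>R ((H (x + h *\<^sub>R e) - H x) + (H (x - h *\<^sub>R e) - H x))" by simp
      then show ?thesis
        by (simp only: matrix_vector_mult_add_rdistrib mat_mult_vec scaleR_matrix_vector_assoc[symmetric])
    qed
    then show ?thesis by (simp only: inner_add_left inner_scaleR_left ff) (simp add: distrib_left right_diff_distrib mult_ac)
  qed
  have "?S (- ((1 / h\<^sup>2) *\<^sub>R (H (x + h *\<^sub>R e) + H (x - h *\<^sub>R e) - 2 *\<^sub>R H x)) + mat (2 * A))
     = - (1 / h\<^sup>2) * (?S (H (x + h *\<^sub>R e) - H x) + ?S (H (x - h *\<^sub>R e) - H x)) + (\<Sum>i\<in>UNIV. a i * (2 * A))"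
    unfolding tm by (simp only: sum.distrib sum_distrib_left[symmetric])
  also have "(\<Sum>i\<in>UNIV. a i * (2 * A)) \<le> (\<Sum>i\<in>(UNIV :: 'n set). 1 * (2 * A))"
    using a A_pos by (intro sum_mono mult_right_mono) auto
  also have "- (1 / h\<^sup>2) * (?S (H (x + h *\<^sub>R e) - H x) + ?S (H (x - h *\<^sub>R e) - H x)) \<le> 2 * q * h powr \<beta> / h\<^sup>2"
    using le by (simp add: distrib_left)
  finally have "?S (- ((1 / h\<^sup>2) *\<^sub>R (H (x + h *\<^sub>R e) + H (x - h *\<^sub>R e) - 2 *\<^sub>R H x)) + mat (2 * A))
      \<le> 2 * q * h powr \<beta> / h\<^sup>2 + 2 * A * CARD('n)"
    by (simp add: mult_ac)
  then show ?thesis using f a unfolding elliptic_bound_def by blast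
qed

lemma continuous_penalized:
  assumes "0 < h" "h \<le> r / 2"
  shows "continuous_on (cball z (r / 2)) (\<phi> h)"
proof -
  have "twice_diff_on (cball z (r / 2)) (second_diff u e h)
     (\<lambda>x. (1 / h\<^sup>2) *\<^sub>R (G (x + h *\<^sub>R e) + G (x - h *\<^sub>R e) - 2 *\<^sub>R G x))
     (\<lambda>x. (1 / h\<^sup>2) *\<^sub>R (H (x + h *\<^sub>R e) + H (x - h *\<^sub>R e) - 2 *\<^sub>R H x))"
    using assms by (intro twice_diff_on_second_diff[OF diff e]) auto
  then have "continuous_on (cball z (r / 2)) (second_diff u e h)"
    unfolding twice_diff_on_def by (intro continuous_at_imp_continuous_on ballI has_derivative_continuous) blast
  then show ?thesis unfolding penalized_def[abs_def] by (intro continuous_intros)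
qed

text \<open>At a maximum point of the penalized second difference the defect is a nonnegative
  supersolution vanishing there, hence small outside a set of small measure; so it is small at three
  equidistant points, which is what a second difference of twice the step is made of.\<close>

lemma one_scale:
  assumes h: "0 < h" "h \<le> r / 32"
    and le: "\<And>x. x \<in> cball z (r / 2) \<Longrightarrow> \<phi> (2 * h) x \<le> M" and x: "x \<in> cball z (r / 2)"
  shows "\<phi> h x \<le> M + 4 * C * (2 * q * h powr \<beta> + 2 * A * CARD('n) * h\<^sup>2)"
proof -
  let ?Z = "cball z (r / 2)"
  have h2: "h \<le> r / 2" using h by simp
  have zZ: "z \<in> ?Z" using r by simp
  then have ne: "?Z \<noteq> {}" by blast
  from continuous_attains_sup[OF compact_cball ne continuous_penalized[OF h(1) h2]]
  obtain x0 where x0: "x0 \<in> ?Z" and max: "\<And>y. y \<in> ?Z \<Longrightarrow> \<phi> h y \<le> \<phi> h x0" by blast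
  have sd: "\<bar>second_diff u e h y\<bar> \<le> m" if "y \<in> ?Z" for y
    using twice_diff_second_diff_bounds(1)[OF diff e that h(1) _ bound] h2 by simp
  have "A * (dist x0 z)\<^sup>2 \<le> 2 * m"
    using max[OF zZ] sd[OF zZ] sd[OF x0] by (simp add: penalized_def abs_le_iff)
  then have "64 * (dist x0 z)\<^sup>2 \<le> 2 * r\<^sup>2"
    using r m by (simp add: A_def field_simps)
  moreover have "(r / 4)\<^sup>2 = r\<^sup>2 / 16" by (simp add: power_divide)
  ultimately have "(dist x0 z)\<^sup>2 \<le> (r / 4)\<^sup>2" using zero_le_power2[of "dist x0 z"] by linarith
  then have near: "dist x0 z \<le> r / 4" using r by (simp add: power2_le_iff_abs_le)
  \<comment> \<open>Radius 8 h <= r / 4 is what h <= r / 32 provides. The measure estimate is used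
    at radius 2 h so that a point within h of x0 has both translates by h e inside.\<close>
  have sub: "cball x0 (4 * (2 * h)) \<subseteq> ?Z"
  proof
    fix y assume "y \<in> cball x0 (4 * (2 * h))"
    then show "y \<in> ?Z" using near h dist_triangle[of z y x0] by (simp add: dist_commute)
  qed
  let ?\<kappa> = "2 * q * h powr \<beta> / h\<^sup>2 + 2 * A * CARD('n)"
  have kap: "0 < ?\<kappa>" using q A_pos h by (intro add_nonneg_pos) auto
  let ?Hw = "\<lambda>x. (1 / h\<^sup>2) *\<^sub>R (H (x + h *\<^sub>R e) + H (x - h *\<^sub>R e) - 2 *\<^sub>R H x)"
  let ?Gw = "\<lambda>x. (1 / h\<^sup>2) *\<^sub>R (G (x + h *\<^sub>R e) + G (x - h *\<^sub>R e) - 2 *\<^sub>R G x)"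
  define v where "v = (\<lambda>y. - second_diff u e h y + (2 * A) / 2 * (dist y z)\<^sup>2 + \<phi> h x0)"
  have v: "v y = \<phi> h x0 - \<phi> h y" for y by (simp add: v_def penalized_def)
  have "twice_diff_on ?Z (second_diff u e h) ?Gw ?Hw"
    using h by (intro twice_diff_on_second_diff[OF diff e]) auto
  from twice_diff_on_add_paraboloid[OF twice_diff_on_uminus[OF this], of "2 * A" z "\<phi> h x0"]
  have vd: "twice_diff_on ?Z v (\<lambda>y. - ?Gw y + (2 * A) *\<^sub>R (y - z)) (\<lambda>y. - ?Hw y + mat (2 * A))"
    by (simp only: v_def)
  have "continuous_on ?Z v" unfolding v by (intro continuous_intros continuous_penalized h h2)
  then have vc: "continuous_on (cball x0 (4 * (2 * h))) v" using sub by (rule continuous_on_subset)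
  have ball: "ball x0 (4 * (2 * h)) \<subseteq> ?Z" using sub ball_subset_cball by blast
  have "0 < 2 * h" using h by simp
  have "\<exists>B\<in>lmeasurable. {x \<in> ball x0 (2 * h). C * ?\<kappa> * (2 * h)\<^sup>2 < v x} \<subseteq> B
      \<and> measure lebesgue B \<le> 1 / (4 * 2 ^ CARD('n)) * measure lebesgue (ball x0 (2 * h))"
  proof (rule harnack[OF kap \<open>0 < 2 * h\<close> twice_diff_on_subset[OF vd ball] vc])
    show "\<forall>y\<in>cball x0 (4 * (2 * h)). 0 \<le> v y" using sub max by (auto simp: v)
    show "v x0 = 0" by (simp add: v)
    show "\<forall>y\<in>ball x0 (4 * (2 * h)). elliptic_bound c ?\<kappa> (- ?Hw y + mat (2 * A))"
      using elliptic_defect[OF _ h(1) h2] ball by blast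
  qed
  then obtain B where B: "B \<in> lmeasurable"
    and Bsub: "\<And>x. x \<in> ball x0 (2 * h) \<Longrightarrow> x \<notin> B \<Longrightarrow> v x \<le> C * ?\<kappa> * (2 * h)\<^sup>2"
    and Bm: "measure lebesgue B \<le> 1 / (4 * 2 ^ CARD('n)) * measure lebesgue (ball x0 (2 * h))"
    by (auto simp: not_le[symmetric] subset_iff)
  have "measure lebesgue (ball x0 (2 * h)) = 2 ^ CARD('n) * measure lebesgue (ball x0 h)"
    using measure_ball_scale(1)[of h 2 x0 x0] h by simp
  then have "4 * measure lebesgue B \<le> measure lebesgue (ball x0 h)" using Bm by simp
  from exists_symmetric_triple_outside[OF B this h(1), of "h *\<^sub>R e"]
  obtain y where y: "y \<in> ball x0 h" "y \<notin> B" "y + h *\<^sub>R e \<notin> B" "y - h *\<^sub>R e \<notin> B" by blast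
  have in2: "y \<in> ball x0 (2 * h)" "y + h *\<^sub>R e \<in> ball x0 (2 * h)" "y - h *\<^sub>R e \<in> ball x0 (2 * h)"
    using y(1) h e dist_triangle[of x0 "y + h *\<^sub>R e" y] dist_triangle[of x0 "y - h *\<^sub>R e" y]
    by (auto simp: dist_norm)
  have yZ: "y \<in> ?Z" using in2(1) ball h by (auto simp: subset_iff)
  define K where "K = C * ?\<kappa> * (2 * h)\<^sup>2"
  have K: "K = 4 * C * (2 * q * h powr \<beta> + 2 * A * CARD('n) * h\<^sup>2)"
    using h by (simp add: K_def field_simps power2_eq_square)
  have "\<phi> h x0 - \<phi> h y \<le> K" "\<phi> h x0 - \<phi> h (y + h *\<^sub>R e) \<le> K" "\<phi> h x0 - \<phi> h (y - h *\<^sub>R e) \<le> K"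
    using Bsub[OF in2(1) y(2)] Bsub[OF in2(2) y(3)] Bsub[OF in2(3) y(4)] by (simp_all only: v K_def)
  moreover have "(\<phi> h (y + h *\<^sub>R e) + 2 * \<phi> h y + \<phi> h (y - h *\<^sub>R e)) / 4 \<le> \<phi> (2 * h) y"
    using penalized_double[OF _ e] A_pos by simp
  ultimately have "(\<phi> h x0 - K + 2 * (\<phi> h x0 - K) + (\<phi> h x0 - K)) / 4 \<le> M"
    using le[OF yZ] by simp
  then have "\<phi> h x0 \<le> M + K" by simp
  then show ?thesis using max[OF x] K by simp
qed

text \<open>Solved from the recursion: the difference of the values at 2 h and at h equals the error
  of \<open>one_scale\<close>. The denominators 2^\<beta> - 1 and 3 are those of geometric
  sums.\<close>

definition scale_error :: "real \<Rightarrow> real" where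
  "scale_error h = 8 * C / (2 powr \<beta> - 1) * (q * h powr \<beta>) + 8 * C * CARD('n) / 3 * (A * h\<^sup>2)"

lemma scale_error_step:
  assumes "0 < h"
  shows "scale_error h + 4 * C * (2 * q * h powr \<beta> + 2 * A * CARD('n) * h\<^sup>2) \<le> scale_error (2 * h)"
proof -
  have b: "2 powr \<beta> - 1 > 0" using \<beta> by (simp add: gr_one_powr)
  have "scale_error (2 * h) = 8 * C / (2 powr \<beta> - 1) * (q * h powr \<beta>) * (2 powr \<beta> - 1 + 1)
      + 8 * C * CARD('n) / 3 * (A * h\<^sup>2) * 4"
    using assms by (simp add: scale_error_def powr_mult power_mult_distrib mult_ac)
  also have "\<dots> = 8 * C / (2 powr \<beta> - 1) * (q * h powr \<beta>) * (2 powr \<beta> - 1)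
      + 8 * C / (2 powr \<beta> - 1) * (q * h powr \<beta>) + 8 * C * CARD('n) / 3 * (A * h\<^sup>2) * 4"
    by (simp only: distrib_left mult_1_right)
  also have "8 * C / (2 powr \<beta> - 1) * (q * h powr \<beta>) * (2 powr \<beta> - 1) = 8 * C * (q * h powr \<beta>)"
    using b \<beta> by simp
  finally show ?thesis by (simp add: scale_error_def algebra_simps)
qed

text \<open>The iteration starts from the gradient bound at step h0; each halving costs the error of
  one scale, which \<open>scale_error\<close> turns into a telescoping sum.\<close>

lemma all_scales:
  assumes h0: "0 < h0" "h0 \<le> r / 16" and g0: "\<And>y. y \<in> cball z r \<Longrightarrow> norm (G y) \<le> g0"
    and x: "x \<in> cball z (r / 2)"
  shows "\<phi> (h0 / 2 ^ j) x \<le> 2 * g0 / h0 + scale_error h0 - scale_error (h0 / 2 ^ j)"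
  using x
proof (induction j arbitrary: x)
  case 0
  have "second_diff u e h0 x \<le> 2 * g0 / h0"
    using twice_diff_second_diff_bounds(2)[OF diff e 0 h0(1) _ g0] h0 by simp
  moreover have "0 \<le> A * (dist x z)\<^sup>2" using A_pos by simp
  ultimately show ?case by (simp add: penalized_def)
next
  case (Suc j)
  let ?h = "h0 / 2 ^ Suc j"
  have h: "0 < ?h" using h0 by simp
  \<comment> \<open>The estimate for one scale is applied to steps at most h0 / 2, so h0 <= r / 16
    suffices.\<close>
  have "?h \<le> h0 / 2 ^ Suc 0" using h0 by (intro divide_left_mono power_increasing) auto
  then have h32: "?h \<le> r / 32" using h0 by simp
  have eq: "2 * ?h = h0 / 2 ^ j" by simp
  have "\<phi> ?h x \<le> (2 * g0 / h0 + scale_error h0 - scale_error (2 * ?h))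
      + 4 * C * (2 * q * ?h powr \<beta> + 2 * A * CARD('n) * ?h\<^sup>2)"
    by (rule one_scale[OF h h32 _ Suc.prems]) (unfold eq, rule Suc.IH)
  then show ?case using scale_error_step[OF h] by linarith
qed

text \<open>At z the penalty vanishes, so letting the step tend to zero recovers the second
  derivative there.\<close>

lemma second_derivative_bound:
  assumes h0: "0 < h0" "h0 \<le> r / 16" and g0: "\<And>y. y \<in> cball z r \<Longrightarrow> norm (G y) \<le> g0"
  shows "(H z *v e) \<bullet> e \<le> 2 * g0 / h0 + scale_error h0"
proof (rule field_le_epsilon)
  fix \<epsilon> :: real assume "0 < \<epsilon>"
  then obtain \<delta> where \<delta>: "\<delta> > 0"
    "\<And>h. 0 < h \<Longrightarrow> h < \<delta> \<Longrightarrow> (H z *v e) \<bullet> e - \<epsilon> \<le> second_diff u e h z"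
    using second_diff_eventually_ge[OF diff r e] by blast
  obtain j :: nat where "h0 / \<delta> < 2 ^ j" using real_arch_pow[of 2 "h0 / \<delta>"] by auto
  then have "h0 / 2 ^ j < \<delta>" using \<delta>(1) by (simp add: field_simps)
  then have "(H z *v e) \<bullet> e - \<epsilon> \<le> second_diff u e (h0 / 2 ^ j) z" using \<delta>(2) h0 by simp
  also have "\<dots> = \<phi> (h0 / 2 ^ j) z" by (simp add: penalized_def)
  also have "\<dots> \<le> 2 * g0 / h0 + scale_error h0 - scale_error (h0 / 2 ^ j)"
  proof (rule all_scales[OF h0 g0])
    show "z \<in> cball z (r / 2)" using r by simp
  qed
  also have "\<dots> \<le> 2 * g0 / h0 + scale_error h0"
  proof -
    have "2 powr \<beta> - 1 > 0" using \<beta> by (simp add: gr_one_powr)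
    then have "0 \<le> scale_error (h0 / 2 ^ j)" using C q A_pos by (simp add: scale_error_def)
    then show ?thesis by simp
  qed
  finally show "(H z *v e) \<bullet> e \<le> 2 * g0 / h0 + scale_error h0 + \<epsilon>" by simp
qed

end

section \<open>Interior estimates for second derivatives\<close>

definition concave_along :: "real \<Rightarrow> real \<Rightarrow> real \<Rightarrow> (real^'n) set \<Rightarrow> (real^'n \<Rightarrow> real^'n^'n) \<Rightarrow> bool" where
  "concave_along c q \<beta> S H \<longleftrightarrow> (\<forall>x\<in>S. \<exists>f a. orthonormal_frame f \<and> (\<forall>i. c \<le> a i \<and> a i \<le> 1) \<and>
     (\<forall>y\<in>S. - (q * dist x y powr \<beta>) \<le> (\<Sum>i\<in>UNIV. a i * (((H y - H x) *v f i) \<bullet> f i))))"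

text \<open>The constant is fixed before the function, the ball and the direction. The starting step
  h0 is left free because the a priori bound m is itself to be estimated: a small h0 / r makes its
  contribution absorbable.\<close>

theorem interior_second_derivative_bound:
  fixes c \<beta> :: real
  assumes c: "0 < c" and \<beta>: "0 < \<beta>"
  shows "\<exists>C>0. \<forall>(u :: real^'n \<Rightarrow> real) G H z e r m q g0 h0.
     0 < r \<longrightarrow> 0 < m \<longrightarrow> 0 \<le> q \<longrightarrow> norm e = 1 \<longrightarrow> twice_diff_on (cball z r) u G H \<longrightarrow>
     (\<forall>y\<in>cball z r. \<bar>(H y *v e) \<bullet> e\<bar> \<le> m) \<longrightarrow> (\<forall>y\<in>cball z r. norm (G y) \<le> g0) \<longrightarrow>
     concave_along c q \<beta> (cball z r) H \<longrightarrow> 0 < h0 \<longrightarrow> h0 \<le> r / 16 \<longrightarrow>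
     (H z *v e) \<bullet> e \<le> 2 * g0 / h0 + C * (q * h0 powr \<beta> + m * h0\<^sup>2 / r\<^sup>2)"
proof -
  obtain C0 where C0: "C0 > 0" and harnack: "\<And>(v :: real^'n \<Rightarrow> real) G H x0 \<rho> \<kappa>. 0 < \<kappa> \<Longrightarrow> 0 < \<rho> \<Longrightarrow> twice_diff_on (ball x0 (4 * \<rho>)) v G H
      \<Longrightarrow> continuous_on (cball x0 (4 * \<rho>)) v \<Longrightarrow> \<forall>z\<in>cball x0 (4 * \<rho>). 0 \<le> v z \<Longrightarrow> v x0 = 0
      \<Longrightarrow> \<forall>z\<in>ball x0 (4 * \<rho>). elliptic_bound c \<kappa> (H z)
      \<Longrightarrow> \<exists>B\<in>lmeasurable. {x \<in> ball x0 \<rho>. C0 * \<kappa> * \<rho>\<^sup>2 < v x} \<subseteq> B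
        \<and> measure lebesgue B \<le> 1 / (4 * 2 ^ CARD('n)) * measure lebesgue (ball x0 \<rho>)"
    using nonneg_supersolution_measure[OF c, of "1 / (4 * 2 ^ CARD('n))", where 'n = 'n] by auto
  have b: "2 powr \<beta> - 1 > 0" using \<beta> by (simp add: gr_one_powr)
  define K1 K2 where "K1 = 8 * C0 / (2 powr \<beta> - 1)" and "K2 = 8 * C0 * CARD('n) / 3 * 64"
  have K: "K1 > 0" "K2 > 0" using C0 b by (auto simp: K1_def K2_def)
  show ?thesis
  proof (intro exI[of _ "max K1 K2"] conjI allI impI)
    show "max K1 K2 > 0" using K by simp
    fix u :: "real^'n \<Rightarrow> real" and G H z e r m q g0 h0
    assume h: "0 < r" "0 < m" "0 \<le> q" "norm e = 1" "twice_diff_on (cball z r) u G H"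
     "\<forall>y\<in>cball z r. \<bar>(H y *v e) \<bullet> e\<bar> \<le> m" "\<forall>y\<in>cball z r. norm (G y) \<le> g0"
     "concave_along c q \<beta> (cball z r) H" "0 < h0" "h0 \<le> r / 16"
    interpret concave_type u G H z e r m q \<beta> c C0
    proof (unfold_locales, goal_cases)
      case (10 x)
      then show ?case using h(8) unfolding concave_along_def by blast
    next
      case (11 v G H x0 \<rho> \<kappa>)
      then show ?case by (rule harnack)
    qed (use h c \<beta> C0 in auto)
    have "(H z *v e) \<bullet> e \<le> 2 * g0 / h0 + scale_error h0"
      using second_derivative_bound[OF h(9,10)] h(7) by blast
    also have "scale_error h0 = K1 * (q * h0 powr \<beta>) + K2 * (m * h0\<^sup>2 / r\<^sup>2)"
      by (simp add: scale_error_def K1_def K2_def A_def)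
    also have "\<dots> \<le> max K1 K2 * (q * h0 powr \<beta>) + max K1 K2 * (m * h0\<^sup>2 / r\<^sup>2)"
      using h by (intro add_mono mult_right_mono) auto
    finally show "(H z *v e) \<bullet> e \<le> 2 * g0 / h0 + max K1 K2 * (q * h0 powr \<beta> + m * h0\<^sup>2 / r\<^sup>2)"
      by (simp only: distrib_left)
  qed
qed

text \<open>The norm of a matrix is here the Euclidean norm of its entries, so the bound is the
  Cauchy-Schwarz inequality row by row.\<close>

lemma norm_matrix_vector_le:
  fixes A :: "real^'n^'m"
  shows "norm (A *v x) \<le> norm A * norm x"
proof -
  have "(norm (A *v x))\<^sup>2 = (\<Sum>i\<in>UNIV. (A $ i \<bullet> x)\<^sup>2)"
    unfolding power2_norm_eq_inner inner_vec_def[of "A *v x"]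
    by (simp add: matrix_vector_mul_component power2_eq_square)
  also have "\<dots> \<le> (\<Sum>i\<in>UNIV. (norm (A $ i))\<^sup>2 * (norm x)\<^sup>2)"
    by (intro sum_mono) (simp add: power_mult_distrib[symmetric] abs_le_square_iff[symmetric] Cauchy_Schwarz_ineq2)
  also have "\<dots> = (norm A * norm x)\<^sup>2"
  proof -
    have "(norm A)\<^sup>2 = (\<Sum>i\<in>UNIV. (norm (A $ i))\<^sup>2)"
      by (simp add: power2_norm_eq_inner inner_vec_def)
    then show ?thesis by (simp add: power_mult_distrib sum_distrib_right)
  qed
  finally show ?thesis by (rule power2_le_imp_le) simp
qed

lemma quadratic_form_le_norm:
  fixes A :: "real^'n^'n"
  assumes "norm e = 1"
  shows "\<bar>(A *v e) \<bullet> e\<bar> \<le> norm A"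
  using Cauchy_Schwarz_ineq2[of "A *v e" e] norm_matrix_vector_le[of A e] assms by simp

lemma absorb_quarters:
  fixes w :: real
  assumes "w \<le> a + b + c" "a = x" "b \<le> y + w / 4" "c \<le> w / 4"
  shows "w \<le> 2 * (x + y)"
proof -
  have "w / 4 + w / 4 = w / 2" by simp
  then show ?thesis using assms by argo
qed

lemma powr_le_one_plus:
  fixes t \<beta> :: real
  assumes "0 \<le> t" "0 < \<beta>" "\<beta> \<le> 1"
  shows "t powr \<beta> \<le> 1 + t"
proof (cases "t \<le> 1")
  case True
  then have "t powr \<beta> \<le> 1 powr \<beta>" using assms by (intro powr_mono2) auto
  then show ?thesis using assms by simp
next
  case False
  then have "t powr \<beta> \<le> t powr 1" using assms by (intro powr_mono) auto
  then show ?thesis using False by simp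
qed

text \<open>The maximum of \<open>(R - \<bar>x - x\<^sub>0\<bar>) \<bar>D\<^sup>2u\<bar>\<close> is bounded: around a maximum point the Hessian is at most
  doubled, and the quadratic error term in the estimate above is absorbed by choosing the initial
  scale proportional to the distance to the boundary.\<close>

theorem interior_hessian_bound:
  fixes c \<beta> \<gamma> K L g0 :: real
  assumes c: "0 < c" and \<beta>: "0 < \<beta>" "\<beta> \<le> 1" and \<gamma>: "0 < \<gamma>" and K: "0 \<le> K" and L: "0 \<le> L" and g0: "0 \<le> g0"
  shows "\<exists>R0>0. \<exists>N0. \<forall>(u :: real^'n \<Rightarrow> real) G H x0 R F \<Sigma>.
     0 < R \<longrightarrow> R \<le> R0 \<longrightarrow> \<Sigma> \<subseteq> {1, -1} \<longrightarrow> twice_diff_on (cball x0 R) u G H \<longrightarrow>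
     continuous_on (cball x0 R) H \<longrightarrow> (\<forall>x\<in>cball x0 R. norm (G x) \<le> g0) \<longrightarrow>
     (\<forall>x\<in>cball x0 R. \<exists>s\<in>\<Sigma>. \<exists>e. norm e = 1 \<and> \<gamma> * norm (H x) \<le> s * ((H x *v e) \<bullet> e)) \<longrightarrow>
     (\<forall>s\<in>\<Sigma>. \<forall>x\<in>cball x0 R. \<exists>f a. orthonormal_frame f \<and> (\<forall>i. c \<le> a i \<and> a i \<le> 1) \<and>
        (\<forall>y\<in>cball x0 R. - (K * \<bar>F y - F x\<bar> powr \<beta>) \<le> (\<Sum>i\<in>UNIV. a i * (s * (((H y - H x) *v f i) \<bullet> f i))))) \<longrightarrow>
     (\<forall>S M. S \<subseteq> cball x0 R \<longrightarrow> convex S \<longrightarrow> (\<forall>x\<in>S. norm (H x) \<le> M) \<longrightarrow>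
        (\<forall>x\<in>S. \<forall>y\<in>S. \<bar>F y - F x\<bar> \<le> L * (1 + M) * dist x y)) \<longrightarrow>
     R * norm (H x0) \<le> N0"
proof -
  obtain C where C: "C > 0" and bound: "\<And>(u :: real^'n \<Rightarrow> real) G H z e r m q g0 h0.
     0 < r \<Longrightarrow> 0 < m \<Longrightarrow> 0 \<le> q \<Longrightarrow> norm e = 1 \<Longrightarrow> twice_diff_on (cball z r) u G H \<Longrightarrow>
     \<forall>y\<in>cball z r. \<bar>(H y *v e) \<bullet> e\<bar> \<le> m \<Longrightarrow> \<forall>y\<in>cball z r. norm (G y) \<le> g0 \<Longrightarrow>
     concave_along c q \<beta> (cball z r) H \<Longrightarrow> 0 < h0 \<Longrightarrow> h0 \<le> r / 16 \<Longrightarrow>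
     (H z *v e) \<bullet> e \<le> 2 * g0 / h0 + C * (q * h0 powr \<beta> + m * h0\<^sup>2 / r\<^sup>2)"
    using interior_second_derivative_bound[OF c \<beta>(1), where 'n = 'n] by auto
  \<comment> \<open>The ratio of h0 to r, small enough that the quadratic error is at most a quarter
    of \<gamma> N.\<close>
  define \<theta> where "\<theta> = min (1 / 16) (\<gamma> / (8 * C))"
  have \<theta>: "0 < \<theta>" "\<theta> \<le> 1 / 16" "8 * (C * \<theta>) \<le> \<gamma>"
    using C \<gamma> by (auto simp: \<theta>_def min_def field_simps)
  \<comment> \<open>Small radii make the part of the Hoelder error that is linear in N at most
    another quarter of \<gamma> N.\<close>
  define R0 where "R0 = min 1 (\<gamma> / (4 * (C * K * L + 1)))"
  have CKL: "0 < C * K * L + 1" using C K L by (simp add: add_nonneg_pos)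
  have R0: "0 < R0" "R0 \<le> 1" using CKL \<gamma> by (auto simp: R0_def)
  have R0b: "C * K * L * R0 \<le> \<gamma> / 4"
  proof -
    have "R0 \<le> \<gamma> / (4 * (C * K * L + 1))" by (simp add: R0_def)
    then have "4 * ((C * K * L + 1) * R0) \<le> \<gamma>" using CKL by (simp add: pos_le_divide_eq mult_ac)
    moreover have "C * K * L * R0 \<le> (C * K * L + 1) * R0" using R0 by (intro mult_right_mono) auto
    ultimately show ?thesis by simp
  qed
  define N0 where "N0 = 2 / \<gamma> * (4 * g0 / \<theta> + C * K * (1 + L))"
  have N0: "0 \<le> N0" using \<gamma> g0 \<theta> C K L by (simp add: N0_def)
  show ?thesis
  proof (rule exI[of _ R0], rule conjI[OF R0(1)], rule exI[of _ N0], intro allI impI)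
    fix u :: "real^'n \<Rightarrow> real" and G H x0 R F \<Sigma>
    assume R: "0 < R" "R \<le> R0" and \<Sigma>: "\<Sigma> \<subseteq> {1 :: real, -1}" and diff: "twice_diff_on (cball x0 R) u G H"
      and cont: "continuous_on (cball x0 R) H" and G: "\<forall>x\<in>cball x0 R. norm (G x) \<le> g0"
      and dir: "\<forall>x\<in>cball x0 R. \<exists>s\<in>\<Sigma>. \<exists>e. norm e = 1 \<and> \<gamma> * norm (H x) \<le> s * ((H x *v e) \<bullet> e)"
      and conc: "\<forall>s\<in>\<Sigma>. \<forall>x\<in>cball x0 R. \<exists>f a. orthonormal_frame f \<and> (\<forall>i. c \<le> a i \<and> a i \<le> 1) \<and>
        (\<forall>y\<in>cball x0 R. - (K * \<bar>F y - F x\<bar> powr \<beta>) \<le> (\<Sum>i\<in>UNIV. a i * (s * (((H y - H x) *v f i) \<bullet> f i))))"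
      and lip: "\<forall>S M. S \<subseteq> cball x0 R \<longrightarrow> convex S \<longrightarrow> (\<forall>x\<in>S. norm (H x) \<le> M) \<longrightarrow>
        (\<forall>x\<in>S. \<forall>y\<in>S. \<bar>F y - F x\<bar> \<le> L * (1 + M) * dist x y)"
    let ?W = "\<lambda>x. (R - dist x0 x) * norm (H x)"
    have x0: "x0 \<in> cball x0 R" using R by simp
    then have ne: "cball x0 R \<noteq> {}" by blast
    have "continuous_on (cball x0 R) ?W" by (intro continuous_intros cont)
    from continuous_attains_sup[OF compact_cball ne this] obtain z where z: "z \<in> cball x0 R"
      and max: "\<And>y. y \<in> cball x0 R \<Longrightarrow> ?W y \<le> ?W z" by blast
    define N where "N = ?W z"
    have "N \<le> N0"
    proof (cases "N \<le> 0")
      case False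
      define d where "d = R - dist x0 z"
      have d0: "d \<ge> 0" using z by (simp add: d_def)
      have Nd: "N = d * norm (H z)" by (simp add: N_def d_def)
      have d: "0 < d" "d \<le> R0" using False d0 R Nd by (auto simp: less_le d_def intro: order_trans[of _ R])
      \<comment> \<open>On the ball of radius d / 2 around z the weight R - |x - x0| is at least d /
        2, so maximality of N bounds the Hessian there by m.\<close>
      define r m h0 where "r = d / 2" and "m = 2 * N / d" and "h0 = \<theta> * r"
      have r: "0 < r" and m: "0 < m" and h0: "0 < h0" "h0 \<le> r / 16"
        using d False \<theta> mult_right_mono[OF \<theta>(2), of r] by (auto simp: r_def m_def h0_def)
      have sub: "cball z r \<subseteq> cball x0 R"
      proof
        fix y assume "y \<in> cball z r"
        then show "y \<in> cball x0 R" using dist_triangle[of x0 y z] d by (simp add: r_def d_def)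
      qed
      have Hm: "norm (H y) \<le> m" if y: "y \<in> cball z r" for y
      proof -
        have "d / 2 \<le> R - dist x0 y" using y dist_triangle[of x0 y z] by (simp add: r_def d_def)
        then have "d / 2 * norm (H y) \<le> ?W y" by (rule mult_right_mono) simp
        also have "\<dots> \<le> N" using max y sub unfolding N_def by blast
        finally show ?thesis using d by (simp add: m_def pos_le_divide_eq mult_ac)
      qed
      obtain s e where s: "s \<in> \<Sigma>" and e: "norm e = 1" and top: "\<gamma> * norm (H z) \<le> s * ((H z *v e) \<bullet> e)"
        using dir z by blast
      have s1: "s = 1 \<or> s = -1" using s \<Sigma> by blast
      \<comment> \<open>Where the Hessian is at most m, F is Lipschitz with constant L (1 + m); this
        turns the error in F into one in the distance.\<close>
      define q where "q = K * (L * (1 + m)) powr \<beta>"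
      have q: "0 \<le> q" using K by (simp add: q_def)
      have sm: "(s *\<^sub>R A) *v x = s *\<^sub>R (A *v x)" for A :: "real^'n^'n" and x
        by (rule scaleR_matrix_vector_assoc[symmetric])
      have conc': "concave_along c q \<beta> (cball z r) (\<lambda>x. s *\<^sub>R H x)"
        unfolding concave_along_def
      proof
        fix x assume x: "x \<in> cball z r"
        then have "x \<in> cball x0 R" using sub by blast
        then obtain f a where f: "orthonormal_frame f" "\<forall>i. c \<le> a i \<and> a i \<le> 1"
          and ge: "\<And>y. y \<in> cball x0 R \<Longrightarrow> - (K * \<bar>F y - F x\<bar> powr \<beta>) \<le> (\<Sum>i\<in>UNIV. a i * (s * (((H y - H x) *v f i) \<bullet> f i)))"
          using conc s by blast
        have "- (q * dist x y powr \<beta>) \<le> (\<Sum>i\<in>UNIV. a i * (((s *\<^sub>R H y - s *\<^sub>R H x) *v f i) \<bullet> f i))"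
          if y: "y \<in> cball z r" for y
        proof -
          have "\<bar>F y - F x\<bar> \<le> L * (1 + m) * dist x y"
            using lip[rule_format, OF sub convex_cball Hm x y] .
          then have "\<bar>F y - F x\<bar> powr \<beta> \<le> (L * (1 + m) * dist x y) powr \<beta>"
            using \<beta> by (intro powr_mono2) auto
          also have "\<dots> = (L * (1 + m)) powr \<beta> * dist x y powr \<beta>"
            by (rule powr_mult)
          finally have "K * \<bar>F y - F x\<bar> powr \<beta> \<le> q * dist x y powr \<beta>"
            using K by (simp add: q_def mult_left_mono mult.assoc)
          moreover have "s *\<^sub>R H y - s *\<^sub>R H x = s *\<^sub>R (H y - H x)" by (simp add: scaleR_diff_right)
          ultimately show ?thesis using ge[of y] y sub by (auto simp: sm)
        qed
        then show "\<exists>f a. orthonormal_frame f \<and> (\<forall>i. c \<le> a i \<and> a i \<le> 1) \<and>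
          (\<forall>y\<in>cball z r. - (q * dist x y powr \<beta>) \<le> (\<Sum>i\<in>UNIV. a i * (((s *\<^sub>R H y - s *\<^sub>R H x) *v f i) \<bullet> f i)))"
          using f by blast
      qed
      have diff': "twice_diff_on (cball z r) (\<lambda>x. s * u x) (\<lambda>x. s *\<^sub>R G x) (\<lambda>x. s *\<^sub>R H x)"
        using twice_diff_on_subset[OF diff sub] twice_diff_on_uminus[OF twice_diff_on_subset[OF diff sub]] s1 by auto
      have "((s *\<^sub>R H z) *v e) \<bullet> e \<le> 2 * g0 / h0 + C * (q * h0 powr \<beta> + m * h0\<^sup>2 / r\<^sup>2)"
      proof (rule bound[OF r m q e diff' _ _ conc' h0])
        show "\<forall>y\<in>cball z r. \<bar>((s *\<^sub>R H y) *v e) \<bullet> e\<bar> \<le> m"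
        proof
          fix y assume "y \<in> cball z r"
          then have "\<bar>(H y *v e) \<bullet> e\<bar> \<le> m" using order_trans[OF quadratic_form_le_norm[OF e] Hm] by blast
          then show "\<bar>((s *\<^sub>R H y) *v e) \<bullet> e\<bar> \<le> m" unfolding sm using s1 by auto
        qed
        show "\<forall>y\<in>cball z r. norm (s *\<^sub>R G y) \<le> g0" using s1 G sub by auto
      qed
      then have "\<gamma> * norm (H z) \<le> 2 * g0 / h0 + C * (q * h0 powr \<beta> + m * h0\<^sup>2 / r\<^sup>2)"
        using top by (simp add: sm)
      then have "d * (\<gamma> * norm (H z)) \<le> d * (2 * g0 / h0 + C * (q * h0 powr \<beta> + m * h0\<^sup>2 / r\<^sup>2))"
        using d by (intro mult_left_mono) auto
      then have main: "\<gamma> * N \<le> d * (2 * g0 / h0) + C * (d * (q * h0 powr \<beta>)) + C * (d * (m * h0\<^sup>2 / r\<^sup>2))"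
        by (simp add: Nd distrib_left mult_ac)
      have t1: "d * (2 * g0 / h0) = 4 * g0 / \<theta>" using d \<theta> by (simp add: h0_def r_def)
      have t3: "C * (d * (m * h0\<^sup>2 / r\<^sup>2)) \<le> (\<gamma> * N) / 4"
      proof -
        have "d * (m * h0\<^sup>2 / r\<^sup>2) = 2 * N * \<theta>\<^sup>2" using d r by (simp add: m_def h0_def power_mult_distrib)
        also have "\<dots> \<le> 2 * N * (\<theta> * 1)" unfolding power2_eq_square using \<theta> False by (intro mult_left_mono) auto
        finally have "C * (d * (m * h0\<^sup>2 / r\<^sup>2)) \<le> C * (2 * N * (\<theta> * 1))" using C by (intro mult_left_mono) auto
        also have "\<dots> = 8 * (C * \<theta>) * (N / 4)" by simp
        also have "\<dots> \<le> \<gamma> * (N / 4)" using \<theta>(3) False by (intro mult_right_mono) auto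
        finally show ?thesis by simp
      qed
      have t2: "C * (d * (q * h0 powr \<beta>)) \<le> C * K * (1 + L) + (\<gamma> * N) / 4"
      proof -
        \<comment> \<open>Since m is 2 N / d and h0 is proportional to d, their product is free of
          d.\<close>
        have "(1 + m) * h0 \<le> 1 + N"
        proof -
          have "m * h0 = \<theta> * N" using d by (simp add: m_def h0_def r_def)
          also have "\<dots> \<le> 1 * N" using \<theta> False by (intro mult_right_mono) auto
          finally have "m * h0 \<le> N" by simp
          moreover have "h0 \<le> 1" using h0 d R0 by (simp add: r_def)
          ultimately show ?thesis by (simp add: distrib_right)
        qed
        then have le: "L * ((1 + m) * h0) \<le> L * (1 + N)" using L by (intro mult_left_mono) auto
        have "(L * (1 + m)) powr \<beta> * h0 powr \<beta> = (L * ((1 + m) * h0)) powr \<beta>"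
          using L m h0 by (simp flip: powr_mult add: mult.assoc)
        also have "\<dots> \<le> (L * (1 + N)) powr \<beta>" using L m h0 \<beta> le by (intro powr_mono2) auto
        also have "\<dots> \<le> 1 + L * (1 + N)" using L False \<beta> by (intro powr_le_one_plus) auto
        finally have qle: "q * h0 powr \<beta> \<le> K * (1 + L * (1 + N))"
          using K by (simp add: q_def mult.assoc mult_left_mono)
        have "d * (q * h0 powr \<beta>) \<le> R0 * (K * (1 + L * (1 + N)))"
          by (rule mult_mono[OF d(2) qle]) (use R0 q in auto)
        also have "\<dots> = R0 * (K * (1 + L)) + K * L * R0 * N" by (simp add: algebra_simps)
        also have "R0 * (K * (1 + L)) \<le> 1 * (K * (1 + L))" using R0 K L by (intro mult_right_mono) auto
        finally have "C * (d * (q * h0 powr \<beta>)) \<le> C * (1 * (K * (1 + L)) + K * L * R0 * N)"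
          using C by (intro mult_left_mono) auto
        also have "\<dots> = C * K * (1 + L) + C * K * L * R0 * N" by (simp add: distrib_left mult.assoc)
        also have "C * K * L * R0 * N \<le> (\<gamma> * N) / 4" using mult_right_mono[OF R0b, of N] False by simp
        finally show ?thesis by simp
      qed
      have "\<gamma> * N \<le> 2 * (4 * g0 / \<theta> + C * K * (1 + L))" by (rule absorb_quarters[OF main t1 t2 t3])
      then have "N \<le> 2 * (4 * g0 / \<theta> + C * K * (1 + L)) / \<gamma>"
        using \<gamma> by (simp add: pos_le_divide_eq mult.commute)
      then show ?thesis by (simp add: N0_def)
    qed (use N0 in simp)
    moreover have "R * norm (H x0) \<le> N" using max[OF x0] by (simp add: N_def)
    ultimately show "R * norm (H x0) \<le> N0" by simp
  qed
qed

section \<open>Smooth functions\<close>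

lemma Ck_on_has_derivative:
  assumes u: "Ck_on m S u" and S: "open S" "x \<in> S" and bs: "set bs \<subseteq> Basis" "length bs < m"
  shows "(partial_deriv bs u has_derivative frechet_derivative (partial_deriv bs u) (at x)) (at x)"
proof -
  have "bs \<in> directions m" using bs by (simp add: directions_def)
  then have "partial_deriv bs u differentiable_on S" using u bs by (simp add: Ck_on_def)
  then have "partial_deriv bs u differentiable (at x)"
    using S by (simp add: differentiable_on_eq_differentiable_at)
  then show ?thesis by (simp add: frechet_derivative_works)
qed

lemma Ck_on_continuous:
  assumes "Ck_on m S u" "set bs \<subseteq> Basis" "length bs \<le> m"
  shows "continuous_on S (partial_deriv bs u)"
  using assms by (simp add: Ck_on_def directions_def)

lemma linear_sum_Basis:
  fixes f :: "'a::euclidean_space \<Rightarrow> real"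
  assumes "linear f"
  shows "f h = (\<Sum>b\<in>Basis. (h \<bullet> b) * f b)"
proof -
  have "f h = f (\<Sum>b\<in>Basis. (h \<bullet> b) *\<^sub>R b)" by (simp add: euclidean_representation)
  also have "\<dots> = (\<Sum>b\<in>Basis. (h \<bullet> b) * f b)"
    using assms by (simp add: linear_sum linear_cmul)
  finally show ?thesis .
qed

lemma sum_Basis_vec:
  fixes f :: "real^'n \<Rightarrow> real"
  shows "(\<Sum>b\<in>Basis. f b) = (\<Sum>i\<in>UNIV. f (axis i 1))"
proof -
  have inj: "inj (\<lambda>i :: 'n. axis i (1 :: real))" by (auto simp: inj_def axis_eq_axis)
  have Basis: "(Basis :: (real^'n) set) = range (\<lambda>i. axis i 1)" by (auto simp: Basis_vec_def)
  show ?thesis unfolding Basis by (subst sum.reindex[OF inj]) (simp add: comp_def)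
qed

lemma axis_in_Basis: "axis i (1 :: real) \<in> Basis"
  by (auto simp: Basis_vec_def)

lemma Ck_on_has_derivative_vec:
  fixes u :: "real^'n \<Rightarrow> real"
  assumes u: "Ck_on m S u" and S: "open S" "x \<in> S" and bs: "set bs \<subseteq> Basis" "length bs < m"
  shows "(partial_deriv bs u has_derivative (\<lambda>h. \<Sum>i\<in>UNIV. h $ i * partial_deriv (axis i 1 # bs) u x)) (at x)"
proof -
  let ?D = "frechet_derivative (partial_deriv bs u) (at x)"
  note d = Ck_on_has_derivative[OF assms]
  have "?D h = (\<Sum>i\<in>UNIV. h $ i * partial_deriv (axis i 1 # bs) u x)" for h
    using linear_sum_Basis[OF has_derivative_linear[OF d], of h] by (simp add: sum_Basis_vec inner_axis)
  then have "?D = (\<lambda>h. \<Sum>i\<in>UNIV. h $ i * partial_deriv (axis i 1 # bs) u x)" by blast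
  then show ?thesis using d by simp
qed

lemma Ck_on_line:
  fixes u :: "real^'n \<Rightarrow> real"
  assumes "Ck_on m S u" "open S" "y + t *\<^sub>R axis i 1 \<in> S" "set bs \<subseteq> Basis" "length bs < m"
  shows "((\<lambda>t. partial_deriv bs u (y + t *\<^sub>R axis i 1)) has_real_derivative
           partial_deriv (axis i 1 # bs) u (y + t *\<^sub>R axis i 1)) (at t)"
proof -
  have "((\<lambda>t. y + t *\<^sub>R axis i 1) has_derivative (\<lambda>s. s *\<^sub>R axis i 1)) (at t)"
    by (rule derivative_eq_intros refl | simp)+
  from has_derivative_compose[OF this Ck_on_has_derivative_vec[OF assms]]
  show ?thesis
    by (simp add: has_field_derivative_def mult_commute_abs axis_def if_distrib[of "\<lambda>x. _ * x"] if_distrib[of "\<lambda>x. x * _"] cong: if_cong)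
qed

section \<open>Symmetry of second derivatives\<close>

lemma mixed_difference:
  fixes u :: "real^'n \<Rightarrow> real"
  assumes u: "Ck_on 2 S u" and S: "open S" and h: "0 < h"
    and sub: "\<And>s t. 0 \<le> s \<Longrightarrow> s \<le> h \<Longrightarrow> 0 \<le> t \<Longrightarrow> t \<le> h \<Longrightarrow> x + s *\<^sub>R axis i 1 + t *\<^sub>R axis j 1 \<in> S"
  shows "\<exists>s t. 0 \<le> s \<and> s \<le> h \<and> 0 \<le> t \<and> t \<le> h \<and>
    u (x + h *\<^sub>R axis i 1 + h *\<^sub>R axis j 1) - u (x + h *\<^sub>R axis i 1) - (u (x + h *\<^sub>R axis j 1) - u x)
      = h * h * partial_deriv [axis j 1, axis i 1] u (x + s *\<^sub>R axis i 1 + t *\<^sub>R axis j 1)"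
proof -
  let ?a = "axis i (1 :: real) :: real^'n" and ?b = "axis j (1 :: real) :: real^'n"
  define \<psi> where "\<psi> = (\<lambda>s. u ((x + h *\<^sub>R ?b) + s *\<^sub>R ?a) - u (x + s *\<^sub>R ?a))"
  have in1: "(x + h *\<^sub>R ?b) + s *\<^sub>R ?a \<in> S" "x + s *\<^sub>R ?a \<in> S" if "0 \<le> s" "s \<le> h" for s
    using sub[of s h] sub[of s 0] that h by (simp_all add: add.commute add.left_commute)
  have l1: "((\<lambda>t. u (y + t *\<^sub>R ?a)) has_real_derivative partial_deriv [?a] u (y + s *\<^sub>R ?a)) (at s)"
    if "y + s *\<^sub>R ?a \<in> S" for y s
    using Ck_on_line[OF u S that, of "[]"] by simp
  have d: "(\<psi> has_real_derivative (partial_deriv [?a] u ((x + h *\<^sub>R ?b) + s *\<^sub>R ?a) - partial_deriv [?a] u (x + s *\<^sub>R ?a))) (at s)"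
    if "0 \<le> s" "s \<le> h" for s
    unfolding \<psi>_def by (intro DERIV_diff l1 in1 that)
  obtain s where s: "0 < s" "s < h"
    "\<psi> h - \<psi> 0 = (h - 0) * (partial_deriv [?a] u ((x + h *\<^sub>R ?b) + s *\<^sub>R ?a) - partial_deriv [?a] u (x + s *\<^sub>R ?a))"
    using MVT2[OF h d] by blast
  have l2: "((\<lambda>t. partial_deriv [?a] u ((x + s *\<^sub>R ?a) + t *\<^sub>R ?b)) has_real_derivative
      partial_deriv [?b, ?a] u ((x + s *\<^sub>R ?a) + t *\<^sub>R ?b)) (at t)" if "0 \<le> t" "t \<le> h" for t
    by (rule Ck_on_line[OF u S]) (use sub[of s t] that s in \<open>auto simp: axis_in_Basis\<close>)
  obtain t where t: "0 < t" "t < h"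
    "partial_deriv [?a] u ((x + s *\<^sub>R ?a) + h *\<^sub>R ?b) - partial_deriv [?a] u ((x + s *\<^sub>R ?a) + 0 *\<^sub>R ?b)
      = (h - 0) * partial_deriv [?b, ?a] u ((x + s *\<^sub>R ?a) + t *\<^sub>R ?b)"
    using MVT2[OF h l2] by blast
  have eq: "(x + s *\<^sub>R ?a) + h *\<^sub>R ?b = (x + h *\<^sub>R ?b) + s *\<^sub>R ?a" by (simp add: add_ac)
  have "\<psi> h - \<psi> 0 = h * h * partial_deriv [?b, ?a] u ((x + s *\<^sub>R ?a) + t *\<^sub>R ?b)"
    using s(3) t(3) unfolding eq by (simp only: diff_zero scaleR_zero_left add_0_right mult.assoc)
  moreover have "\<psi> h - \<psi> 0 = u (x + h *\<^sub>R ?a + h *\<^sub>R ?b) - u (x + h *\<^sub>R ?a) - (u (x + h *\<^sub>R ?b) - u x)"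
    by (simp add: \<psi>_def add_ac)
  ultimately show ?thesis using s t by (intro exI[of _ s] exI[of _ t]) auto
qed

text \<open>The mixed difference is symmetric in the two directions and equals h^2 times either
  mixed derivative at nearby points; continuity then identifies the two derivatives.\<close>

lemma partial_deriv_commute:
  fixes u :: "real^'n \<Rightarrow> real"
  assumes u: "Ck_on 2 S u" and S: "open S" "x \<in> S"
  shows "partial_deriv [axis i 1, axis j 1] u x = partial_deriv [axis j 1, axis i 1] u x"
proof (rule ccontr)
  assume ne: "\<not> ?thesis"
  let ?a = "axis i (1 :: real) :: real^'n" and ?b = "axis j (1 :: real) :: real^'n"
  let ?p = "partial_deriv [?a, ?b] u" and ?q = "partial_deriv [?b, ?a] u"
  define \<epsilon> where "\<epsilon> = \<bar>?p x - ?q x\<bar> / 2"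
  have \<epsilon>: "\<epsilon> > 0" using ne by (simp add: \<epsilon>_def)
  have near: "\<exists>\<delta>>0. \<forall>y\<in>S. dist y x < \<delta> \<longrightarrow> dist (partial_deriv bs u y) (partial_deriv bs u x) < \<epsilon>"
    if "set bs \<subseteq> Basis" "length bs \<le> 2" for bs
    using Ck_on_continuous[OF u that] S(2) \<epsilon> unfolding continuous_on_iff by blast
  obtain \<delta>1 where \<delta>1: "\<delta>1 > 0" "\<And>y. y \<in> S \<Longrightarrow> dist y x < \<delta>1 \<Longrightarrow> dist (?p y) (?p x) < \<epsilon>"
    using near[of "[?a, ?b]"] by (auto simp: axis_in_Basis)
  obtain \<delta>2 where \<delta>2: "\<delta>2 > 0" "\<And>y. y \<in> S \<Longrightarrow> dist y x < \<delta>2 \<Longrightarrow> dist (?q y) (?q x) < \<epsilon>"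
    using near[of "[?b, ?a]"] by (auto simp: axis_in_Basis)
  obtain \<delta>3 where \<delta>3: "\<delta>3 > 0" "ball x \<delta>3 \<subseteq> S" using S by (meson openE)
  define h where "h = min \<delta>1 (min \<delta>2 \<delta>3) / 3"
  have h: "0 < h" "3 * h \<le> \<delta>1" "3 * h \<le> \<delta>2" "3 * h \<le> \<delta>3" using \<delta>1(1) \<delta>2(1) \<delta>3(1) by (auto simp: h_def)
  have dist: "dist (x + s *\<^sub>R axis k 1 + t *\<^sub>R axis l 1) x < 3 * h"
    if "0 \<le> s" "s \<le> h" "0 \<le> t" "t \<le> h" for s t and k l :: 'n
  proof -
    have "norm (s *\<^sub>R axis k (1 :: real) + t *\<^sub>R axis l 1) \<le> norm (s *\<^sub>R axis k (1 :: real)) + norm (t *\<^sub>R axis l (1 :: real))"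
      by (rule norm_triangle_ineq)
    also have "\<dots> < 3 * h" using that h by simp
    finally show ?thesis by (simp add: dist_norm add.assoc)
  qed
  have inS: "x + s *\<^sub>R axis k 1 + t *\<^sub>R axis l 1 \<in> S"
    if "0 \<le> s" "s \<le> h" "0 \<le> t" "t \<le> h" for s t and k l :: 'n
    using dist[OF that, of k l] h \<delta>3(2) by (auto simp: subset_iff dist_commute)
  obtain s t where st: "0 \<le> s" "s \<le> h" "0 \<le> t" "t \<le> h"
    "u (x + h *\<^sub>R ?a + h *\<^sub>R ?b) - u (x + h *\<^sub>R ?a) - (u (x + h *\<^sub>R ?b) - u x) = h * h * ?q (x + s *\<^sub>R ?a + t *\<^sub>R ?b)"
    using mixed_difference[OF u S(1) h(1) inS, of i j] by blast
  obtain s' t' where st': "0 \<le> s'" "s' \<le> h" "0 \<le> t'" "t' \<le> h"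
    "u (x + h *\<^sub>R ?b + h *\<^sub>R ?a) - u (x + h *\<^sub>R ?b) - (u (x + h *\<^sub>R ?a) - u x) = h * h * ?p (x + s' *\<^sub>R ?b + t' *\<^sub>R ?a)"
    using mixed_difference[OF u S(1) h(1) inS, of j i] by blast
  have eq: "x + h *\<^sub>R ?b + h *\<^sub>R ?a = x + h *\<^sub>R ?a + h *\<^sub>R ?b" by (simp add: add_ac)
  have "h * h * ?q (x + s *\<^sub>R ?a + t *\<^sub>R ?b) = h * h * ?p (x + s' *\<^sub>R ?b + t' *\<^sub>R ?a)"
    unfolding st(5)[symmetric] st'(5)[symmetric] eq by simp
  then have "?q (x + s *\<^sub>R ?a + t *\<^sub>R ?b) = ?p (x + s' *\<^sub>R ?b + t' *\<^sub>R ?a)" using h by simp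
  moreover have "dist (?q (x + s *\<^sub>R ?a + t *\<^sub>R ?b)) (?q x) < \<epsilon>"
    using dist[OF st(1-4), of i j] h by (intro \<delta>2(2) inS st) auto
  moreover have "dist (?p (x + s' *\<^sub>R ?b + t' *\<^sub>R ?a)) (?p x) < \<epsilon>"
    using dist[OF st'(1-4), of j i] h by (intro \<delta>1(2) inS st') auto
  ultimately have "\<bar>?p x - ?q x\<bar> < 2 * \<epsilon>" by (simp add: dist_real_def abs_less_iff)
  then show False by (simp add: \<epsilon>_def)
qed

lemma Ck_on_mono: "Ck_on m S u \<Longrightarrow> l \<le> m \<Longrightarrow> Ck_on l S u"
  unfolding Ck_on_def directions_def by fastforce

lemma has_derivative_vecI:
  fixes f :: "'a::real_normed_vector \<Rightarrow> real^'n"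
  assumes "\<And>j. ((\<lambda>x. f x $ j) has_derivative (\<lambda>h. f' h $ j)) (at x)"
  shows "(f has_derivative f') (at x)"
  unfolding has_derivative_componentwise_within[of f f' x UNIV]
  using assms by (auto simp: Basis_vec_def inner_axis)

lemma Ck_on_twice_diff_on:
  fixes u :: "real^'n \<Rightarrow> real"
  assumes u: "Ck_on 3 S u" and S: "open S"
  shows "twice_diff_on S u (gradient u) (hessian u)"
  unfolding twice_diff_on_def
proof (intro ballI conjI)
  fix x assume x: "x \<in> S"
  have u2: "Ck_on 2 S u" by (rule Ck_on_mono[OF u]) simp
  show sym: "transpose (hessian u x) = hessian u x"
    using partial_deriv_commute[OF u2 S x] by (simp add: transpose_def hessian_def vec_eq_iff)
  show "(u has_derivative (\<lambda>h. gradient u x \<bullet> h)) (at x)"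
    using Ck_on_has_derivative_vec[OF u S x, of "[]"] by (simp add: gradient_def inner_vec_def mult.commute)
  show "(gradient u has_derivative (\<lambda>h. hessian u x *v h)) (at x)"
  proof (rule has_derivative_vecI)
    fix j
    have "(hessian u x *v h) $ j = (\<Sum>i\<in>UNIV. h $ i * partial_deriv [axis i 1, axis j 1] u x)" for h
      using partial_deriv_commute[OF u2 S x] by (simp add: matrix_vector_mult_def hessian_def mult.commute)
    then show "((\<lambda>x. gradient u x $ j) has_derivative (\<lambda>h. (hessian u x *v h) $ j)) (at x)"
      using Ck_on_has_derivative_vec[OF u S x, of "[axis j 1]"] by (simp add: gradient_def axis_in_Basis)
  qed
qed

lemma continuous_on_hessian:
  fixes u :: "real^'n \<Rightarrow> real"
  assumes "Ck_on 2 S u"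
  shows "continuous_on S (hessian u)"
  unfolding hessian_def[abs_def]
  by (intro continuous_on_vec_lambda Ck_on_continuous[OF assms]) (auto simp: axis_in_Basis)

section \<open>The structure of the equation\<close>

lemma sigma_esf: "sigma k lam = esf k UNIV (\<lambda>i. lam $ i)"
  by (simp add: sigma_def esf_def)

lemma eta_permuted:
  fixes lam :: "real^'n"
  assumes "\<pi> permutes UNIV" "\<And>i. lam $ i = d (\<pi> i)"
  shows "sigma k (eta lam) = esf k UNIV (\<lambda>i. sum d UNIV - d i)"
proof -
  have "(\<Sum>j\<in>UNIV - {i}. lam $ j) = sum d UNIV - d (\<pi> i)" for i
  proof -
    have "(\<Sum>j\<in>UNIV. lam $ j) = sum d UNIV"
      using sum.permute[OF assms(1), of d] assms(2) by (simp add: comp_def)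
    then show ?thesis by (simp add: sum_diff1 assms(2))
  qed
  then have "sigma k (eta lam) = esf k UNIV (\<lambda>i. sum d UNIV - d (\<pi> i))"
    by (simp add: sigma_esf eta_def)
  also have "\<dots> = esf k UNIV (\<lambda>i. sum d UNIV - d i)"
    by (rule esf_permutes[OF assms(1)])
  finally show ?thesis .
qed

text \<open>An eigenframe of the Hessian also diagonalizes the matrix whose eigenvalues form \<eta>,
  so the unspecified order in \<open>eta_at\<close> disappears under the symmetric function.\<close>

lemma sigma_eta_at:
  fixes u :: "real^'n \<Rightarrow> real"
  assumes "eigenframe (hessian u x) e d"
  shows "sigma k (eta_at u x) = esf k UNIV (\<lambda>i. sum d UNIV - d i)"
proof -
  have e: "orthonormal_frame e" using assms by (simp add: eigenframe_def)
  have "laplacian u x = (\<Sum>i\<in>UNIV. (hessian u x *v e i) \<bullet> e i)"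
    by (simp add: laplacian_def trace_orthonormal_frame[OF e])
  also have "\<dots> = sum d UNIV" using assms by (simp add: eigenframe_def orthonormal_frame_def)
  finally have "eigenframe (mat (laplacian u x) - hessian u x) e (\<lambda>i. sum d UNIV - d i)"
    using assms by (simp add: eigenframe_def matrix_vector_mult_diff_rdistrib mat_mult_vec scaleR_left_diff_distrib)
  then obtain \<pi> where \<pi>: "\<pi> permutes UNIV" "\<And>i. eta_at u x $ i = sum d UNIV - d (\<pi> i)"
    unfolding eta_at_def by (rule eigenvalues_eigenframe) blast
  have "(\<lambda>i. eta_at u x $ i) = (\<lambda>i. sum d UNIV - d (\<pi> i))" using \<pi>(2) by blast
  then show ?thesis
    unfolding sigma_esf using esf_permutes[OF \<pi>(1), of k "\<lambda>i. sum d UNIV - d i"] by simp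
qed

lemma equation_as_esf:
  fixes u :: "real^'n \<Rightarrow> real"
  assumes "eigenframe (hessian u x) e d"
  shows "sigma (Suc k) (eta_at u x) + \<alpha> * sigma k (eta_at u x) = esf (Suc k) UNIV (hat \<alpha> d)"
  by (simp add: sigma_eta_at[OF assms] esf_option)

text \<open>Admissibility covers the orders up to k, and appending \<alpha> >= 0 preserves their
  positivity. The remaining order \<open>Suc k\<close> is the left-hand side of the equation,
  positive by assumption.\<close>

lemma admissible_esf_cone:
  fixes u :: "real^'n \<Rightarrow> real"
  assumes adm: "admissible k \<Omega> u" and x: "x \<in> \<Omega>" and frame: "eigenframe (hessian u x) e d"
    and \<alpha>: "0 \<le> \<alpha>" and pos: "0 < sigma (Suc k) (eta_at u x) + \<alpha> * sigma k (eta_at u x)"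
  shows "hat \<alpha> d \<in> esf_cone (Suc k) UNIV"
proof -
  obtain \<pi> where \<pi>: "\<pi> permutes UNIV" "\<And>i. eigenvalues (hessian u x) $ i = d (\<pi> i)"
    by (rule eigenvalues_eigenframe[OF frame]) blast
  let ?h = "\<lambda>i. sum d UNIV - d i"
  have p: "0 < esf j UNIV ?h" if "j \<le> k" for j
  proof (cases "j = 0")
    case False
    have "eigenvalues (hessian u x) \<in> Gamma' k" using adm x by (simp add: admissible_def)
    then have "0 < sigma j (eta (eigenvalues (hessian u x)))" using False that by (simp add: Gamma'_def)
    then show ?thesis using eta_permuted[OF \<pi>] by simp
  qed simp
  have "0 < esf j UNIV (hat \<alpha> d)" if "j \<le> k" for j
  proof (cases j)
    case (Suc i)
    then have "0 < esf (Suc i) UNIV ?h" "0 < esf i UNIV ?h" using p that by auto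
    then show ?thesis using \<alpha> by (simp add: Suc esf_option add_pos_nonneg)
  qed simp
  moreover have "0 < esf (Suc k) UNIV (hat \<alpha> d)" using pos by (simp add: equation_as_esf[OF frame])
  ultimately show ?thesis by (auto simp: esf_cone_def le_Suc_eq)
qed

section \<open>Matrix norm and eigenvalues\<close>

lemma norm_le_eigenvalue_bound:
  fixes A :: "real^'n^'n" and \<mu> :: real
  assumes frame: "eigenframe A e d" and sym: "transpose A = A" and \<mu>: "0 \<le> \<mu>" "\<And>i. \<bar>d i\<bar> \<le> \<mu>"
  shows "norm A \<le> CARD('n) * \<mu>"
proof -
  have e: "orthonormal_frame e" and Ae: "\<And>i. A *v e i = d i *\<^sub>R e i" using frame by (auto simp: eigenframe_def)
  have bound: "norm (A *v x) \<le> \<mu> * norm x" for x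
  proof (rule power2_le_imp_le)
    have inn: "(A *v x) \<bullet> e i = d i * (x \<bullet> e i)" for i
      using symmetric_matrix_inner[OF sym, of x "e i"] by (simp add: Ae inner_commute)
    have "(norm (A *v x))\<^sup>2 = (\<Sum>i\<in>UNIV. (d i)\<^sup>2 * (x \<bullet> e i)\<^sup>2)"
      using orthonormal_frame_inner[OF e, of "A *v x" "A *v x"]
      by (simp add: inn power2_norm_eq_inner) (simp add: power2_eq_square mult_ac)
    also have "\<dots> \<le> (\<Sum>i\<in>UNIV. \<mu>\<^sup>2 * (x \<bullet> e i)\<^sup>2)"
      using \<mu> by (intro sum_mono mult_right_mono) (auto simp: abs_le_square_iff[symmetric])
    also have "\<dots> = (\<mu> * norm x)\<^sup>2"
      using orthonormal_frame_inner[OF e, of x x]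
      by (simp add: sum_distrib_left[symmetric] power_mult_distrib power2_norm_eq_inner) (simp add: power2_eq_square)
    finally show "(norm (A *v x))\<^sup>2 \<le> (\<mu> * norm x)\<^sup>2" .
  qed (use \<mu> in simp)
  have "norm A \<le> (\<Sum>i\<in>UNIV. norm (A $ i))"
    by (simp add: norm_vec_def[of A] L2_set_le_sum)
  also have "\<dots> \<le> (\<Sum>i\<in>(UNIV :: 'n set). \<mu>)"
  proof (rule sum_mono)
    fix i
    have "A $ i = A *v axis i 1"
      using sym by (simp add: vec_eq_iff transpose_def matrix_vector_mult_basis column_def)
    then show "norm (A $ i) \<le> \<mu>" using bound[of "axis i 1"] by simp
  qed
  finally show ?thesis by simp
qed

lemma eigenvalue_ge_norm:
  fixes A :: "real^'n^'n"
  assumes frame: "eigenframe A e d" and sym: "transpose A = A"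
  obtains i where "norm A / CARD('n) \<le> \<bar>d i\<bar>"
proof -
  have fin: "finite (range (\<lambda>i. \<bar>d i\<bar>))" "range (\<lambda>i. \<bar>d i\<bar>) \<noteq> {}" by auto
  define \<mu> where "\<mu> = Max (range (\<lambda>i. \<bar>d i\<bar>))"
  have "\<mu> \<in> range (\<lambda>i. \<bar>d i\<bar>)" unfolding \<mu>_def by (rule Max_in[OF fin])
  then obtain i where i: "\<mu> = \<bar>d i\<bar>" by blast
  have "\<bar>d j\<bar> \<le> \<mu>" for j unfolding \<mu>_def using fin(1) by (intro Max_ge) auto
  then have "norm A \<le> CARD('n) * \<mu>" using norm_le_eigenvalue_bound[OF frame sym, of \<mu>] i by simp
  then show ?thesis using that[of i] i by (simp add: divide_le_eq mult.commute)
qed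

text \<open>If an eigenvalue of large modulus is negative, the others must compensate for it in the
  trace, so one of them is at least the n-th part of its modulus. The other factor n comes from
  comparing the norm with the eigenvalues.\<close>

lemma positive_eigenvalue_ge_norm:
  fixes A :: "real^'n^'n"
  assumes frame: "eigenframe A e d" and sym: "transpose A = A" and tr: "0 \<le> sum d UNIV"
  obtains i where "norm A / (real CARD('n))\<^sup>2 \<le> d i"
proof -
  let ?n = "real CARD('n)"
  have n: "1 \<le> ?n" by (simp add: Suc_leI)
  obtain i where i: "norm A / ?n \<le> \<bar>d i\<bar>" by (rule eigenvalue_ge_norm[OF frame sym])
  have le: "norm A / ?n\<^sup>2 \<le> \<bar>d i\<bar> / ?n" using divide_right_mono[OF i, of ?n] by (simp add: power2_eq_square)
  have le1: "\<bar>d i\<bar> / ?n \<le> \<bar>d i\<bar>" using mult_left_mono[OF n abs_ge_zero[of "d i"]] by (simp add: divide_le_eq)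
  show ?thesis
  proof (cases "0 \<le> d i")
    case True
    then show ?thesis using that[of i] le le1 by simp
  next
    case False
    have "\<exists>j. \<bar>d i\<bar> / ?n \<le> d j"
    proof (rule ccontr)
      assume "\<not> ?thesis"
      then have lt: "d j < \<bar>d i\<bar> / ?n" for j by (simp add: not_le)
      have "sum d UNIV = d i + (\<Sum>j\<in>UNIV - {i}. d j)" by (simp add: sum.remove[of _ i])
      also have "(\<Sum>j\<in>UNIV - {i}. d j) \<le> (\<Sum>j\<in>UNIV - {i}. \<bar>d i\<bar> / ?n)"
        using lt by (intro sum_mono) (auto intro: less_imp_le)
      also have "\<dots> = (?n - 1) * (\<bar>d i\<bar> / ?n)" by (simp add: card_Diff_singleton of_nat_diff Suc_leI)
      also have "\<dots> = \<bar>d i\<bar> - \<bar>d i\<bar> / ?n" using n by (simp add: field_simps)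
      finally have "\<bar>d i\<bar> / ?n \<le> 0" using tr False by simp
      moreover have "0 < \<bar>d i\<bar> / ?n" using False n by (intro divide_pos_pos) auto
      ultimately show False by simp
    qed
    then show ?thesis using that le order_trans by blast
  qed
qed

section \<open>The estimate\<close>

lemma finite_directions: "finite (directions m :: 'a::euclidean_space list set)"
  using finite_lists_length_le[OF finite_Basis, of m] by (simp add: directions_def)

section \<open>Consequences of the norms of u and f\<close>

lemma bdd_above_continuous_extension:
  fixes g :: "'a::t2_space \<Rightarrow> real"
  assumes "compact K" "K \<subseteq> T" "continuous_on T g" "S \<subseteq> K" "\<And>x. x \<in> S \<Longrightarrow> g x = f x"
  shows "bdd_above ((\<lambda>x. \<bar>f x\<bar>) ` S)"
proof -
  have "compact (g ` K)" using assms by (intro compact_continuous_image continuous_on_subset[OF assms(3)])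
  then obtain B where "\<And>y. y \<in> g ` K \<Longrightarrow> norm y \<le> B"
    using compact_imp_bounded bounded_iff by metis
  then show ?thesis using assms(4,5) by (intro bdd_aboveI2[of _ _ B]) force
qed

lemma Ck_norm_ge:
  fixes u :: "'a::euclidean_space \<Rightarrow> real"
  assumes bdd: "\<And>bs. bs \<in> directions m \<Longrightarrow> bdd_above ((\<lambda>x. \<bar>partial_deriv bs u x\<bar>) ` S)"
    and x: "x \<in> S" and A: "A \<subseteq> directions m"
  shows "(\<Sum>bs\<in>A. \<bar>partial_deriv bs u x\<bar>) \<le> Ck_norm m S u"
proof -
  have le: "\<bar>partial_deriv bs u x\<bar> \<le> (SUP x\<in>S. \<bar>partial_deriv bs u x\<bar>)" if "bs \<in> directions m" for bs
    by (rule cSUP_upper[OF x bdd[OF that]])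
  have "(\<Sum>bs\<in>A. \<bar>partial_deriv bs u x\<bar>) \<le> (\<Sum>bs\<in>A. SUP x\<in>S. \<bar>partial_deriv bs u x\<bar>)"
    using le A by (intro sum_mono) auto
  also have "\<dots> \<le> Ck_norm m S u"
    unfolding Ck_norm_def
    using A order_trans[OF abs_ge_zero le] by (intro sum_mono2 finite_directions) auto
  finally show ?thesis .
qed

lemma Ck_norm_ge_first_order:
  fixes u :: "'a::euclidean_space \<Rightarrow> real"
  assumes bdd: "\<And>bs. bs \<in> directions m \<Longrightarrow> bdd_above ((\<lambda>x. \<bar>partial_deriv bs u x\<bar>) ` S)"
    and x: "x \<in> S" and m: "1 \<le> m"
  shows "\<bar>u x\<bar> + (\<Sum>b\<in>Basis. \<bar>partial_deriv [b] u x\<bar>) \<le> Ck_norm m S u"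
proof -
  let ?A = "insert [] ((\<lambda>b. [b]) ` Basis)"
  have "?A \<subseteq> directions m" using m by (auto simp: directions_def)
  then have "(\<Sum>bs\<in>?A. \<bar>partial_deriv bs u x\<bar>) \<le> Ck_norm m S u"
    using Ck_norm_ge[OF bdd x] by blast
  moreover have "(\<Sum>bs\<in>?A. \<bar>partial_deriv bs u x\<bar>) = \<bar>u x\<bar> + (\<Sum>b\<in>Basis. \<bar>partial_deriv [b] u x\<bar>)"
    by (subst sum.insert) (auto simp: sum.reindex inj_on_def)
  ultimately show ?thesis by simp
qed

text \<open>The suprema in \<open>Ck_norm\<close> are informative only for bounded derivatives;
  boundedness comes from the continuous extension to the compact closure.\<close>

lemma Ck_closure_bdd:
  assumes "Ck_closure m \<Omega> u" "bounded \<Omega>" "bs \<in> directions l" "l \<le> m"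
  shows "bdd_above ((\<lambda>x. \<bar>partial_deriv bs u x\<bar>) ` \<Omega>)"
proof -
  have "bs \<in> directions m" using assms by (auto simp: directions_def)
  then obtain g where "continuous_on (closure \<Omega>) g" "\<forall>x\<in>\<Omega>. g x = partial_deriv bs u x"
    using assms(1) by (auto simp: Ck_closure_def)
  then show ?thesis
    using assms(2) closure_subset[of \<Omega>]
    by (intro bdd_above_continuous_extension[of "closure \<Omega>" "closure \<Omega>" g]) auto
qed

lemma Ck_closure_bdd_data:
  fixes f :: "(real^'n) \<times> real \<times> (real^'n) \<Rightarrow> real"
  assumes "Ck_closure 2 (\<Omega> \<times> UNIV \<times> UNIV) f" "bounded \<Omega>" "bs \<in> directions 2"
  shows "bdd_above ((\<lambda>x. \<bar>partial_deriv bs f x\<bar>) ` (\<Omega> \<times> {-R..R} \<times> cball 0 R))"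
proof -
  obtain g where g: "continuous_on (closure (\<Omega> \<times> UNIV \<times> UNIV)) g"
    "\<forall>x\<in>\<Omega> \<times> UNIV \<times> UNIV. g x = partial_deriv bs f x"
    using assms(1,3) by (auto simp: Ck_closure_def)
  have "compact (closure \<Omega> \<times> {-R..R} \<times> cball (0 :: real^'n) R)"
    using assms(2) by (intro compact_Times) auto
  then show ?thesis
    using g closure_subset[of \<Omega>] by (intro bdd_above_continuous_extension[of "closure \<Omega> \<times> {-R..R} \<times> cball 0 R" _ g])
      (auto simp: closure_Times)
qed

lemma Lipschitz_on_convex:
  fixes f :: "'a::euclidean_space \<Rightarrow> real"
  assumes f: "Ck_on m S f" and m: "1 \<le> m" and S: "open S" and D: "D \<subseteq> S" "convex D"
    and L: "\<And>x. x \<in> D \<Longrightarrow> (\<Sum>b\<in>Basis. \<bar>partial_deriv [b] f x\<bar>) \<le> L"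
    and xy: "x \<in> D" "y \<in> D"
  shows "\<bar>f x - f y\<bar> \<le> L * norm (x - y)"
proof -
  have d: "(f has_derivative frechet_derivative f (at z)) (at z within D)" if "z \<in> D" for z
    using Ck_on_has_derivative[OF f S, of z "[]"] that D m by (auto intro: has_derivative_at_withinI)
  have "onorm (frechet_derivative f (at z)) \<le> L" if z: "z \<in> D" for z
  proof (rule onorm_le)
    fix h
    have lin: "linear (frechet_derivative f (at z))" using d[OF z] by (rule has_derivative_linear)
    have "norm (frechet_derivative f (at z) h) = \<bar>\<Sum>b\<in>Basis. (h \<bullet> b) * partial_deriv [b] f z\<bar>"
      using linear_sum_Basis[OF lin, of h] by simp
    also have "\<dots> \<le> (\<Sum>b\<in>Basis. norm h * \<bar>partial_deriv [b] f z\<bar>)"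
    proof (rule order_trans[OF sum_abs sum_mono])
      fix b :: 'a assume "b \<in> Basis"
      then have "\<bar>h \<bullet> b\<bar> \<le> norm h" by (rule Basis_le_norm)
      then show "\<bar>(h \<bullet> b) * partial_deriv [b] f z\<bar> \<le> norm h * \<bar>partial_deriv [b] f z\<bar>"
        unfolding abs_mult by (rule mult_right_mono) simp
    qed
    also have "\<dots> = (\<Sum>b\<in>Basis. \<bar>partial_deriv [b] f z\<bar>) * norm h"
      by (simp only: sum_distrib_left[symmetric] mult.commute)
    also have "\<dots> \<le> L * norm h" by (intro mult_right_mono L z) simp
    finally show "norm (frechet_derivative f (at z) h) \<le> L * norm h" .
  qed
  from differentiable_bound[OF D(2) d this xy] show ?thesis by simp
qed

lemma norm_triple_le: "norm (a, b, c) \<le> norm a + norm b + norm c"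
  using norm_Pair_le[of a "(b, c)"] norm_Pair_le[of b c] by linarith

text \<open>Let w be a nearest point of the complement. The segment from x to w stays in the domain
  up to its end point, where u vanishes, so the mean value theorem gives |u x| <= g |x - w| and
  hence R < |x - w|.\<close>

lemma ball_in_domain:
  fixes u :: "real^'n \<Rightarrow> real"
  assumes \<Omega>: "open \<Omega>" "bounded \<Omega>" and x: "x \<in> \<Omega>" and cont: "continuous_on (closure \<Omega>) u"
    and diff: "\<And>y. y \<in> \<Omega> \<Longrightarrow> (u has_derivative (\<lambda>h. G y \<bullet> h)) (at y)"
    and G: "\<And>y. y \<in> \<Omega> \<Longrightarrow> norm (G y) \<le> g" and zero: "\<And>y. y \<in> frontier \<Omega> \<Longrightarrow> u y = 0"
    and R: "g * R < \<bar>u x\<bar>" "0 < R"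
  shows "cball x R \<subseteq> \<Omega>"
proof -
  have "- \<Omega> \<noteq> {}" using \<Omega>(2) not_bounded_UNIV by (metis Compl_empty_eq double_compl)
  moreover have "closed (- \<Omega>)" by (rule closed_Compl[OF \<Omega>(1)])
  ultimately obtain w where w: "w \<in> - \<Omega>" "infdist x (- \<Omega>) = dist x w"
    using infdist_attains_inf by blast
  have inball: "y \<in> \<Omega>" if "dist x y < dist x w" for y
    using infdist_le[of y "- \<Omega>" x] that w by force
  have seg: "x + t *\<^sub>R (w - x) \<in> \<Omega>" if "0 \<le> t" "t < 1" for t
  proof (rule inball)
    have "x \<noteq> w" using x w by auto
    then show "dist x (x + t *\<^sub>R (w - x)) < dist x w"
      using that by (simp add: dist_norm norm_minus_commute mult_less_cancel_right1)
  qed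
  have wcl: "x + t *\<^sub>R (w - x) \<in> closure \<Omega>" if "0 \<le> t" "t \<le> 1" for t
  proof (cases "t < 1")
    case True
    then show ?thesis using seg[OF that(1)] closure_subset by blast
  next
    case False
    have "(\<lambda>n. x + (1 - inverse (real (Suc n))) *\<^sub>R (w - x)) \<longlonglongrightarrow> x + (1 - 0) *\<^sub>R (w - x)"
      by (intro tendsto_intros LIMSEQ_inverse_real_of_nat)
    moreover have "x + (1 - inverse (real (Suc n))) *\<^sub>R (w - x) \<in> \<Omega>" for n
      by (rule seg) (auto simp: field_simps)
    ultimately have "x + (1 - 0) *\<^sub>R (w - x) \<in> closure \<Omega>"
      unfolding closure_sequential
      by (intro exI[of _ "\<lambda>n. x + (1 - inverse (real (Suc n))) *\<^sub>R (w - x)"]) blast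
    moreover have "t = 1" using False that by simp
    ultimately show ?thesis by simp
  qed
  have "w \<in> frontier \<Omega>"
    using wcl[of 1] w(1) \<Omega>(1) by (simp add: frontier_def interior_open)
  then have uw: "u w = 0" by (rule zero)
  define \<psi> where "\<psi> = (\<lambda>t. u (x + t *\<^sub>R (w - x)))"
  \<comment> \<open>The derivative is available only before the end point w, so the mean value
    theorem relies here on continuity of u up to the boundary.\<close>
  have c: "continuous_on {0..1} \<psi>"
    unfolding \<psi>_def using wcl by (intro continuous_on_compose2[OF cont]) (auto intro!: continuous_intros)
  have d: "(\<psi> has_derivative (\<lambda>s. G (x + t *\<^sub>R (w - x)) \<bullet> (s *\<^sub>R (w - x)))) (at t)" if "0 < t" "t < 1" for t
  proof -
    have "((\<lambda>t. x + t *\<^sub>R (w - x)) has_derivative (\<lambda>s. s *\<^sub>R (w - x))) (at t)"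
      by (rule derivative_eq_intros refl | simp)+
    from has_derivative_compose[OF this diff[OF seg]] show ?thesis using that unfolding \<psi>_def by simp
  qed
  obtain \<xi> where \<xi>: "0 < \<xi>" "\<xi> < 1" "\<psi> 1 - \<psi> 0 = G (x + \<xi> *\<^sub>R (w - x)) \<bullet> ((1 - 0) *\<^sub>R (w - x))"
    by (rule mvt[OF zero_less_one c d])
  have "\<bar>u x\<bar> = \<bar>G (x + \<xi> *\<^sub>R (w - x)) \<bullet> (w - x)\<bar>" using \<xi>(3) uw by (simp add: \<psi>_def)
  also have "\<dots> \<le> norm (G (x + \<xi> *\<^sub>R (w - x))) * norm (w - x)" by (rule Cauchy_Schwarz_ineq2)
  also have "\<dots> \<le> g * dist x w"
    using G[OF seg, of \<xi>] \<xi> by (auto simp: dist_norm norm_minus_commute intro: mult_right_mono)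
  finally have "g * R < g * dist x w" using R by simp
  moreover have "0 \<le> g" using G[OF x] norm_ge_zero order_trans by blast
  ultimately have "R < dist x w" by (simp add: mult_less_cancel_left)
  then show ?thesis using inball by (auto intro: inball)
qed

text \<open>The order of the equation is \<open>Suc k\<close>, so \<open>k = 0\<close> is the linear
  case. \<open>\<Sigma>\<close> lists signs s for which s u satisfies the one-sided comparison; by
  the first claim one of them sees a fixed fraction of |D^2 u|, which turns one-sided bounds into a
  bound for the norm.\<close>

lemma structure_bound:
  fixes u :: "real^'n \<Rightarrow> real" and f :: "(real^'n) \<times> real \<times> (real^'n) \<Rightarrow> real"
  assumes k: "Suc k < CARD('n)" and \<alpha>: "0 \<le> \<alpha>" and \<Omega>: "open \<Omega>"
    and u: "Ck_on 3 \<Omega> u" and adm: "admissible k \<Omega> u"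
    and eqn: "\<forall>x\<in>\<Omega>. sigma (Suc k) (eta_at u x) + \<alpha> * sigma k (eta_at u x) = F x"
    and F: "\<forall>x\<in>\<Omega>. 0 < F x"
  defines "\<Sigma> \<equiv> (if k = 0 then {1, -1} else {1 :: real})"
  shows "\<forall>x\<in>\<Omega>. \<exists>s\<in>\<Sigma>. \<exists>e. norm e = 1 \<and>
           1 / (real CARD('n))\<^sup>2 * norm (hessian u x) \<le> s * ((hessian u x *v e) \<bullet> e)"
    and "\<forall>s\<in>\<Sigma>. \<forall>x\<in>\<Omega>. \<exists>e a. orthonormal_frame e \<and> (\<forall>i. 1 / (real CARD('n) + 1) \<le> a i \<and> a i \<le> 1) \<and>
           (\<forall>y\<in>\<Omega>. - (real CARD('n) * \<bar>F y - F x\<bar> powr (1 / real (Suc k)))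
              \<le> (\<Sum>i\<in>UNIV. a i * (s * (((hessian u y - hessian u x) *v e i) \<bullet> e i))))"
proof -
  note eqn = bspec[OF eqn] and F = bspec[OF F]
  let ?n = "real CARD('n)" and ?H = "hessian u"
  have n: "2 \<le> ?n" using k by simp
  have sym: "transpose (?H x) = ?H x" if "x \<in> \<Omega>" for x
    using Ck_on_twice_diff_on[OF u \<Omega>] that by (simp add: twice_diff_on_def)
  have frame: "\<exists>e d. eigenframe (?H x) e d \<and> hat \<alpha> d \<in> esf_cone (Suc k) UNIV \<and> esf (Suc k) UNIV (hat \<alpha> d) = F x"
    if x: "x \<in> \<Omega>" for x
  proof -
    obtain e d where ed: "eigenframe (?H x) e d" by (rule symmetric_matrix_eigenframe[OF sym[OF x]])
    moreover have "0 < sigma (Suc k) (eta_at u x) + \<alpha> * sigma k (eta_at u x)"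
      unfolding eqn[OF x] by (rule F[OF x])
    from admissible_esf_cone[OF adm x ed \<alpha> this] have "hat \<alpha> d \<in> esf_cone (Suc k) UNIV" .
    ultimately show ?thesis using equation_as_esf[OF ed, of k \<alpha>] eqn[OF x] by auto
  qed
  have esf1: "esf 1 UNIV (hat \<alpha> d) = (?n - 1) * sum d UNIV + \<alpha>" for d :: "'n \<Rightarrow> real"
  proof -
    have "esf (Suc 0) UNIV (\<lambda>i. sum d UNIV - d i) = (\<Sum>i\<in>UNIV. sum d UNIV - d i)"
      using esf_sum_remove[of UNIV "\<lambda>i. sum d UNIV - d i" 0] by simp
    then show ?thesis by (simp add: esf_option sum_subtractf left_diff_distrib)
  qed
  show "\<forall>x\<in>\<Omega>. \<exists>s\<in>\<Sigma>. \<exists>e. norm e = 1 \<and> 1 / ?n\<^sup>2 * norm (?H x) \<le> s * ((?H x *v e) \<bullet> e)"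
  proof
    fix x assume x: "x \<in> \<Omega>"
    obtain e d where ed: "eigenframe (?H x) e d" and cone: "hat \<alpha> d \<in> esf_cone (Suc k) UNIV" using frame[OF x] by blast
    have e: "orthonormal_frame e" using ed by (simp add: eigenframe_def)
    have q: "(?H x *v e i) \<bullet> e i = d i" for i using ed e by (simp add: eigenframe_def orthonormal_frame_def)
    have "\<exists>s\<in>\<Sigma>. \<exists>i. norm (?H x) / ?n\<^sup>2 \<le> s * d i"
    proof (cases "k = 0")
      case True
      obtain i where i: "norm (?H x) / ?n \<le> \<bar>d i\<bar>" by (rule eigenvalue_ge_norm[OF ed sym[OF x]])
      have "norm (?H x) / ?n\<^sup>2 \<le> norm (?H x) / ?n"
        using n by (intro divide_left_mono) (auto simp: power2_eq_square)
      then have "norm (?H x) / ?n\<^sup>2 \<le> sgn (d i) * d i \<or> norm (?H x) / ?n\<^sup>2 \<le> 1 * d i"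
        using i by (simp add: sgn_if abs_if split: if_splits)
      then have "norm (?H x) / ?n\<^sup>2 \<le> 1 * d i \<or> norm (?H x) / ?n\<^sup>2 \<le> - 1 * d i"
        by (auto simp: sgn_if split: if_splits)
      then show ?thesis using True by (auto simp: \<Sigma>_def)
    next
      case False
      \<comment> \<open>For k > 0 admissibility includes order one, and the sum of the entries of
        \<eta> is n - 1 times the trace; hence the trace is positive.\<close>
      have "eigenvalues (?H x) \<in> Gamma' k" using adm x by (simp add: admissible_def)
      then have "0 < sigma 1 (eta (eigenvalues (?H x)))" using False by (simp add: Gamma'_def)
      moreover obtain \<pi> where \<pi>: "\<pi> permutes UNIV" "\<And>i. eigenvalues (?H x) $ i = d (\<pi> i)"
        by (rule eigenvalues_eigenframe[OF ed]) blast
      ultimately have "0 < esf 1 UNIV (\<lambda>i. sum d UNIV - d i)" using eta_permuted[OF \<pi>] by simp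
      also have "\<dots> = (?n - 1) * sum d UNIV"
        using esf1[of d] by (simp add: esf_option)
      finally have "0 \<le> sum d UNIV" using n by (simp add: zero_less_mult_iff)
      from positive_eigenvalue_ge_norm[OF ed sym[OF x] this]
      obtain i where "norm (?H x) / ?n\<^sup>2 \<le> d i" by blast
      then show ?thesis using False by (auto simp: \<Sigma>_def)
    qed
    then obtain s i where "s \<in> \<Sigma>" "norm (?H x) / ?n\<^sup>2 \<le> s * d i" by blast
    then show "\<exists>s\<in>\<Sigma>. \<exists>e. norm e = 1 \<and> 1 / ?n\<^sup>2 * norm (?H x) \<le> s * ((?H x *v e) \<bullet> e)"
      using orthonormal_frame_norm[OF e, of i] q[of i] by (intro bexI[of _ s] exI[of _ "e i"]) auto
  qed
  show "\<forall>s\<in>\<Sigma>. \<forall>x\<in>\<Omega>. \<exists>e a. orthonormal_frame e \<and> (\<forall>i. 1 / (?n + 1) \<le> a i \<and> a i \<le> 1) \<and>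
           (\<forall>y\<in>\<Omega>. - (?n * \<bar>F y - F x\<bar> powr (1 / real (Suc k)))
              \<le> (\<Sum>i\<in>UNIV. a i * (s * (((?H y - ?H x) *v e i) \<bullet> e i))))"
  proof (intro ballI)
    fix s x assume s: "s \<in> \<Sigma>" and x: "x \<in> \<Omega>"
    obtain e d where ed: "eigenframe (?H x) e d" and cone: "hat \<alpha> d \<in> esf_cone (Suc k) UNIV"
      and Fx: "esf (Suc k) UNIV (hat \<alpha> d) = F x" using frame[OF x] by blast
    have e: "orthonormal_frame e" using ed by (simp add: eigenframe_def)
    show "\<exists>e a. orthonormal_frame e \<and> (\<forall>i. 1 / (?n + 1) \<le> a i \<and> a i \<le> 1) \<and>
           (\<forall>y\<in>\<Omega>. - (?n * \<bar>F y - F x\<bar> powr (1 / real (Suc k)))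
              \<le> (\<Sum>i\<in>UNIV. a i * (s * (((?H y - ?H x) *v e i) \<bullet> e i))))"
    proof (cases "s = 1")
      case True
      obtain a where a: "\<And>i. 1 / (?n + 1) \<le> a i" "\<And>i. a i \<le> 1"
        and ge: "\<And>B v \<mu>. eigenframe B v \<mu> \<Longrightarrow> hat \<alpha> \<mu> \<in> esf_cone (Suc k) UNIV
        \<Longrightarrow> - (?n * \<bar>esf (Suc k) UNIV (hat \<alpha> \<mu>) - esf (Suc k) UNIV (hat \<alpha> d)\<bar> powr (1 / real (Suc k)))
         \<le> (\<Sum>i\<in>UNIV. a i * (((B - ?H x) *v e i) \<bullet> e i))"
        by (rule supporting_frame_Hoelder[OF ed cone k]) (rule that, assumption+)
      have "- (?n * \<bar>F y - F x\<bar> powr (1 / real (Suc k))) \<le> (\<Sum>i\<in>UNIV. a i * (s * (((?H y - ?H x) *v e i) \<bullet> e i)))"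
        if y: "y \<in> \<Omega>" for y
      proof -
        obtain v \<mu> where v: "eigenframe (?H y) v \<mu>" "hat \<alpha> \<mu> \<in> esf_cone (Suc k) UNIV"
          "esf (Suc k) UNIV (hat \<alpha> \<mu>) = F y" using frame[OF y] by blast
        show ?thesis using ge[OF v(1,2)] unfolding v(3) Fx True mult_1_left .
      qed
      then show ?thesis using e a by blast
    next
      case False
      then have k0: "k = 0" and s1: "s = -1" using s by (auto simp: \<Sigma>_def split: if_splits)
      \<comment> \<open>For order one the equation is affine in the trace, so unit weights in any
        frame serve the sign -1.\<close>
      have tr: "F y = (?n - 1) * trace (?H y) + \<alpha>" if y: "y \<in> \<Omega>" for y
      proof -
        obtain v \<mu> where v: "eigenframe (?H y) v \<mu>" "esf (Suc k) UNIV (hat \<alpha> \<mu>) = F y" using frame[OF y] by blast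
        have "trace (?H y) = sum \<mu> UNIV"
          using v(1) trace_orthonormal_frame[of v "?H y"] by (simp add: eigenframe_def orthonormal_frame_def)
        then show ?thesis using v(2) esf1[of \<mu>] k0 by simp
      qed
      have "- (?n * \<bar>F y - F x\<bar> powr (1 / real (Suc k))) \<le> (\<Sum>i\<in>UNIV. 1 * (s * (((?H y - ?H x) *v e i) \<bullet> e i)))"
        if y: "y \<in> \<Omega>" for y
      proof -
        let ?t = "trace (?H y - ?H x)"
        have "(\<Sum>i\<in>UNIV. 1 * (s * (((?H y - ?H x) *v e i) \<bullet> e i))) = - ?t"
          using trace_orthonormal_frame[OF e, of "?H y - ?H x"] by (simp add: s1 sum_negf)
        moreover have "?t = trace (?H y) - trace (?H x)" by (simp add: trace_def sum_subtractf)
        then have "F y - F x = (?n - 1) * ?t" using tr[OF y] tr[OF x] by (simp add: right_diff_distrib)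
        then have "\<bar>F y - F x\<bar> = (?n - 1) * \<bar>?t\<bar>" using n by (simp add: abs_mult)
        moreover have "1 * \<bar>?t\<bar> \<le> (?n - 1) * \<bar>?t\<bar>" using n by (intro mult_right_mono) auto
        moreover have "1 * \<bar>F y - F x\<bar> \<le> ?n * \<bar>F y - F x\<bar>" using n by (intro mult_right_mono) auto
        ultimately show ?thesis using k0 by simp
      qed
      moreover have "1 / (?n + 1) \<le> 1" by (simp add: divide_le_eq)
      ultimately show ?thesis using e by (intro exI[of _ e] exI[of _ "\<lambda>_. 1"]) auto
    qed
  qed
qed

section \<open>Assembly of the estimate\<close>

lemma norm_gradient_le: "norm (gradient u x) \<le> (\<Sum>b\<in>Basis. \<bar>partial_deriv [b] u x\<bar>)"
  using norm_le_l1_cart[of "gradient u x"] by (simp only: gradient_def vec_lambda_beta sum_Basis_vec)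

lemma Lipschitz_twice_diff_on:
  fixes u :: "real^'n \<Rightarrow> real"
  assumes u: "twice_diff_on S u G H" and S: "convex S"
    and G: "\<And>z. z \<in> S \<Longrightarrow> norm (G z) \<le> g" and H: "\<And>z. z \<in> S \<Longrightarrow> norm (H z) \<le> M"
    and xy: "x \<in> S" "y \<in> S"
  shows "\<bar>u y - u x\<bar> \<le> g * norm (y - x)" "norm (G y - G x) \<le> M * norm (y - x)"
proof -
  have "norm (u y - u x) \<le> g * norm (y - x)"
  proof (rule differentiable_bound[OF S])
    fix z assume z: "z \<in> S"
    show "(u has_derivative (\<lambda>h. G z \<bullet> h)) (at z within S)"
      using u z by (auto simp: twice_diff_on_def intro: has_derivative_at_withinI)
    show "onorm (\<lambda>h. G z \<bullet> h) \<le> g"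
    proof (rule onorm_le)
      fix h
      have "norm (G z \<bullet> h) \<le> norm (G z) * norm h" using Cauchy_Schwarz_ineq2 by simp
      also have "\<dots> \<le> g * norm h" by (intro mult_right_mono G z) simp
      finally show "norm (G z \<bullet> h) \<le> g * norm h" .
    qed
  qed (use xy in auto)
  then show "\<bar>u y - u x\<bar> \<le> g * norm (y - x)" by simp
  show "norm (G y - G x) \<le> M * norm (y - x)"
  proof (rule differentiable_bound[OF S])
    fix z assume z: "z \<in> S"
    show "(G has_derivative (\<lambda>h. H z *v h)) (at z within S)"
      using u z by (auto simp: twice_diff_on_def intro: has_derivative_at_withinI)
    show "onorm (\<lambda>h. H z *v h) \<le> M"
    proof (rule onorm_le)
      fix h
      have "norm (H z *v h) \<le> norm (H z) * norm h" by (rule norm_matrix_vector_le)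
      also have "\<dots> \<le> M * norm h" by (intro mult_right_mono H z) simp
      finally show "norm (H z *v h) \<le> M * norm h" .
    qed
  qed (use xy in auto)
qed

text \<open>The triples (x, u, Du) lie in a product of convex sets on which the norm of f is taken,
  and vary at rate at most 1 + q + M; the bound (1 + q)(1 + M) has the form expected by
  \<open>interior_hessian_bound\<close>.\<close>

lemma Lipschitz_data:
  fixes u :: "real^'n \<Rightarrow> real" and f :: "(real^'n) \<times> real \<times> (real^'n) \<Rightarrow> real"
  assumes \<Omega>: "open \<Omega>" "bounded \<Omega>" and f: "Ck_closure 2 (\<Omega> \<times> UNIV \<times> UNIV) f"
    and S: "S \<subseteq> \<Omega>" "convex S" and u: "twice_diff_on S u G H"
    and q: "\<And>z. z \<in> S \<Longrightarrow> \<bar>u z\<bar> \<le> q" "\<And>z. z \<in> S \<Longrightarrow> norm (G z) \<le> q" "q \<le> r"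
    and M: "\<And>z. z \<in> S \<Longrightarrow> norm (H z) \<le> M" and xy: "x \<in> S" "y \<in> S"
  shows "\<bar>f (y, u y, G y) - f (x, u x, G x)\<bar> \<le> C2_norm_data \<Omega> r f * (1 + q) * (1 + M) * dist x y"
proof -
  let ?D = "S \<times> {-r..r} \<times> cball (0 :: real^'n) r" and ?p = "C2_norm_data \<Omega> r f"
  have inD: "(z, u z, G z) \<in> ?D" if "z \<in> S" for z
    using q(1)[OF that] q(2)[OF that] q(3) that by auto
  have bound: "\<bar>f w\<bar> + (\<Sum>b\<in>Basis. \<bar>partial_deriv [b] f w\<bar>) \<le> ?p" if "w \<in> ?D" for w
    unfolding C2_norm_data_def
    by (rule Ck_norm_ge_first_order[OF Ck_closure_bdd_data[OF f \<Omega>(2)]]) (use that S in auto)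
  have f2: "Ck_on 2 (\<Omega> \<times> UNIV \<times> UNIV) f" using f by (simp add: Ck_closure_def)
  have p0: "0 \<le> ?p"
    by (rule order_trans[OF _ bound[OF inD[OF xy(1)]]]) (intro add_nonneg_nonneg sum_nonneg abs_ge_zero)
  have le: "\<bar>f (y, u y, G y) - f (x, u x, G x)\<bar> \<le> ?p * norm ((y, u y, G y) - (x, u x, G x))"
  proof (rule Lipschitz_on_convex[OF f2])
    show "open (\<Omega> \<times> (UNIV :: real set) \<times> (UNIV :: (real^'n) set))" using \<Omega> by (intro open_Times) auto
    show "?D \<subseteq> \<Omega> \<times> UNIV \<times> UNIV" using S by auto
    show "convex ?D" using S by (intro convex_Times) auto
    show "(\<Sum>b\<in>Basis. \<bar>partial_deriv [b] f w\<bar>) \<le> ?p" if "w \<in> ?D" for w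
      using bound[OF that] by linarith
  qed (use inD xy in auto)
  have "norm ((y, u y, G y) - (x, u x, G x)) \<le> norm (y - x) + \<bar>u y - u x\<bar> + norm (G y - G x)"
    using norm_triple_le[of "y - x" "u y - u x" "G y - G x"] by simp
  also have "\<dots> \<le> norm (y - x) + q * norm (y - x) + M * norm (y - x)"
    using Lipschitz_twice_diff_on[OF u S(2) q(2) M xy] by (intro add_mono) auto
  also have "\<dots> = (1 + q + M) * norm (y - x)" by (simp add: algebra_simps)
  also have "\<dots> \<le> ((1 + q) * (1 + M)) * norm (y - x)"
  proof (rule mult_right_mono)
    have "0 \<le> q" using q(1)[OF xy(1)] by linarith
    moreover have "0 \<le> M" using M[OF xy(1)] norm_ge_zero order_trans by blast
    ultimately have "0 \<le> q * M" by simp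
    then show "1 + q + M \<le> (1 + q) * (1 + M)" by (simp add: algebra_simps)
  qed simp
  finally have "?p * norm ((y, u y, G y) - (x, u x, G x)) \<le> ?p * (((1 + q) * (1 + M)) * norm (y - x))"
    using p0 by (rule mult_left_mono)
  then show ?thesis using le by (simp add: dist_norm norm_minus_commute mult.assoc)
qed

text \<open>The values p and q of the norms are prescribed before the domain, the data and the
  solution, so that C can depend on them alone.\<close>

lemma hessian_estimate:
  fixes p q :: real
  assumes k: "Suc k < CARD('n::finite)"
  shows "\<exists>C. \<forall>\<alpha> (\<Omega> :: (real^'n) set) f u. 0 \<le> \<alpha> \<longrightarrow> bounded_domain \<Omega> \<longrightarrow>
    Ck_closure 2 (\<Omega> \<times> UNIV \<times> UNIV) f \<longrightarrow> (\<forall>x\<in>closure \<Omega>. \<forall>z p. f (x, z, p) > 0) \<longrightarrow>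
    Ck_on 4 \<Omega> u \<longrightarrow> Ck_closure 2 \<Omega> u \<longrightarrow> admissible k \<Omega> u \<longrightarrow> dirichlet_solution (Suc k) \<alpha> \<Omega> f u \<longrightarrow>
    Ck_norm 1 \<Omega> u = q \<longrightarrow> C2_norm_data \<Omega> (q + 1) f = p \<longrightarrow> (\<forall>x\<in>\<Omega>. - u x * norm (hessian u x) \<le> C)"
proof -
  let ?n = "real CARD('n)"
  \<comment> \<open>At this point p and q are arbitrary reals; truncation keeps the interior
    estimate applicable for values that no norm takes.\<close>
  define g where "g = max 0 q"
  define L where "L = max 0 p * (1 + g)"
  have g: "0 \<le> g" "q \<le> g" by (auto simp: g_def)
  have L: "0 \<le> L" using g by (simp add: L_def)
  obtain R\<^sub>0 N where R0: "0 < R\<^sub>0" and N: "\<forall>(u :: real^'n \<Rightarrow> real) G H x\<^sub>0 R F \<Sigma>. 0 < R \<longrightarrow> R \<le> R\<^sub>0 \<longrightarrow> \<Sigma> \<subseteq> {1, -1} \<longrightarrow>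
      twice_diff_on (cball x\<^sub>0 R) u G H \<longrightarrow> continuous_on (cball x\<^sub>0 R) H \<longrightarrow>
      (\<forall>x\<in>cball x\<^sub>0 R. norm (G x) \<le> g) \<longrightarrow>
      (\<forall>x\<in>cball x\<^sub>0 R. \<exists>s\<in>\<Sigma>. \<exists>e. norm e = 1 \<and> 1 / ?n\<^sup>2 * norm (H x) \<le> s * ((H x *v e) \<bullet> e)) \<longrightarrow>
      (\<forall>s\<in>\<Sigma>. \<forall>x\<in>cball x\<^sub>0 R. \<exists>e a. orthonormal_frame e \<and> (\<forall>i. 1 / (?n + 1) \<le> a i \<and> a i \<le> 1) \<and>
         (\<forall>y\<in>cball x\<^sub>0 R. - (?n * \<bar>F y - F x\<bar> powr (1 / real (Suc k)))
            \<le> (\<Sum>i\<in>UNIV. a i * (s * (((H y - H x) *v e i) \<bullet> e i))))) \<longrightarrow>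
      (\<forall>S M. S \<subseteq> cball x\<^sub>0 R \<longrightarrow> convex S \<longrightarrow> (\<forall>x\<in>S. norm (H x) \<le> M) \<longrightarrow>
         (\<forall>x\<in>S. \<forall>y\<in>S. \<bar>F y - F x\<bar> \<le> L * (1 + M) * dist x y)) \<longrightarrow>
      R * norm (H x\<^sub>0) \<le> N"
  proof -
    have "0 < 1 / (?n + 1)" "0 < 1 / real (Suc k)" "1 / real (Suc k) \<le> 1" "0 < 1 / ?n\<^sup>2" "0 \<le> ?n"
      by auto
    from interior_hessian_bound[where 'n='n, OF this L g(1)] show ?thesis
      by (elim exE conjE) (rule that)
  qed
  \<comment> \<open>The two summands match the two terms in the minimum that defines R below, and
    give -u x <= (g / R0 + 2 (g + 1)) R in either case.\<close>
  define C where "C = (g / R\<^sub>0 + 2 * (g + 1)) * max 0 N"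
  have C: "0 \<le> C" using g R0 by (simp add: C_def)
  have "- u x * norm (hessian u x) \<le> C"
    if \<alpha>: "0 \<le> \<alpha>" and dom: "bounded_domain \<Omega>" and f: "Ck_closure 2 (\<Omega> \<times> UNIV \<times> UNIV) f"
      and fpos: "\<forall>x\<in>closure \<Omega>. \<forall>z p. f (x, z, p) > 0" and u4: "Ck_on 4 \<Omega> u" and ucl: "Ck_closure 2 \<Omega> u"
      and adm: "admissible k \<Omega> u" and sol: "dirichlet_solution (Suc k) \<alpha> \<Omega> f u" and uq: "Ck_norm 1 \<Omega> u = q"
      and fp: "C2_norm_data \<Omega> (q + 1) f = p" and x: "x \<in> \<Omega>"
    for \<alpha> and \<Omega> :: "(real^'n) set" and f u x
  proof (cases "0 \<le> u x")
    case True
    then have "- u x * norm (hessian u x) \<le> 0" by simp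
    then show ?thesis using C by linarith
  next
    case False
    have \<Omega>: "open \<Omega>" "bounded \<Omega>" using dom by (auto simp: bounded_domain_def)
    have u3: "Ck_on 3 \<Omega> u" and u2: "Ck_on 2 \<Omega> u" by (rule Ck_on_mono[OF u4]; simp)+
    note tw = Ck_on_twice_diff_on[OF u3 \<Omega>(1)]
    define F where "F = (\<lambda>y. f (y, u y, gradient u y))"
    have first: "\<bar>u y\<bar> + norm (gradient u y) \<le> q" if "y \<in> \<Omega>" for y
      using Ck_norm_ge_first_order[OF Ck_closure_bdd[OF ucl \<Omega>(2) _ one_le_numeral] that order_refl]
        norm_gradient_le[of u y] unfolding uq by linarith
    have uy: "\<bar>u y\<bar> \<le> q" and Gy: "norm (gradient u y) \<le> q" if "y \<in> \<Omega>" for y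
      using first[OF that] norm_ge_zero[of "gradient u y"] abs_ge_zero[of "u y"] by linarith+
    have q0: "0 \<le> q" using uy[OF x] by linarith
    then have gq: "g = q" by (simp add: g_def)
    let ?t = "- u x"
    have t: "0 < ?t" "?t \<le> q" using False uy[OF x] by auto
    \<comment> \<open>The second term makes q R smaller than -u x, as \<open>ball_in_domain\<close>
      requires; q + 1 instead of q avoids division by zero.\<close>
    define R where "R = min R\<^sub>0 (?t / (2 * (q + 1)))"
    have "0 < ?t / (2 * (q + 1))" using t(1) q0 by (intro divide_pos_pos) auto
    then have R: "0 < R" "R \<le> R\<^sub>0" using R0 by (auto simp: R_def)
    have "R \<le> ?t / (2 * (q + 1))" unfolding R_def by (rule min.cobounded2)
    then have "R * (2 * (q + 1)) \<le> ?t" by (subst (asm) pos_le_divide_eq) (use q0 in auto)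
    then have "2 * (q + 1) * R \<le> ?t" by (simp only: mult.commute)
    moreover have "q * R < 2 * (q + 1) * R" using R q0 by (intro mult_strict_right_mono) auto
    ultimately have Rt: "q * R < \<bar>u x\<bar>" by linarith
    have sub: "cball x R \<subseteq> \<Omega>"
    proof (rule ball_in_domain[where G="gradient u", OF \<Omega> x])
      show "continuous_on (closure \<Omega>) u" using ucl by (simp add: Ck_closure_def)
      show "(u has_derivative (\<lambda>h. gradient u y \<bullet> h)) (at y)" if "y \<in> \<Omega>" for y
        using tw that by (simp add: twice_diff_on_def)
      show "u y = 0" if "y \<in> frontier \<Omega>" for y using sol that by (simp add: dirichlet_solution_def)
    qed (use Gy Rt R in auto)
    have eqn: "\<forall>y\<in>\<Omega>. sigma (Suc k) (eta_at u y) + \<alpha> * sigma k (eta_at u y) = F y"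
      using sol by (simp add: dirichlet_solution_def F_def)
    have Fpos: "\<forall>y\<in>\<Omega>. 0 < F y"
      using fpos closure_subset[of \<Omega>] by (auto simp: F_def)
    note struct = structure_bound[OF k \<alpha> \<Omega>(1) u3 adm eqn Fpos]
    have RN: "R * norm (hessian u x) \<le> N"
    proof (rule N[rule_format, OF R, where \<Sigma>="if k = 0 then {1, -1} else {1}" and G="gradient u" and u=u and F=F])
      show "twice_diff_on (cball x R) u (gradient u) (hessian u)" using tw sub by (auto simp: twice_diff_on_def)
      show "continuous_on (cball x R) (hessian u)" by (rule continuous_on_subset[OF continuous_on_hessian[OF u2] sub])
      show "norm (gradient u y) \<le> g" if "y \<in> cball x R" for y using Gy that sub by (auto simp: gq)
      show "\<exists>s\<in>if k = 0 then {1, -1} else {1}. \<exists>e. norm e = 1 \<and>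
          1 / ?n\<^sup>2 * norm (hessian u y) \<le> s * ((hessian u y *v e) \<bullet> e)" if "y \<in> cball x R" for y
        using struct(1) that sub by blast
      show "\<exists>e a. orthonormal_frame e \<and>
          (\<forall>i. 1 / (?n + 1) \<le> a i \<and> a i \<le> 1) \<and>
          (\<forall>z\<in>cball x R. - (?n * \<bar>F z - F y\<bar> powr (1 / real (Suc k)))
            \<le> (\<Sum>i\<in>UNIV. a i * (s * (((hessian u z - hessian u y) *v e i) \<bullet> e i))))"
        if s: "s \<in> (if k = 0 then {1, -1} else {1})" and y: "y \<in> cball x R" for s y
      proof -
        obtain e a where "orthonormal_frame e" "\<forall>i. 1 / (?n + 1) \<le> a i \<and> a i \<le> 1"
          "\<forall>z\<in>\<Omega>. - (?n * \<bar>F z - F y\<bar> powr (1 / real (Suc k)))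
              \<le> (\<Sum>i\<in>UNIV. a i * (s * (((hessian u z - hessian u y) *v e i) \<bullet> e i)))"
          using struct(2)[rule_format, OF s subsetD[OF sub y]] by (elim exE conjE) (rule that)
        then show ?thesis using sub by (intro exI[of _ e] exI[of _ a] conjI) auto
      qed
      show "\<bar>F z - F y\<bar> \<le> L * (1 + M) * dist y z"
        if S: "S \<subseteq> cball x R" "convex S" and M: "\<And>y. y \<in> S \<Longrightarrow> norm (hessian u y) \<le> M" and yz: "y \<in> S" "z \<in> S"
        for S M y z
      proof -
        have S\<Omega>: "S \<subseteq> \<Omega>" using S(1) sub by blast
        have twS: "twice_diff_on S u (gradient u) (hessian u)" using tw S\<Omega> by (auto simp: twice_diff_on_def)
        have "\<bar>F z - F y\<bar> \<le> C2_norm_data \<Omega> (q + 1) f * (1 + q) * (1 + M) * dist y z"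
          unfolding F_def
        proof (rule Lipschitz_data[OF \<Omega> f S\<Omega> S(2) twS])
          show "\<bar>u w\<bar> \<le> q" "norm (gradient u w) \<le> q" "norm (hessian u w) \<le> M" if "w \<in> S" for w
            using that S\<Omega> uy Gy M by auto
        qed (use yz in auto)
        also have "\<dots> \<le> L * (1 + M) * dist y z"
        proof -
          have "0 \<le> M" using M yz norm_ge_zero order_trans by blast
          then show ?thesis unfolding fp L_def gq using q0 by (intro mult_right_mono) auto
        qed
        finally show "\<bar>F z - F y\<bar> \<le> L * (1 + M) * dist y z" .
      qed
    qed simp
    have "?t \<le> (g / R\<^sub>0 + 2 * (g + 1)) * R"
    proof (cases "R = R\<^sub>0")
      case True
      then have "(g / R\<^sub>0 + 2 * (g + 1)) * R = q + 2 * (q + 1) * R" using R0 by (simp add: gq field_simps)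
      moreover have "0 \<le> 2 * (q + 1) * R" using q0 R by simp
      ultimately show ?thesis using t by linarith
    next
      case False
      then have "R = ?t / (2 * (q + 1))" by (auto simp: R_def min_def)
      then have "?t = 2 * (q + 1) * R" using q0 by simp
      moreover have "0 \<le> q / R\<^sub>0 * R" using q0 R0 R by simp
      ultimately show ?thesis by (simp add: gq distrib_right)
    qed
    then have "?t * norm (hessian u x) \<le> (g / R\<^sub>0 + 2 * (g + 1)) * R * norm (hessian u x)"
      by (rule mult_right_mono) simp
    also have "\<dots> = (g / R\<^sub>0 + 2 * (g + 1)) * (R * norm (hessian u x))" by simp
    also have "\<dots> \<le> C" unfolding C_def using RN g R0 by (intro mult_left_mono) auto
    finally show ?thesis .
  qed
  then show ?thesis by blast
qed

theorem theorem3: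
  fixes k :: nat
  assumes "0 < k" and "k < CARD('n::finite)"
  shows "\<exists>C :: real \<Rightarrow> real \<Rightarrow> real.
    \<forall>(\<alpha>::real) (\<Omega>::(real^'n) set)
      (f :: (real^'n) \<times> real \<times> (real^'n) \<Rightarrow> real) (u :: real^'n \<Rightarrow> real).
      \<alpha> \<ge> 0 \<longrightarrow>
      bounded_domain \<Omega> \<longrightarrow>
      Ck_closure 2 (\<Omega> \<times> UNIV \<times> UNIV) f \<longrightarrow>
      (\<forall>x\<in>closure \<Omega>. \<forall>z p. f (x, z, p) > 0) \<longrightarrow>
      Ck_on 4 \<Omega> u \<longrightarrow>
      Ck_closure 2 \<Omega> u \<longrightarrow>
      admissible (k - 1) \<Omega> u \<longrightarrow>
      dirichlet_solution k \<alpha> \<Omega> f u \<longrightarrow>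
      (\<forall>x\<in>\<Omega>. - u x * norm (hessian u x)
         \<le> C (C2_norm_data \<Omega> (Ck_norm 1 \<Omega> u + 1) f) (Ck_norm 1 \<Omega> u))"
proof -
  obtain l where k: "k = Suc l" using assms(1) by (cases k) auto
  have "Suc l < CARD('n)" using assms(2) k by simp
  \<comment> \<open>One constant is selected for each pair of norm values, which makes C a function
    of the two norms.\<close>
  from choice[OF allI[OF choice[OF allI[OF hessian_estimate[OF this]]]]]
  obtain C where C: "\<forall>p q \<alpha> (\<Omega> :: (real^'n) set) f u. 0 \<le> \<alpha> \<longrightarrow> bounded_domain \<Omega> \<longrightarrow>
    Ck_closure 2 (\<Omega> \<times> UNIV \<times> UNIV) f \<longrightarrow> (\<forall>x\<in>closure \<Omega>. \<forall>z p. f (x, z, p) > 0) \<longrightarrow>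
    Ck_on 4 \<Omega> u \<longrightarrow> Ck_closure 2 \<Omega> u \<longrightarrow> admissible l \<Omega> u \<longrightarrow> dirichlet_solution (Suc l) \<alpha> \<Omega> f u \<longrightarrow>
    Ck_norm 1 \<Omega> u = q \<longrightarrow> C2_norm_data \<Omega> (q + 1) f = p \<longrightarrow> (\<forall>x\<in>\<Omega>. - u x * norm (hessian u x) \<le> C p q)"
    by (rule exE)
  then show ?thesis unfolding k by (intro exI[of _ C]) simp
qed

end
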